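(* Let $\bar u\in L^2(0,T;U)$ be the unique minimizer of $\hat J$ over $L^2(0,T;U)$ and let $\tilde u\in L^2(0,T;U)$ be arbitrary. Define $$\bar\Delta(\tilde u)=\tfrac1\beta\,|\nabla\hat J(\tilde u)|_{L^2(0,T;U)},\qquad \underline\Delta(\tilde u)=\tfrac{1}{\beta+\|C\mathcal S\|^2}\,|\nabla\hat J(\tilde u)|_{L^2(0,T;U)},\qquad e_u(\tilde u)=|\bar u-\tilde u|_{L^2(0,T;U)}.$$ Then $$\underline\Delta(\tilde u)\le e_u(\tilde u)\le\bar\Delta(\tilde u).$$
   Context: Setting: $T>0$; $U,V,H$ are real separable Hilbert spaces with $V\subset H$ compactly and densely embedded; $H$ is identified with its dual, so $V\subset H\subset V'$. $\mathcal L(X,Y)$ is the space of bounded linear operators, $|\cdot|_X$ the norm of $X$, $\mathcal J_X:X\to X'$ the Riesz isomorphism, and $W(0,T)=H^1(0,T;V')\cap L^2(0,T;V)$. For $B\in\mathcal L(U,V')$ the dual operator $B'\in\mathcal L(V,U')$ is defined by $\langle B'v,u\rangle_{U',U}=\langle Bu,v\rangle_{V',V}$; $A'(t)$ and $C'(t)$ are the dual (adjoint) operators of $A(t)$ and $C(t)$. Assumptions: (A1) $A\in L^\infty(0,T;\mathcal L(V,V'))$ and there is $\eta_V>0$ with $\langle A(t)v,v\rangle_{V',V}\ge\eta_V|v|_V^2$ for all $t\in(0,T)$, $v\in V$. (A2) $C\in L^\infty(0,T;\mathcal L(H,H))$, $B\in\mathcal L(U,V')$, $\beta>0$, $y_d\in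 L^2(0,T;H)$, $y_0\in H$. Measurability of $A$ means that $t\mapsto\langle A(t)v,w\rangle_{V',V}$ is measurable for all $v,w\in V$, and analogously for $C$. Full-order problem: for $u\in L^2(0,T;U)$, the state $y=y(u)\in W(0,T)$ is the unique solution of $$\partial_t y(t)+A(t)y(t)=Bu(t)\ \text{ in }V'\text{ for a.e. }t\in(0,T),\qquad y(0)=y_0\ \text{ in }H,$$ and $$\hat J(u)=\int_0^T\tfrac12|C(t)y(t)-y_d(t)|_H^2+\tfrac\beta2|u(t)|_U^2\,dt,\qquad y=y(u).$$ For $y\in L^2(0,T;H)$, the adjoint state $p=p(y)\in W(0,T)$ is the unique solution of $$-\partial_t p(t)+A'(t)p(t)=C'(t)(C(t)y(t)-y_d(t))\ \text{ in }V'\text{ for a.e. }t\in(0,T),\qquad p(T)=0\ \text{ in }H.$$ $\nabla\hat J(u)\in L^2(0,T;U)$ is the gradient (Riesz representative of the derivative), $\nabla\hat J(u)=\mathcal J_U^{-1}B'p(y(u))+\beta u$. The functional $\hat J$ is strictly convex and has a unique minimizer $\bar u$. $\mathcal S\in\mathcal L(L^2(0,T;U),W(0,T))$ is the linear solution operator $u\mapsto y$ of the state equation with $y_0=0$, and $C\mathcal S\in\mathcal L(L^2(0,T;U),L^2(0,T;H))$ is given by $(C\mathcal Su)(t)=C(t)(\mathcal Su)(t)$, with operator norm $\|C\mathcal S\|$. *)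

theory Defs
  imports "HOL-Analysis.Analysis"
begin

text \<open>
  The dual of a normed space \<open>'v\<close> is \<open>'v \<Rightarrow>\<^sub>L real\<close>.  The embedding of V into H is a bounded linear
  map \<open>\<iota> :: 'v \<Rightarrow>\<^sub>L 'h\<close>.  Elements of Bochner spaces over (0,T) are represented by functions on the
  real line, of which only the values almost everywhere in (0,T) matter.
\<close>


subsection \<open>Gelfand triples and dual operators\<close>

definition compact_dense_embedding :: "('v::real_normed_vector \<Rightarrow>\<^sub>L 'h::real_normed_vector) \<Rightarrow> bool" where
  "compact_dense_embedding \<iota> \<longleftrightarrow>
     inj (blinfun_apply \<iota>) \<and> closure (range (blinfun_apply \<iota>)) = UNIV \<and>
     compact (closure (blinfun_apply \<iota> ` cball 0 1))"

text \<open>The inclusion of H into V': \<open>h\<close> acts on V as \<open>v \<mapsto> \<langle>h, v\<rangle>\<^sub>H\<close>.\<close>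

definition to_dual :: "('v::real_normed_vector \<Rightarrow>\<^sub>L 'h::real_inner) \<Rightarrow> 'h \<Rightarrow> 'v \<Rightarrow>\<^sub>L real" where
  "to_dual \<iota> h = blinfun_inner_right h o\<^sub>L \<iota>"

definition dual_op ::
  "('a::real_normed_vector \<Rightarrow>\<^sub>L 'b::real_normed_vector \<Rightarrow>\<^sub>L real) \<Rightarrow> 'b \<Rightarrow>\<^sub>L 'a \<Rightarrow>\<^sub>L real" where
  "dual_op F = Blinfun (\<lambda>b. Blinfun (\<lambda>a. F a b))"

text \<open>The two nested \<^const>\<open>Blinfun\<close> are applied to bounded linear maps only:\<close>

lemma dual_op_apply: "dual_op F b a = F a b"
proof -
  have bil: "bounded_bilinear (\<lambda>b a. F a b)"
    by (rule bounded_bilinear.flip, rule bounded_bilinear.comp1[OF bounded_bilinear_blinfun_apply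
          blinfun.bounded_linear_right])
  have inner: "blinfun_apply (Blinfun (\<lambda>a. F a b)) = (\<lambda>a. F a b)" for b
    by (rule bounded_linear_Blinfun_apply[OF bounded_bilinear.bounded_linear_right[OF bil]])
  obtain K where K: "\<And>b a. norm (F a b) \<le> norm b * norm a * K" and "K \<ge> 0"
    using bounded_bilinear.nonneg_bounded[OF bil] by blast
  have "bounded_linear (\<lambda>b. Blinfun (\<lambda>a. F a b))"
  proof (rule bounded_linear_intro)
    show "norm (Blinfun (\<lambda>a. F a x)) \<le> norm x * K" for x
      using K[where b = x] \<open>K \<ge> 0\<close> by (intro norm_blinfun_bound) (auto simp: inner mult_ac)
  qed (rule blinfun_eqI, unfold plus_blinfun.rep_eq scaleR_blinfun.rep_eq inner,
      simp add: blinfun.add_right blinfun.scaleR_right)+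
  then show ?thesis
    unfolding dual_op_def by (simp add: bounded_linear_Blinfun_apply inner)
qed

definition riesz :: "'a::real_inner \<Rightarrow> 'a \<Rightarrow>\<^sub>L real" where
  "riesz = blinfun_inner_right"


subsection \<open>Bochner spaces over (0,T)\<close>

abbreviation time :: "real \<Rightarrow> real measure" where
  "time T \<equiv> lebesgue_on {0<..<T}"

definition Ltwo :: "real \<Rightarrow> (real \<Rightarrow> 'a::real_normed_vector) set" where
  "Ltwo T = {f. f \<in> borel_measurable (time T) \<and> integrable (time T) (\<lambda>t. (norm (f t))\<^sup>2)}"

definition Ltwo_norm :: "real \<Rightarrow> (real \<Rightarrow> 'a::real_normed_vector) \<Rightarrow> real" where
  "Ltwo_norm T f = sqrt (LINT t|time T. (norm (f t))\<^sup>2)"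

text \<open>The quotient is 0 for null functions, since division by 0 yields 0.\<close>

definition Ltwo_opnorm ::
  "real \<Rightarrow> ((real \<Rightarrow> 'a::real_normed_vector) \<Rightarrow> real \<Rightarrow> 'b::real_normed_vector) \<Rightarrow> real" where
  "Ltwo_opnorm T F = (SUP u\<in>Ltwo T. Ltwo_norm T (F u) / Ltwo_norm T u)"

text \<open>\<open>g\<close> is the Riesz representative in \<open>L\<^sup>2\<close> of the Frechet derivative of \<open>F\<close> at \<open>u\<close>.\<close>

definition has_Ltwo_gradient ::
  "real \<Rightarrow> ((real \<Rightarrow> 'a::real_inner) \<Rightarrow> real) \<Rightarrow> (real \<Rightarrow> 'a) \<Rightarrow> (real \<Rightarrow> 'a) \<Rightarrow> bool" where
  "has_Ltwo_gradient T F u g \<longleftrightarrow> g \<in> Ltwo T \<and>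
     (\<forall>e>0. \<exists>d>0. \<forall>h\<in>Ltwo T. Ltwo_norm T h < d \<longrightarrow>
        \<bar>F (\<lambda>t. u t + h t) - F u - (LINT t|time T. g t \<bullet> h t)\<bar> \<le> e * Ltwo_norm T h)"


subsection \<open>The space W(0,T)\<close>

definition test_functions :: "real \<Rightarrow> (real \<Rightarrow> real) set" where
  "test_functions T =
     {\<phi>. (\<forall>n t. (deriv ^^ n) \<phi> differentiable at t) \<and>
         (\<exists>a b. 0 < a \<and> b < T \<and> (\<forall>t. t \<notin> {a..b} \<longrightarrow> \<phi> t = 0))}"

text \<open>
  \<open>y \<in> W(0,T)\<close> with distributional derivative \<open>y'\<close> in \<open>L\<^sup>2(0,T;V')\<close>.  The defining identity
  \<open>\<integral> \<phi>' y = - \<integral> \<phi> y'\<close> between elements of V' is evaluated at each \<open>v\<close> in V (evaluation commutes with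
  the Bochner integral), as the library's Bochner integral is not available on \<open>'v \<Rightarrow>\<^sub>L real\<close>.
\<close>

definition has_W_derivative ::
  "real \<Rightarrow> ('v::real_normed_vector \<Rightarrow>\<^sub>L 'h::real_inner) \<Rightarrow> (real \<Rightarrow> 'v) \<Rightarrow> (real \<Rightarrow> 'v \<Rightarrow>\<^sub>L real) \<Rightarrow> bool"
where
  "has_W_derivative T \<iota> y y' \<longleftrightarrow> y \<in> Ltwo T \<and> y' \<in> Ltwo T \<and>
     (\<forall>\<phi>\<in>test_functions T. \<forall>v.
        (LINT t|time T. deriv \<phi> t * to_dual \<iota> (\<iota> (y t)) v) = - (LINT t|time T. \<phi> t * y' t v))"

text \<open>
  The value in H at a time \<open>s\<close> in \<open>[0,T]\<close> of an element of W(0,T), i.e. the value at \<open>s\<close> of its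
  representative in \<open>C([0,T];H)\<close>.
\<close>

definition has_value_at ::
  "real \<Rightarrow> ('v::real_normed_vector \<Rightarrow>\<^sub>L 'h::real_normed_vector) \<Rightarrow> (real \<Rightarrow> 'v) \<Rightarrow> real \<Rightarrow> 'h \<Rightarrow> bool"
where
  "has_value_at T \<iota> y s h \<longleftrightarrow>
     (\<exists>z. continuous_on {0..T} z \<and> (AE t in time T. \<iota> (y t) = z t) \<and> z s = h)"


subsection \<open>Coefficients\<close>

text \<open>
  Essentially bounded, weakly measurable operator families; for \<open>C\<close> the pairing on H is the inner
  product.
\<close>

definition Linfty_form :: "real \<Rightarrow> (real \<Rightarrow> 'v::real_normed_vector \<Rightarrow>\<^sub>L 'v \<Rightarrow>\<^sub>L real) \<Rightarrow> bool" where
  "Linfty_form T A \<longleftrightarrow> (\<forall>v w. (\<lambda>t. A t v w) \<in> borel_measurable (time T)) \<and>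
     (\<exists>K. AE t in time T. norm (A t) \<le> K)"

definition Linfty_op :: "real \<Rightarrow> (real \<Rightarrow> 'h::real_inner \<Rightarrow>\<^sub>L 'h) \<Rightarrow> bool" where
  "Linfty_op T C \<longleftrightarrow> (\<forall>v w. (\<lambda>t. C t v \<bullet> w) \<in> borel_measurable (time T)) \<and>
     (\<exists>K. AE t in time T. norm (C t) \<le> K)"

definition uniformly_coercive :: "real \<Rightarrow> (real \<Rightarrow> 'v::real_normed_vector \<Rightarrow>\<^sub>L 'v \<Rightarrow>\<^sub>L real) \<Rightarrow> bool" where
  "uniformly_coercive T A \<longleftrightarrow> (\<exists>\<eta>>0. \<forall>t\<in>{0<..<T}. \<forall>v. A t v v \<ge> \<eta> * (norm v)\<^sup>2)"


subsection \<open>State and adjoint equations\<close>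

definition solves_state ::
  "real \<Rightarrow> ('v::real_normed_vector \<Rightarrow>\<^sub>L 'h::real_inner) \<Rightarrow> (real \<Rightarrow> 'v \<Rightarrow>\<^sub>L 'v \<Rightarrow>\<^sub>L real) \<Rightarrow>
   ('u::real_normed_vector \<Rightarrow>\<^sub>L 'v \<Rightarrow>\<^sub>L real) \<Rightarrow> 'h \<Rightarrow> (real \<Rightarrow> 'u) \<Rightarrow> (real \<Rightarrow> 'v) \<Rightarrow> bool"
where
  "solves_state T \<iota> A B y0 u y \<longleftrightarrow>
     (\<exists>y'. has_W_derivative T \<iota> y y' \<and> (AE t in time T. y' t + A t (y t) = B (u t))) \<and>
     has_value_at T \<iota> y 0 y0"

text \<open>
  The solutions of both equations are unique up to null sets, so \<open>SOME\<close> merely picks a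
  representative.
\<close>

definition state ::
  "real \<Rightarrow> ('v::real_normed_vector \<Rightarrow>\<^sub>L 'h::real_inner) \<Rightarrow> (real \<Rightarrow> 'v \<Rightarrow>\<^sub>L 'v \<Rightarrow>\<^sub>L real) \<Rightarrow>
   ('u::real_normed_vector \<Rightarrow>\<^sub>L 'v \<Rightarrow>\<^sub>L real) \<Rightarrow> 'h \<Rightarrow> (real \<Rightarrow> 'u) \<Rightarrow> real \<Rightarrow> 'v"
where
  "state T \<iota> A B y0 u = (SOME y. solves_state T \<iota> A B y0 u y)"

definition solves_adjoint ::
  "real \<Rightarrow> ('v::real_normed_vector \<Rightarrow>\<^sub>L 'h::real_inner) \<Rightarrow> (real \<Rightarrow> 'v \<Rightarrow>\<^sub>L 'v \<Rightarrow>\<^sub>L real) \<Rightarrow>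
   (real \<Rightarrow> 'h \<Rightarrow>\<^sub>L 'h) \<Rightarrow> (real \<Rightarrow> 'h) \<Rightarrow> (real \<Rightarrow> 'h) \<Rightarrow> (real \<Rightarrow> 'v) \<Rightarrow> bool"
where
  "solves_adjoint T \<iota> A C yd y p \<longleftrightarrow>
     (\<exists>p'. has_W_derivative T \<iota> p p' \<and>
        (AE t in time T. - p' t + dual_op (A t) (p t) =
            to_dual \<iota> (adjoint (blinfun_apply (C t)) (C t (y t) - yd t)))) \<and>
     has_value_at T \<iota> p T 0"

definition adjoint_state ::
  "real \<Rightarrow> ('v::real_normed_vector \<Rightarrow>\<^sub>L 'h::real_inner) \<Rightarrow> (real \<Rightarrow> 'v \<Rightarrow>\<^sub>L 'v \<Rightarrow>\<^sub>L real) \<Rightarrow>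
   (real \<Rightarrow> 'h \<Rightarrow>\<^sub>L 'h) \<Rightarrow> (real \<Rightarrow> 'h) \<Rightarrow> (real \<Rightarrow> 'h) \<Rightarrow> real \<Rightarrow> 'v"
where
  "adjoint_state T \<iota> A C yd y = (SOME p. solves_adjoint T \<iota> A C yd y p)"


subsection \<open>The reduced optimal control problem\<close>

definition reduced_cost ::
  "real \<Rightarrow> ('v::real_normed_vector \<Rightarrow>\<^sub>L 'h::real_inner) \<Rightarrow> (real \<Rightarrow> 'v \<Rightarrow>\<^sub>L 'v \<Rightarrow>\<^sub>L real) \<Rightarrow>
   ('u::real_normed_vector \<Rightarrow>\<^sub>L 'v \<Rightarrow>\<^sub>L real) \<Rightarrow> (real \<Rightarrow> 'h \<Rightarrow>\<^sub>L 'h) \<Rightarrow> real \<Rightarrow> (real \<Rightarrow> 'h) \<Rightarrow> 'h \<Rightarrow>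
   (real \<Rightarrow> 'u) \<Rightarrow> real"
where
  "reduced_cost T \<iota> A B C \<beta> yd y0 u =
     (LINT t|time T. 1/2 * (norm (C t (\<iota> (state T \<iota> A B y0 u t)) - yd t))\<^sup>2
                     + \<beta>/2 * (norm (u t))\<^sup>2)"

text \<open>
  The gradient is required to be both the Riesz representative of the derivative and given by the
  adjoint formula \<open>\<J>\<^sub>U\<^sup>-\<^sup>1 B' p(y(u)) + \<beta> u\<close>.  The existence of such a function is not assumed
  anywhere; it has to be derived before anything can be said about \<open>reduced_gradient\<close>.
\<close>

definition reduced_gradient ::
  "real \<Rightarrow> ('v::real_normed_vector \<Rightarrow>\<^sub>L 'h::real_inner) \<Rightarrow> (real \<Rightarrow> 'v \<Rightarrow>\<^sub>L 'v \<Rightarrow>\<^sub>L real) \<Rightarrow>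
   ('u::real_inner \<Rightarrow>\<^sub>L 'v \<Rightarrow>\<^sub>L real) \<Rightarrow> (real \<Rightarrow> 'h \<Rightarrow>\<^sub>L 'h) \<Rightarrow> real \<Rightarrow> (real \<Rightarrow> 'h) \<Rightarrow> 'h \<Rightarrow>
   (real \<Rightarrow> 'u) \<Rightarrow> real \<Rightarrow> 'u"
where
  "reduced_gradient T \<iota> A B C \<beta> yd y0 u =
     (let p = adjoint_state T \<iota> A C yd (\<lambda>t. \<iota> (state T \<iota> A B y0 u t))
      in SOME g. has_Ltwo_gradient T (reduced_cost T \<iota> A B C \<beta> yd y0) u g \<and>
                 (AE t in time T. g t = inv riesz (dual_op B (p t)) + \<beta> *\<^sub>R u t))"

definition CS_operator ::
  "real \<Rightarrow> ('v::real_normed_vector \<Rightarrow>\<^sub>L 'h::real_inner) \<Rightarrow> (real \<Rightarrow> 'v \<Rightarrow>\<^sub>L 'v \<Rightarrow>\<^sub>L real) \<Rightarrow>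
   ('u::real_normed_vector \<Rightarrow>\<^sub>L 'v \<Rightarrow>\<^sub>L real) \<Rightarrow> (real \<Rightarrow> 'h \<Rightarrow>\<^sub>L 'h) \<Rightarrow> (real \<Rightarrow> 'u) \<Rightarrow> real \<Rightarrow> 'h"
where
  "CS_operator T \<iota> A B C u = (\<lambda>t. C t (\<iota> (state T \<iota> A B 0 u t)))"

definition upper_estimator ::
  "real \<Rightarrow> ('v::real_normed_vector \<Rightarrow>\<^sub>L 'h::real_inner) \<Rightarrow> (real \<Rightarrow> 'v \<Rightarrow>\<^sub>L 'v \<Rightarrow>\<^sub>L real) \<Rightarrow>
   ('u::real_inner \<Rightarrow>\<^sub>L 'v \<Rightarrow>\<^sub>L real) \<Rightarrow> (real \<Rightarrow> 'h \<Rightarrow>\<^sub>L 'h) \<Rightarrow> real \<Rightarrow> (real \<Rightarrow> 'h) \<Rightarrow> 'h \<Rightarrow>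
   (real \<Rightarrow> 'u) \<Rightarrow> real"
where
  "upper_estimator T \<iota> A B C \<beta> yd y0 u =
     1 / \<beta> * Ltwo_norm T (reduced_gradient T \<iota> A B C \<beta> yd y0 u)"

definition lower_estimator ::
  "real \<Rightarrow> ('v::real_normed_vector \<Rightarrow>\<^sub>L 'h::real_inner) \<Rightarrow> (real \<Rightarrow> 'v \<Rightarrow>\<^sub>L 'v \<Rightarrow>\<^sub>L real) \<Rightarrow>
   ('u::real_inner \<Rightarrow>\<^sub>L 'v \<Rightarrow>\<^sub>L real) \<Rightarrow> (real \<Rightarrow> 'h \<Rightarrow>\<^sub>L 'h) \<Rightarrow> real \<Rightarrow> (real \<Rightarrow> 'h) \<Rightarrow> 'h \<Rightarrow>
   (real \<Rightarrow> 'u) \<Rightarrow> real"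
where
  "lower_estimator T \<iota> A B C \<beta> yd y0 u =
     1 / (\<beta> + (Ltwo_opnorm T (CS_operator T \<iota> A B C))\<^sup>2) *
       Ltwo_norm T (reduced_gradient T \<iota> A B C \<beta> yd y0 u)"

end

theory Submission
  imports Defs
begin

text \<open>
  The reduced cost is quadratic: \<open>J(u + h) = J(u) + (\<nabla>J(u), h) + (\<parallel>CSh\<parallel>\<^sup>2 + \<beta>\<parallel>h\<parallel>\<^sup>2) / 2\<close>.  Since the gradient
  vanishes at the minimizer \<open>u\<close>, the error \<open>e = v - u\<close> satisfies \<open>(\<nabla>J(v), h) = (CSe, CSh) + \<beta>(e, h)\<close>; choosing
  \<open>h = e\<close> gives the upper and \<open>h = \<nabla>J(v)\<close> the lower bound.

  The substance is the well-posedness of the state and adjoint equations.  Identify V' with V by Riesz.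
  Integration by parts holds in W(0,T) because difference quotients of \<open>y\<close> are Steklov averages of \<open>y'\<close>, and
  these converge in \<open>L\<^sup>2\<close>; it yields energy estimates, uniqueness and the adjoint formula for the gradient.
  For existence, minimize the residual of the equation and of the initial value over W(0,T).  By the
  energy estimate a minimizing sequence converges; the residual \<open>G\<close> of its limit is orthogonal to the range of
  \<open>y \<mapsto> y' + Ay\<close> on functions vanishing at time 0, and testing with the backward Steklov averages of \<open>G\<close> itself
  shows \<open>G = 0\<close> by coercivity.
\<close>


subsection \<open>Square-integrable functions\<close>

text \<open>The coefficients depend on time only measurably, so the existence proof uses just the
  parallelogram identity, completeness and the energy estimate: the residuals alone bound
  \<open>y\<close> and its value in C([0,T];H), hence also \<open>y'\<close>. Averages enter because
  the residual \<open>G\<close> is merely square integrable in time and is no admissible test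
  function itself. Its backward average is one, with derivative (G(t) - G(t - h)) / h, and pairing
  this with \<open>G\<close> in H is nonnegative since translations are isometries.

  Two mismatches cost work. Integrals over (0,T) are taken in completed Lebesgue measure, while
  shifts and Fubini are applied on \<open>lborel\<close>; functions are therefore replaced by Borel
  representatives that vanish off (0,T). And W(0,T) is given by test functions, while the proof runs
  on the integrated form of the derivative; smooth steps that approximate indicators of intervals
  lead from one to the other.

  Since \<open>state\<close>, \<open>adjoint_state\<close> and \<open>reduced_gradient\<close> are
  choices, nothing is known about them before existence is proved, and superposition for
  \<open>state\<close> also rests on uniqueness up to null sets.\<close>

definition L2 :: "'a measure \<Rightarrow> ('a \<Rightarrow> 'b::real_normed_vector) set" where
  "L2 M = {f. f \<in> borel_measurable M \<and> integrable M (\<lambda>t. (norm (f t))\<^sup>2)}"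

definition L2_norm :: "'a measure \<Rightarrow> ('a \<Rightarrow> 'b::real_normed_vector) \<Rightarrow> real" where
  "L2_norm M f = sqrt (LINT t|M. (norm (f t))\<^sup>2)"

lemma Ltwo_eq_L2: "Ltwo T = L2 (time T)"
  by (simp add: Ltwo_def L2_def)

lemma Ltwo_norm_eq_L2_norm: "Ltwo_norm T = L2_norm (time T)"
  by (simp add: Ltwo_norm_def L2_norm_def fun_eq_iff)

lemma L2_measurable: "f \<in> L2 M \<Longrightarrow> f \<in> borel_measurable M"
  by (simp add: L2_def)

lemma L2_integrable: "f \<in> L2 M \<Longrightarrow> integrable M (\<lambda>t. (norm (f t))\<^sup>2)"
  by (simp add: L2_def)

lemma L2_zero [simp]: "(\<lambda>t. 0) \<in> L2 M"
  by (simp add: L2_def)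

lemma L2_norm_nonneg [simp]: "0 \<le> L2_norm M f"
  by (simp add: L2_norm_def)

lemma L2_norm_square: "(L2_norm M f)\<^sup>2 = (LINT t|M. (norm (f t))\<^sup>2)"
  by (simp add: L2_norm_def)

lemma L2_bounded:
  assumes f: "f \<in> L2 M" and g: "g \<in> borel_measurable M"
    and le: "AE t in M. norm (g t) \<le> K * norm (f t)"
  shows "g \<in> L2 M"
proof -
  have "integrable M (\<lambda>t. (norm (g t))\<^sup>2)"
  proof (rule Bochner_Integration.integrable_bound)
    show "integrable M (\<lambda>t. K\<^sup>2 * (norm (f t))\<^sup>2)"
      using L2_integrable[OF f] by simp
    show "(\<lambda>t. (norm (g t))\<^sup>2) \<in> borel_measurable M"
      using g by measurable
    show "AE t in M. norm ((norm (g t))\<^sup>2) \<le> norm (K\<^sup>2 * (norm (f t))\<^sup>2)"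
      using le
    proof eventually_elim
      case (elim t)
      then have "(norm (g t))\<^sup>2 \<le> (K * norm (f t))\<^sup>2"
        by (intro power_mono) auto
      then show ?case by (simp add: power_mult_distrib)
    qed
  qed
  with g show ?thesis by (simp add: L2_def)
qed

lemma L2_norm_bounded:
  assumes f: "f \<in> L2 M" and g: "g \<in> borel_measurable M" and "K \<ge> 0"
    and le: "AE t in M. norm (g t) \<le> K * norm (f t)"
  shows "L2_norm M g \<le> K * L2_norm M f"
proof -
  have "(LINT t|M. (norm (g t))\<^sup>2) \<le> (LINT t|M. K\<^sup>2 * (norm (f t))\<^sup>2)"
  proof (rule integral_mono_AE)
    show "integrable M (\<lambda>t. (norm (g t))\<^sup>2)"
      using L2_bounded[OF f g le] by (rule L2_integrable)
    show "integrable M (\<lambda>t. K\<^sup>2 * (norm (f t))\<^sup>2)"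
      using L2_integrable[OF f] by simp
    show "AE t in M. (norm (g t))\<^sup>2 \<le> K\<^sup>2 * (norm (f t))\<^sup>2"
      using le
    proof eventually_elim
      case (elim t)
      then have "(norm (g t))\<^sup>2 \<le> (K * norm (f t))\<^sup>2"
        by (intro power_mono) auto
      then show ?case by (simp add: power_mult_distrib)
    qed
  qed
  also have "\<dots> = (K * L2_norm M f)\<^sup>2"
    by (simp add: power_mult_distrib L2_norm_square)
  finally show ?thesis
    unfolding L2_norm_def[of M g] using \<open>K \<ge> 0\<close> by (intro real_le_lsqrt) (auto simp: L2_norm_def)
qed

lemma L2_cong_AE:
  assumes "f \<in> L2 M" "g \<in> borel_measurable M" "AE t in M. f t = g t"
  shows "g \<in> L2 M"
  by (rule L2_bounded[where K = 1, OF assms(1,2)]) (use assms(3) in auto)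

lemma L2_norm_cong_AE:
  assumes f: "f \<in> borel_measurable M" and g: "g \<in> borel_measurable M"
    and eq: "AE t in M. f t = g t"
  shows "L2_norm M f = L2_norm M g"
proof -
  have "(LINT t|M. (norm (f t))\<^sup>2) = (LINT t|M. (norm (g t))\<^sup>2)"
  proof (rule integral_cong_AE)
    show "(\<lambda>t. (norm (f t))\<^sup>2) \<in> borel_measurable M" using f by measurable
    show "(\<lambda>t. (norm (g t))\<^sup>2) \<in> borel_measurable M" using g by measurable
    show "AE t in M. (norm (f t))\<^sup>2 = (norm (g t))\<^sup>2" using eq by eventually_elim simp
  qed
  then show ?thesis by (simp add: L2_norm_def)
qed

lemma L2_norm_of_norm [simp]: "L2_norm M (\<lambda>t. norm (f t)) = L2_norm M f"
  by (simp add: L2_norm_def)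

lemma L2_blinfun:
  assumes "f \<in> L2 M"
  shows "(\<lambda>t. blinfun_apply L (f t)) \<in> L2 M"
proof (rule L2_bounded[OF assms, where K = "norm L"])
  show "(\<lambda>t. blinfun_apply L (f t)) \<in> borel_measurable M"
    using linear_continuous_on[OF blinfun.bounded_linear_right] L2_measurable[OF assms]
    by (rule borel_measurable_continuous_on)
qed (simp add: norm_blinfun)

lemma L2_norm_blinfun:
  assumes "f \<in> L2 M"
  shows "L2_norm M (\<lambda>t. blinfun_apply L (f t)) \<le> norm L * L2_norm M f"
  by (rule L2_norm_bounded[OF assms]) (use L2_measurable[OF L2_blinfun[OF assms]] norm_blinfun in auto)

lemma L2_scaleR:
  fixes f :: "'a \<Rightarrow> 'b::{real_normed_vector, second_countable_topology}"
  assumes "f \<in> L2 M"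
  shows "(\<lambda>t. c *\<^sub>R f t) \<in> L2 M"
  by (rule L2_bounded[OF assms, where K = "\<bar>c\<bar>"]) (use L2_measurable[OF assms] in auto)

lemma L2_norm_scaleR: "L2_norm M (\<lambda>t. c *\<^sub>R f t) = \<bar>c\<bar> * L2_norm M f"
  by (simp add: L2_norm_def power_mult_distrib real_sqrt_mult)

context
  fixes M :: "'a measure" and f g :: "'a \<Rightarrow> 'b::{real_inner, second_countable_topology}"
  assumes f: "f \<in> L2 M" and g: "g \<in> L2 M"
begin

lemma L2_norm_mult_integrable: "integrable M (\<lambda>t. norm (f t) * norm (g t))"
proof (rule Bochner_Integration.integrable_bound)
  show "integrable M (\<lambda>t. (norm (f t))\<^sup>2 + (norm (g t))\<^sup>2)"
    using L2_integrable[OF f] L2_integrable[OF g] by simp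
  show "(\<lambda>t. norm (f t) * norm (g t)) \<in> borel_measurable M"
    using L2_measurable[OF f] L2_measurable[OF g] by measurable
  have "norm (f t) * norm (g t) \<le> (norm (f t))\<^sup>2 + (norm (g t))\<^sup>2" for t
  proof -
    have "2 * (norm (f t) * norm (g t)) \<le> (norm (f t))\<^sup>2 + (norm (g t))\<^sup>2"
      using sum_squares_bound[of "norm (f t)" "norm (g t)"] by (simp add: algebra_simps)
    moreover have "0 \<le> norm (f t) * norm (g t)" by simp
    ultimately show ?thesis by linarith
  qed
  then show "AE t in M. norm (norm (f t) * norm (g t)) \<le> norm ((norm (f t))\<^sup>2 + (norm (g t))\<^sup>2)"
    by (auto simp: abs_of_nonneg)
qed

lemma L2_inner_measurable: "(\<lambda>t. f t \<bullet> g t) \<in> borel_measurable M"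
  using L2_measurable[OF f] L2_measurable[OF g] by measurable

lemma L2_inner_integrable: "integrable M (\<lambda>t. f t \<bullet> g t)"
  by (rule Bochner_Integration.integrable_bound[OF L2_norm_mult_integrable])
     (use L2_inner_measurable Cauchy_Schwarz_ineq2 in \<open>auto simp: abs_mult\<close>)

lemma L2_add: "(\<lambda>t. f t + g t) \<in> L2 M"
proof -
  have m: "(\<lambda>t. f t + g t) \<in> borel_measurable M"
    using L2_measurable[OF f] L2_measurable[OF g] by measurable
  have "(norm (f t + g t))\<^sup>2 = (norm (f t))\<^sup>2 + 2 * (f t \<bullet> g t) + (norm (g t))\<^sup>2" for t
    by (simp add: power2_norm_eq_inner inner_add_left inner_add_right inner_commute)
  then show ?thesis
    using L2_integrable[OF f] L2_integrable[OF g] L2_inner_integrable m by (simp add: L2_def)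
qed

lemma L2_norm_add_square:
  "(L2_norm M (\<lambda>t. f t + g t))\<^sup>2 = (L2_norm M f)\<^sup>2 + 2 * (LINT t|M. f t \<bullet> g t) + (L2_norm M g)\<^sup>2"
proof -
  have "(norm (f t + g t))\<^sup>2 = (norm (f t))\<^sup>2 + 2 * (f t \<bullet> g t) + (norm (g t))\<^sup>2" for t
    by (simp add: power2_norm_eq_inner inner_add_left inner_add_right inner_commute)
  then show ?thesis
    using L2_integrable[OF f] L2_integrable[OF g] L2_inner_integrable by (simp add: L2_norm_square)
qed

text \<open>Young's inequality with a free weight \<open>c\<close> is integrated and then optimized
  over \<open>c\<close>, which reduces Cauchy-Schwarz to pointwise arithmetic. The slack
  \<open>e\<close> covers the case that one of the norms is zero, where no optimal weight
  exists.\<close>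

lemma L2_norm_mult_le: "(LINT t|M. norm (f t) * norm (g t)) \<le> L2_norm M f * L2_norm M g"
proof (rule field_le_epsilon)
  fix e :: real assume e: "e > 0"
  define a where "a = L2_norm M f"
  define b where "b = L2_norm M g"
  define I where "I = (LINT t|M. norm (f t) * norm (g t))"
  have young: "2 * I \<le> c * a\<^sup>2 + b\<^sup>2 / c" if "c > 0" for c
  proof -
    have "2 * I = (LINT t|M. 2 * (norm (f t) * norm (g t)))"
      by (simp add: I_def)
    also have "\<dots> \<le> (LINT t|M. c * (norm (f t))\<^sup>2 + (norm (g t))\<^sup>2 / c)"
    proof (rule integral_mono)
      show "integrable M (\<lambda>t. 2 * (norm (f t) * norm (g t)))"
        using L2_norm_mult_integrable by simp
      show "integrable M (\<lambda>t. c * (norm (f t))\<^sup>2 + (norm (g t))\<^sup>2 / c)"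
        using L2_integrable[OF f] L2_integrable[OF g] by simp
      fix t
      have "0 \<le> (c * norm (f t) - norm (g t))\<^sup>2 / c" using that by simp
      also have "\<dots> = c * (norm (f t))\<^sup>2 + (norm (g t))\<^sup>2 / c - 2 * (norm (f t) * norm (g t))"
        using that by (simp add: field_simps power2_eq_square)
      finally show "2 * (norm (f t) * norm (g t)) \<le> c * (norm (f t))\<^sup>2 + (norm (g t))\<^sup>2 / c" by simp
    qed
    also have "\<dots> = c * a\<^sup>2 + b\<^sup>2 / c"
      using L2_integrable[OF f] L2_integrable[OF g] by (simp add: a_def b_def L2_norm_square)
    finally show ?thesis .
  qed
  have ab: "a \<ge> 0" "b \<ge> 0" by (auto simp: a_def b_def)
  have "I \<le> a * b + e"
  proof (cases "a > 0 \<and> b > 0")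
    case True
    \<comment> \<open>The weight \<open>b / a\<close> minimizes the right-hand side of
      \<open>young\<close>.\<close>
    then have "2 * I \<le> b / a * a\<^sup>2 + b\<^sup>2 / (b / a)" by (intro young) auto
    also have "\<dots> = 2 * (a * b)" using True by (simp add: field_simps power2_eq_square)
    finally show ?thesis using e by simp
  next
    case False
    with ab consider "a = 0" | "b = 0" by linarith
    then show ?thesis
    proof cases
      case 1
      \<comment> \<open>With \<open>a = 0\<close> only \<open>b\<^sup>2 / c\<close> remains, and
        this weight makes it at most \<open>e\<close>.\<close>
      have pos: "b\<^sup>2 / e + 1 > 0" using e by (simp add: add_nonneg_pos)
      then have "2 * I \<le> b\<^sup>2 / (b\<^sup>2 / e + 1)" using young[OF pos] 1 by simp
      also have "\<dots> \<le> e" using e pos by (simp add: field_simps)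
      finally show ?thesis using 1 e by simp
    next
      case 2
      have pos: "e / (a\<^sup>2 + 1) > 0" using e by (simp add: add_nonneg_pos)
      then have "2 * I \<le> e / (a\<^sup>2 + 1) * a\<^sup>2" using young[OF pos] 2 by simp
      also have "\<dots> = e * (a\<^sup>2 / (a\<^sup>2 + 1))" by simp
      also have "\<dots> \<le> e * 1" using e by (intro mult_left_mono) (auto simp: divide_le_eq add_nonneg_pos)
      finally show ?thesis using 2 e by simp
    qed
  qed
  then show "(LINT t|M. norm (f t) * norm (g t)) \<le> L2_norm M f * L2_norm M g + e"
    by (simp add: a_def b_def I_def)
qed

lemma L2_inner_le: "\<bar>LINT t|M. f t \<bullet> g t\<bar> \<le> L2_norm M f * L2_norm M g"
proof -
  have "\<bar>LINT t|M. f t \<bullet> g t\<bar> \<le> (LINT t|M. norm (f t) * norm (g t))"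
    by (rule integral_abs_bound[THEN order_trans], rule integral_mono)
       (use L2_inner_integrable L2_norm_mult_integrable Cauchy_Schwarz_ineq2 in auto)
  with L2_norm_mult_le show ?thesis by linarith
qed

lemma L2_norm_triangle: "L2_norm M (\<lambda>t. f t + g t) \<le> L2_norm M f + L2_norm M g"
proof (rule power2_le_imp_le)
  have "(L2_norm M (\<lambda>t. f t + g t))\<^sup>2 \<le> (L2_norm M f)\<^sup>2 + 2 * (L2_norm M f * L2_norm M g) + (L2_norm M g)\<^sup>2"
    using L2_norm_add_square L2_inner_le by linarith
  then show "(L2_norm M (\<lambda>t. f t + g t))\<^sup>2 \<le> (L2_norm M f + L2_norm M g)\<^sup>2"
    by (simp add: power2_sum)
qed simp

end

lemma L2_norm_uminus: "L2_norm M (\<lambda>t. - f t) = L2_norm M f"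
  by (simp add: L2_norm_def)

lemma L2_norm_minus_commute: "L2_norm M (\<lambda>t. f t - g t) = L2_norm M (\<lambda>t. g t - f t)"
  by (simp add: L2_norm_def norm_minus_commute)

context
  fixes M :: "'a measure" and f g :: "'a \<Rightarrow> 'b::{real_inner, second_countable_topology}"
  assumes f: "f \<in> L2 M" and g: "g \<in> L2 M"
begin

lemma L2_uminus: "(\<lambda>t. - g t) \<in> L2 M"
  using L2_scaleR[OF g, of "- 1"] by simp

lemma L2_diff: "(\<lambda>t. f t - g t) \<in> L2 M"
  using L2_add[OF f L2_uminus] by simp

lemma L2_norm_diff_square:
  "(L2_norm M (\<lambda>t. f t - g t))\<^sup>2 = (L2_norm M f)\<^sup>2 - 2 * (LINT t|M. f t \<bullet> g t) + (L2_norm M g)\<^sup>2"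
  using L2_norm_add_square[OF f L2_uminus] by (simp add: L2_norm_uminus)

lemma L2_norm_triangle_diff: "L2_norm M (\<lambda>t. f t - g t) \<le> L2_norm M f + L2_norm M g"
  using L2_norm_triangle[OF f L2_uminus] by (simp add: L2_norm_uminus)

end

lemma L2_inner_tendsto:
  fixes f :: "'i \<Rightarrow> 'a \<Rightarrow> 'b::{real_inner, second_countable_topology}"
  assumes "\<And>n. f n \<in> L2 M" "f' \<in> L2 M" "g \<in> L2 M"
    and lim: "((\<lambda>n. L2_norm M (\<lambda>t. f n t - f' t)) \<longlongrightarrow> 0) F"
  shows "((\<lambda>n. LINT t|M. f n t \<bullet> g t) \<longlongrightarrow> (LINT t|M. f' t \<bullet> g t)) F"
proof (rule Lim_null[THEN iffD2], rule Lim_null_comparison)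
  show "((\<lambda>n. L2_norm M (\<lambda>t. f n t - f' t) * L2_norm M g) \<longlongrightarrow> 0) F"
    by (rule tendsto_mult_left_zero[OF lim])
  show "\<forall>\<^sub>F n in F. norm ((LINT t|M. f n t \<bullet> g t) - (LINT t|M. f' t \<bullet> g t))
      \<le> L2_norm M (\<lambda>t. f n t - f' t) * L2_norm M g"
  proof (rule always_eventually, rule allI)
    fix n
    have "(LINT t|M. f n t \<bullet> g t) - (LINT t|M. f' t \<bullet> g t) = (LINT t|M. (f n t - f' t) \<bullet> g t)"
      using assms by (simp add: inner_diff_left L2_inner_integrable)
    then show "norm ((LINT t|M. f n t \<bullet> g t) - (LINT t|M. f' t \<bullet> g t)) \<le> L2_norm M (\<lambda>t. f n t - f' t) * L2_norm M g"
      using L2_inner_le[OF L2_diff[OF assms(1,2)] assms(3)] by simp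
  qed
qed

lemma L2_norm_eq_0_imp_AE:
  assumes "f \<in> L2 M" "L2_norm M f = 0"
  shows "AE t in M. f t = 0"
proof -
  have "AE t in M. (norm (f t))\<^sup>2 = 0"
    using integral_nonneg_eq_0_iff_AE[OF L2_integrable[OF assms(1)]] assms(2) by (auto simp: L2_norm_def)
  then show ?thesis by simp
qed

lemma L2_imp_integrable:
  fixes f :: "'a \<Rightarrow> 'b::{real_inner, banach, second_countable_topology}"
  assumes "finite_measure M" "f \<in> L2 M"
  shows "integrable M f"
proof -
  interpret finite_measure M by fact
  have "(\<lambda>t. 1::real) \<in> L2 M" by (simp add: L2_def)
  moreover have "(\<lambda>t. norm (f t)) \<in> L2 M"
    using assms(2) by (auto simp: L2_def)
  ultimately have "integrable M (\<lambda>t. norm (norm (f t)) * norm (1::real))"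
    by (intro L2_norm_mult_integrable)
  then show ?thesis
    using L2_measurable[OF assms(2)] by (simp add: integrable_norm_iff)
qed

text \<open>Cauchy-Schwarz against the constant 1, whose norm is the root of the total mass.\<close>

lemma L1_le_L2_norm:
  fixes f :: "'a \<Rightarrow> 'b::{real_inner, banach, second_countable_topology}"
  assumes "finite_measure M" "f \<in> L2 M"
  shows "(LINT t|M. norm (f t)) \<le> sqrt (measure M (space M)) * L2_norm M f"
proof -
  interpret finite_measure M by fact
  have "(\<lambda>t. 1::real) \<in> L2 M" by (simp add: L2_def)
  moreover have "(\<lambda>t. norm (f t)) \<in> L2 M"
    using assms(2) by (auto simp: L2_def)
  ultimately have "(LINT t|M. norm (norm (f t)) * norm (1::real)) \<le> L2_norm M (\<lambda>t. norm (f t)) * L2_norm M (\<lambda>t. 1::real)"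
    by (intro L2_norm_mult_le)
  then show ?thesis by (simp add: L2_norm_def[of M "\<lambda>t. 1"] mult.commute)
qed

text \<open>Riesz-Fischer: on a finite measure an L^2 Cauchy sequence is also L^1 Cauchy and so has
  an a.e. convergent subsequence. Fatou's lemma along this subsequence bounds the distance of every
  late member to the pointwise limit.\<close>

lemma L2_complete:
  fixes f :: "nat \<Rightarrow> 'a \<Rightarrow> 'b::{real_inner, banach, second_countable_topology}"
  assumes fin: "finite_measure M" and f: "\<And>n. f n \<in> L2 M"
    and cauchy: "\<And>e. e > 0 \<Longrightarrow> \<exists>N. \<forall>m\<ge>N. \<forall>n\<ge>N. L2_norm M (\<lambda>t. f m t - f n t) < e"
  shows "\<exists>f'\<in>L2 M. (\<lambda>n. L2_norm M (\<lambda>t. f n t - f' t)) \<longlonglongrightarrow> 0"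
proof -
  define K where "K = sqrt (measure M (space M)) + 1"
  have K: "K > 0" by (simp add: K_def add_nonneg_pos)
  have "\<exists>N. \<forall>i\<ge>N. \<forall>j\<ge>N. (LINT t|M. norm (f i t - f j t)) < e" if e: "e > 0" for e
  proof -
    obtain N where N: "\<forall>m\<ge>N. \<forall>n\<ge>N. L2_norm M (\<lambda>t. f m t - f n t) < e / K"
      using cauchy[of "e / K"] e K by auto
    have "(LINT t|M. norm (f i t - f j t)) < e" if "i \<ge> N" "j \<ge> N" for i j
    proof -
      have "(LINT t|M. norm (f i t - f j t)) \<le> sqrt (measure M (space M)) * L2_norm M (\<lambda>t. f i t - f j t)"
        using f by (intro L1_le_L2_norm fin L2_diff)
      also have "\<dots> \<le> K * L2_norm M (\<lambda>t. f i t - f j t)"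
        by (intro mult_right_mono) (auto simp: K_def)
      also have "\<dots> < e" using N that K by (auto simp: field_simps)
      finally show ?thesis .
    qed
    then show ?thesis by blast
  qed
  then obtain r where r: "strict_mono r" and ae: "AE x in M. Cauchy (\<lambda>i. f (r i) x)"
    using cauchy_L1_AE_cauchy_subseq[of M f, OF L2_imp_integrable[OF fin f]] by blast
  have fm [measurable]: "f n \<in> borel_measurable M" for n using f by (rule L2_measurable)
  \<comment> \<open>Where the subsequence diverges, \<open>lim\<close> is some unspecified value;
    those points form a null set, and \<open>f'\<close> is measurable all the same.\<close>
  define f' where "f' = (\<lambda>x. lim (\<lambda>i. f (r i) x))"
  have f'm [measurable]: "f' \<in> borel_measurable M"
    unfolding f'_def by (rule borel_measurable_lim_metric) simp
  have ae_lim: "AE x in M. (\<lambda>i. f (r i) x) \<longlonglongrightarrow> f' x"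
    using ae by eventually_elim (simp add: f'_def Cauchy_convergent_iff convergent_LIMSEQ_iff)
  have close: "(\<integral>\<^sup>+ x. ennreal ((norm (f n x - f' x))\<^sup>2) \<partial>M) \<le> ennreal (e\<^sup>2)"
    if e: "e > 0" and N: "\<forall>m\<ge>N. L2_norm M (\<lambda>t. f n t - f m t) < e" for n N e
  proof -
    have "(\<integral>\<^sup>+ x. ennreal ((norm (f n x - f' x))\<^sup>2) \<partial>M)
        = (\<integral>\<^sup>+ x. liminf (\<lambda>i. ennreal ((norm (f n x - f (r i) x))\<^sup>2)) \<partial>M)"
    proof (rule nn_integral_cong_AE)
      show "AE x in M. ennreal ((norm (f n x - f' x))\<^sup>2) = liminf (\<lambda>i. ennreal ((norm (f n x - f (r i) x))\<^sup>2))"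
        using ae_lim
      proof eventually_elim
        case (elim x)
        then have "(\<lambda>i. (norm (f n x - f (r i) x))\<^sup>2) \<longlonglongrightarrow> (norm (f n x - f' x))\<^sup>2"
          by (intro tendsto_intros)
        then have "(\<lambda>i. ennreal ((norm (f n x - f (r i) x))\<^sup>2)) \<longlonglongrightarrow> ennreal ((norm (f n x - f' x))\<^sup>2)"
          by (rule tendsto_ennrealI)
        then show ?case by (intro lim_imp_Liminf[symmetric]) auto
      qed
    qed
    also have "\<dots> \<le> liminf (\<lambda>i. \<integral>\<^sup>+ x. ennreal ((norm (f n x - f (r i) x))\<^sup>2) \<partial>M)"
      by (rule nn_integral_liminf) simp
    also have "\<dots> \<le> ennreal (e\<^sup>2)"
    proof (rule Liminf_le)
      show "\<forall>\<^sub>F i in sequentially. (\<integral>\<^sup>+ x. ennreal ((norm (f n x - f (r i) x))\<^sup>2) \<partial>M) \<le> ennreal (e\<^sup>2)"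
        using eventually_ge_at_top[of N]
      proof eventually_elim
        case (elim i)
        then have "r i \<ge> N" using seq_suble[OF r, of i] by linarith
        then have "L2_norm M (\<lambda>t. f n t - f (r i) t) < e" using N by blast
        then have "(L2_norm M (\<lambda>t. f n t - f (r i) t))\<^sup>2 \<le> e\<^sup>2"
          by (intro power_mono) auto
        moreover have "(\<integral>\<^sup>+ x. ennreal ((norm (f n x - f (r i) x))\<^sup>2) \<partial>M) = ennreal ((L2_norm M (\<lambda>t. f n t - f (r i) t))\<^sup>2)"
          unfolding L2_norm_square by (rule nn_integral_eq_integral) (simp_all add: L2_integrable[OF L2_diff[OF f f]])
        ultimately show ?case by (simp add: ennreal_leI)
      qed
    qed simp
    finally show ?thesis .
  qed
  have diff: "(\<lambda>t. f n t - f' t) \<in> L2 M \<and> L2_norm M (\<lambda>t. f n t - f' t) \<le> e"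
    if e: "e > 0" and N: "\<forall>m\<ge>N. L2_norm M (\<lambda>t. f n t - f m t) < e" for n N e
  proof -
    have int: "integrable M (\<lambda>t. (norm (f n t - f' t))\<^sup>2)"
    proof (rule integrableI_nonneg)
      show "(\<integral>\<^sup>+ x. ennreal ((norm (f n x - f' x))\<^sup>2) \<partial>M) < \<infinity>"
        using close[OF that] by (rule le_less_trans) simp
    qed simp_all
    have "ennreal ((L2_norm M (\<lambda>t. f n t - f' t))\<^sup>2) \<le> ennreal (e\<^sup>2)"
      using close[OF that] by (simp add: L2_norm_square nn_integral_eq_integral[OF int])
    then have "(L2_norm M (\<lambda>t. f n t - f' t))\<^sup>2 \<le> e\<^sup>2"
      by (subst (asm) ennreal_le_iff) simp_all
    then have "L2_norm M (\<lambda>t. f n t - f' t) \<le> e" 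
      by (rule power2_le_imp_le) (use e in simp)
    with int show ?thesis unfolding L2_def by simp
  qed
  obtain N where "\<forall>m\<ge>N. \<forall>n\<ge>N. L2_norm M (\<lambda>t. f m t - f n t) < 1" using cauchy[of 1] by auto
  then have "(\<lambda>t. f N t - f' t) \<in> L2 M" using diff[where e = 1 and N = N and n = N] by simp
  then have "(\<lambda>t. f N t - (f N t - f' t)) \<in> L2 M" by (rule L2_diff[OF f])
  then have f': "f' \<in> L2 M" by simp
  have "(\<lambda>n. L2_norm M (\<lambda>t. f n t - f' t)) \<longlonglongrightarrow> 0"
  proof (rule LIMSEQ_I)
    fix e :: real assume e: "e > 0"
    then obtain N where N: "\<forall>m\<ge>N. \<forall>n\<ge>N. L2_norm M (\<lambda>t. f m t - f n t) < e / 2" using cauchy[of "e / 2"] by auto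
    have "L2_norm M (\<lambda>t. f n t - f' t) \<le> e / 2" if "n \<ge> N" for n
      using diff[where e = "e/2" and N = N and n = n] N that e by simp
    then show "\<exists>N. \<forall>n\<ge>N. norm (L2_norm M (\<lambda>t. f n t - f' t) - 0) < e"
      using e by (intro exI[of _ N]) force
  qed
  with f' show ?thesis by blast
qed


subsection \<open>Riesz representation and operator families\<close>

text \<open>The value at the midpoint is at least the infimum, so \<open>d x y\<close> is at most
  the mean excess of \<open>x\<close> and \<open>y\<close> over it. Here \<open>d\<close> measures
  the gain at the midpoint; it is a multiple of a squared distance both in the Riesz theorem and in
  the least-squares problem for the state equation.\<close>

lemma minimizing_sequence_Cauchy:
  fixes Q :: "'x \<Rightarrow> real" and d :: "'x \<Rightarrow> 'x \<Rightarrow> real"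
  assumes ne: "R \<noteq> {}" and bdd: "\<And>x. x \<in> R \<Longrightarrow> b \<le> Q x"
    and mid: "\<And>x y. x \<in> R \<Longrightarrow> y \<in> R \<Longrightarrow> \<exists>m\<in>R. Q m \<le> (Q x + Q y) / 2 - d x y"
  obtains x :: "nat \<Rightarrow> 'x" where "\<And>n. x n \<in> R" "(\<lambda>n. Q (x n)) \<longlonglongrightarrow> Inf (Q ` R)"
    "\<And>e. e > 0 \<Longrightarrow> \<exists>N. \<forall>m\<ge>N. \<forall>n\<ge>N. d (x m) (x n) < e"
proof -
  define i where "i = Inf (Q ` R)"
  have bb: "bdd_below (Q ` R)" using bdd by (intro bdd_belowI2)
  have i_le: "i \<le> Q x" if "x \<in> R" for x
    unfolding i_def using bb that by (intro cInf_lower) auto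
  have "\<exists>x\<in>R. Q x < i + 1 / Suc n" for n
    using cInf_lessD[of "Q ` R" "i + 1 / Suc n"] ne by (auto simp: i_def)
  then obtain x where x: "\<And>n. x n \<in> R" "\<And>n. Q (x n) < i + 1 / Suc n" by metis
  show thesis
  proof (rule that[of x])
    show "x n \<in> R" for n by fact
    have "(\<lambda>n. i + 1 / Suc n) \<longlonglongrightarrow> i + 0"
      by (intro tendsto_add tendsto_const LIMSEQ_Suc[OF lim_1_over_n])
    then show "(\<lambda>n. Q (x n)) \<longlonglongrightarrow> Inf (Q ` R)"
      unfolding i_def[symmetric] using x i_le
      by (intro tendsto_sandwich[OF _ _ tendsto_const, of i "\<lambda>n. Q (x n)" sequentially "\<lambda>n. i + 1 / Suc n"])
         (auto intro!: always_eventually less_imp_le)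
  next
    fix e :: real assume e: "e > 0"
    obtain N where N: "1 / real (Suc N) < e" using e by (meson nat_approx_posE)
    have "d (x m) (x n) < e" if "m \<ge> N" "n \<ge> N" for m n
    proof -
      obtain y where "y \<in> R" "Q y \<le> (Q (x m) + Q (x n)) / 2 - d (x m) (x n)"
        using mid[OF x(1) x(1)] by blast
      then have "d (x m) (x n) \<le> (Q (x m) + Q (x n)) / 2 - i" using i_le[of y] by linarith
      moreover have "1 / real (Suc m) \<le> 1 / real (Suc N)" "1 / real (Suc n) \<le> 1 / real (Suc N)"
        using that by (auto intro!: divide_left_mono)
      ultimately show ?thesis using x(2)[of m] x(2)[of n] N by argo
    qed
    then show "\<exists>N. \<forall>m\<ge>N. \<forall>n\<ge>N. d (x m) (x n) < e" by blast
  qed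
qed

text \<open>The first-order optimality condition behind all minimizations below: near
  \<open>s = 0\<close> a nonzero linear term beats the quadratic one.\<close>

lemma linear_coeff_zero:
  fixes a b :: real
  assumes "\<And>s. 0 \<le> s * a + s\<^sup>2 * b"
  shows "a = 0"
proof (rule ccontr)
  assume a: "a \<noteq> 0"
  \<comment> \<open>As \<open>c\<close> exceeds both 0 and \<open>b\<close>, the linear term wins at
    \<open>s = - a / c\<close>.\<close>
  define c where "c = \<bar>b\<bar> + 1"
  have c: "c > 0" "b < c" by (auto simp: c_def)
  have "0 \<le> (- a / c) * a + (- a / c)\<^sup>2 * b" by (rule assms)
  also have "\<dots> = a\<^sup>2 / c * (b / c - 1)" using c by (simp add: field_simps power2_eq_square)
  also have "\<dots> < 0" using a c by (intro mult_pos_neg) auto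
  finally show False by simp
qed

lemma riesz_apply [simp]: "riesz x v = x \<bullet> v"
  by (simp add: riesz_def)

text \<open>The Dirichlet principle: the representative is the minimizer of
  \<open>x \<bullet> x / 2 - f x\<close>, and its first variation in direction \<open>v\<close> is
  \<open>y \<bullet> v - f v\<close>.\<close>

lemma riesz_representation:
  fixes f :: "'a::{real_inner, banach} \<Rightarrow>\<^sub>L real"
  shows "\<exists>x. \<forall>v. f v = x \<bullet> v"
proof -
  define Q where "Q = (\<lambda>x. x \<bullet> x / 2 - f x)"
  have bdd: "- (norm f)\<^sup>2 / 2 \<le> Q x" for x
  proof -
    have "f x \<le> norm f * norm x" using norm_blinfun[of f x] by (simp add: abs_le_iff)
    moreover have "0 \<le> (norm f - norm x)\<^sup>2" by simp
    ultimately show ?thesis by (simp add: Q_def power2_diff dot_square_norm)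
  qed
  \<comment> \<open>The parallelogram identity: at the midpoint the linear part is exactly the mean,
    while the quadratic part gains a multiple of the squared distance.\<close>
  have mid: "Q ((1/2) *\<^sub>R (x + y)) = (Q x + Q y) / 2 - (norm (x - y))\<^sup>2 / 8" for x y
    by (simp add: Q_def power2_norm_eq_inner blinfun.scaleR_right blinfun.add_right inner_add_left
        inner_add_right inner_diff_left inner_diff_right inner_commute[of y x] add_divide_distrib diff_divide_distrib)
  obtain x where lim: "(\<lambda>n. Q (x n)) \<longlonglongrightarrow> Inf (Q ` UNIV)"
    and cauchy: "\<And>e. e > 0 \<Longrightarrow> \<exists>N. \<forall>m\<ge>N. \<forall>n\<ge>N. (norm (x m - x n))\<^sup>2 / 8 < e"
    using minimizing_sequence_Cauchy[of UNIV "- (norm f)\<^sup>2 / 2" Q "\<lambda>x y. (norm (x - y))\<^sup>2 / 8"] bdd mid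
    by (metis UNIV_I empty_not_UNIV order_refl)
  have "Cauchy x"
  proof (rule CauchyI)
    fix e :: real assume e: "e > 0"
    then obtain N where N: "\<forall>m\<ge>N. \<forall>n\<ge>N. (norm (x m - x n))\<^sup>2 / 8 < e\<^sup>2 / 8"
      using cauchy[of "e\<^sup>2 / 8"] by auto
    have "norm (x m - x n) < e" if "m \<ge> N" "n \<ge> N" for m n
      by (rule power2_less_imp_less) (use N that e in auto)
    then show "\<exists>M. \<forall>m\<ge>M. \<forall>n\<ge>M. norm (x m - x n) < e" by blast
  qed
  then obtain y where y: "x \<longlonglongrightarrow> y" using Cauchy_convergent_iff convergent_def by blast
  have "(\<lambda>n. Q (x n)) \<longlonglongrightarrow> Q y"
    unfolding Q_def by (intro tendsto_intros y) simp
  then have Qy: "Q y = Inf (Q ` UNIV)" using lim LIMSEQ_unique by blast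
  have "Q y \<le> Q z" for z
    unfolding Qy by (rule cINF_lower) (use bdd bdd_belowI2[of UNIV "- (norm f)\<^sup>2 / 2" Q] in auto)
  have "f v = y \<bullet> v" for v
  proof -
    have "0 \<le> s * (y \<bullet> v - f v) + s\<^sup>2 * (v \<bullet> v / 2)" for s
    proof -
      have "Q (y + s *\<^sub>R v) - Q y = s * (y \<bullet> v - f v) + s\<^sup>2 * (v \<bullet> v / 2)"
        by (simp add: Q_def blinfun.scaleR_right blinfun.add_right inner_add_left
            inner_add_right inner_commute field_simps power2_eq_square)
      with \<open>Q y \<le> Q (y + s *\<^sub>R v)\<close> show ?thesis by linarith
    qed
    from linear_coeff_zero[OF this] show ?thesis by simp
  qed
  then show ?thesis by blast
qed

lemma riesz_inv_riesz [simp]: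
  fixes f :: "'a::{real_inner, banach} \<Rightarrow>\<^sub>L real"
  shows "riesz (inv riesz f) = f"
proof -
  obtain x where "\<forall>v. f v = x \<bullet> v" using riesz_representation by blast
  then have "riesz x = f" by (intro blinfun_eqI) simp
  then show ?thesis by (metis f_inv_into_f rangeI)
qed

lemma inner_inv_riesz [simp]:
  fixes f :: "'a::{real_inner, banach} \<Rightarrow>\<^sub>L real"
  shows "inv riesz f \<bullet> v = f v"
  by (metis riesz_apply riesz_inv_riesz)

lemma inner_eqI: "(\<And>v. x \<bullet> v = y \<bullet> v) \<Longrightarrow> x = (y :: 'a::real_inner)"
  using vector_eq_ldot[of x y] by (simp add: inner_commute)

lemma inv_riesz_riesz [simp]:
  fixes x :: "'a::{real_inner, banach}"
  shows "inv riesz (riesz x) = x"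
  by (rule inner_eqI) simp

text \<open>Evaluating \<open>f\<close> at its own representative gives the squared norm of the
  latter, and dividing once by this norm leaves the bound.\<close>

lemma bounded_linear_inv_riesz:
  "bounded_linear (inv riesz :: ('a::{real_inner, banach} \<Rightarrow>\<^sub>L real) \<Rightarrow> 'a)"
proof (rule bounded_linear_intro)
  fix f :: "'a \<Rightarrow>\<^sub>L real"
  have "(norm (inv riesz f))\<^sup>2 = f (inv riesz f)" by (simp add: power2_norm_eq_inner)
  also have "\<dots> \<le> norm f * norm (inv riesz f)" using norm_blinfun[of f "inv riesz f"] by (simp add: abs_le_iff)
  finally show "norm (inv riesz f) \<le> norm f * 1"
    by (cases "norm (inv riesz f) = 0") (auto simp: power2_eq_square)
qed (rule inner_eqI, simp add: inner_add_left plus_blinfun.rep_eq scaleR_blinfun.rep_eq)+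

lemma bounded_linear_riesz: "bounded_linear (riesz :: 'a::real_inner \<Rightarrow> _)"
  unfolding riesz_def by (rule bounded_linear_blinfun_inner_right)

text \<open>The Hilbert space adjoint as an element of the space of bounded operators. In contrast,
  \<open>adjoint\<close> is a plain function chosen by its defining identity, from which boundedness
  cannot be read off.\<close>

definition adj :: "('a::{real_inner, banach} \<Rightarrow>\<^sub>L 'b::real_inner) \<Rightarrow> 'b \<Rightarrow>\<^sub>L 'a" where
  "adj f = Blinfun (\<lambda>y. inv riesz (blinfun_inner_right y o\<^sub>L f))"

lemma adj_apply: "adj f y = inv riesz (blinfun_inner_right y o\<^sub>L f)"
proof -
  have "bounded_linear (\<lambda>y. inv riesz (blinfun_inner_right y o\<^sub>L f))"
    by (intro bounded_linear_compose[OF bounded_linear_inv_riesz]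
        bounded_bilinear.bounded_linear_left[OF bounded_bilinear_blinfun_compose, THEN bounded_linear_compose]
        bounded_linear_blinfun_inner_right)
  then show ?thesis by (simp add: adj_def bounded_linear_Blinfun_apply)
qed

lemma inner_adj: "adj f y \<bullet> x = y \<bullet> f x"
  by (simp add: adj_apply)

lemma inner_adj_right: "x \<bullet> adj f y = f x \<bullet> y"
  by (metis inner_adj inner_commute)

lemma norm_adj_le: "norm (adj f) \<le> norm f"
proof (rule norm_blinfun_bound)
  fix y
  have "(norm (adj f y))\<^sup>2 = y \<bullet> f (adj f y)" by (simp add: power2_norm_eq_inner inner_adj)
  also have "\<dots> \<le> norm y * (norm f * norm (adj f y))"
    by (rule order_trans[OF norm_cauchy_schwarz mult_left_mono[OF norm_blinfun]]) simp
  finally show "norm (adj f y) \<le> norm f * norm y"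
    by (cases "norm (adj f y) = 0") (auto simp: power2_eq_square mult_ac)
qed simp

text \<open>A map satisfying the defining identity of \<open>adjoint\<close> determines it, and
  \<open>adj f\<close> is such a map.\<close>

lemma adjoint_eq_adj:
  fixes f :: "'a::{real_inner, banach} \<Rightarrow>\<^sub>L 'b::real_inner"
  shows "adjoint (blinfun_apply f) = blinfun_apply (adj f)"
  by (rule adjoint_unique) (simp add: inner_adj_right)

text \<open>After the Riesz identification the inclusion of H into V' is the Hilbert adjoint of the
  embedding. This is what turns right-hand sides in V' into right-hand sides in V.\<close>

lemma to_dual_eq: "to_dual \<iota> h = riesz (adj \<iota> h)"
  by (rule blinfun_eqI) (simp add: to_dual_def inner_adj)

section \<open>Measurability of vector-valued functions and of operator families\<close>

text \<open>Pettis' theorem in a separable inner product space: membership in a closed ball amounts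
  to countably many scalar inequalities, and an open set is a countable union of closed
  balls.\<close>

lemma borel_measurable_weak:
  fixes f :: "'a \<Rightarrow> 'b::{real_inner, second_countable_topology}"
  assumes weak: "\<And>w. (\<lambda>t. f t \<bullet> w) \<in> borel_measurable M"
  shows "f \<in> borel_measurable M"
proof -
  obtain D :: "'b set" where D: "countable D" "\<And>X. open X \<Longrightarrow> X \<noteq> {} \<Longrightarrow> \<exists>d\<in>D. d \<in> X"
    by (erule countable_dense_setE)
  have norm_le: "norm x \<le> r \<longleftrightarrow> (\<forall>d\<in>D. x \<bullet> d \<le> r * norm d)" if "r \<ge> 0" for x r
  proof
    assume "norm x \<le> r"
    then show "\<forall>d\<in>D. x \<bullet> d \<le> r * norm d"
      by (meson dual_order.trans mult_right_mono norm_cauchy_schwarz norm_ge_zero)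
  next
    assume le: "\<forall>d\<in>D. x \<bullet> d \<le> r * norm d"
    show "norm x \<le> r"
    proof (rule ccontr)
      assume "\<not> norm x \<le> r"
      then have "r < norm x" "0 < norm x" using that by linarith+
      \<comment> \<open>The point \<open>x\<close> itself violates the inequality. The set of
        violating points is open, so it meets the dense set \<open>D\<close>.\<close>
      then have "x \<in> {d. x \<bullet> d > r * norm d}"
        by (simp add: dot_square_norm power2_eq_square mult_strict_right_mono)
      moreover have "open {d. x \<bullet> d > r * norm d}"
        by (intro open_Collect_less continuous_intros)
      ultimately obtain d where "d \<in> D" "x \<bullet> d > r * norm d" using D(2) by blast
      with le show False by force
    qed
  qed
  have ball: "{t \<in> space M. f t \<in> cball c r} \<in> sets M" if "r \<ge> 0" for c r
  proof -
    have "{t \<in> space M. f t \<in> cball c r} = {t \<in> space M. \<forall>d\<in>D. f t \<bullet> d - c \<bullet> d \<le> r * norm d}"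
      using norm_le[OF that] by (auto simp: dist_norm norm_minus_commute[of c] inner_diff_left)
    also have "\<dots> \<in> sets M"
      using weak D(1) by (intro sets.sets_Collect_countable_All') (auto intro!: borel_measurable_le)
    finally show ?thesis .
  qed
  show ?thesis
  proof (rule borel_measurableI)
    fix S :: "'b set" assume S: "open S"
    define I where "I = {p \<in> D \<times> (\<rat> \<inter> {0..}). cball (fst p) (snd p) \<subseteq> S}"
    have I: "countable I"
      unfolding I_def using D(1) countable_rat by (intro countable_Collect countable_SIGMA countable_Int1)
    have "\<exists>p\<in>I. x \<in> cball (fst p) (snd p)" if x: "x \<in> S" for x
    proof -
      obtain e where e: "e > 0" "cball x e \<subseteq> S" using S x open_contains_cball by blast
      obtain d where d: "d \<in> D" "d \<in> ball x (e / 3)" using D(2)[of "ball x (e / 3)"] e by auto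
      \<comment> \<open>A radius above \<open>e / 3\<close> makes the ball around \<open>d\<close>
        contain \<open>x\<close>; a radius below \<open>e / 2\<close> keeps it inside
        \<open>cball x e\<close>.\<close>
      obtain q where q: "q \<in> \<rat>" "e / 3 < q" "q < e / 2" using Rats_dense_in_real[of "e / 3" "e / 2"] e by auto
      have "cball d q \<subseteq> cball x e"
      proof
        fix z assume "z \<in> cball d q"
        then show "z \<in> cball x e" using d q dist_triangle[of x z d] by (auto simp: dist_commute)
      qed
      then show ?thesis
        using d q e by (intro bexI[of _ "(d, q)"]) (auto simp: I_def dist_commute)
    qed
    then have "f -` S \<inter> space M = (\<Union>p\<in>I. {t \<in> space M. f t \<in> cball (fst p) (snd p)})"
      by (fastforce simp: I_def)
    also have "\<dots> \<in> sets M"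
      using I by (rule sets.countable_UN') (use ball in \<open>simp add: I_def image_subset_iff\<close>)
    finally show "f -` S \<inter> space M \<in> sets M" .
  qed
qed

text \<open>Measurability of \<open>C\<close> is given only for fixed vectors. Therefore
  \<open>y\<close> is approximated by simple functions: on each of their finitely many values the
  hypothesis applies, and continuity of each \<open>C t\<close> passes to the limit.\<close>

lemma measurable_operator_family:
  fixes C :: "'a \<Rightarrow> 'b::{real_inner, second_countable_topology} \<Rightarrow>\<^sub>L 'c::{real_inner, second_countable_topology}"
  assumes C: "\<And>v w. (\<lambda>t. C t v \<bullet> w) \<in> borel_measurable M" and y: "y \<in> borel_measurable M"
  shows "(\<lambda>t. C t (y t)) \<in> borel_measurable M"
proof (rule borel_measurable_weak)
  fix w
  obtain s where s: "\<And>i. simple_function M (s i)" "\<And>x. x \<in> space M \<Longrightarrow> (\<lambda>i. s i x) \<longlonglongrightarrow> y x"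
    using borel_measurable_implies_sequence_metric[OF y, of 0] by blast
  show "(\<lambda>t. C t (y t) \<bullet> w) \<in> borel_measurable M"
  proof (rule borel_measurable_LIMSEQ_real)
    show "(\<lambda>i. C t (s i t) \<bullet> w) \<longlonglongrightarrow> C t (y t) \<bullet> w" if "t \<in> space M" for t
      using s(2)[OF that] by (intro tendsto_intros)
    show "(\<lambda>t. C t (s i t) \<bullet> w) \<in> borel_measurable M" for i
    proof (rule measurable_compose_countable'[where I = "s i ` space M"])
      show "(\<lambda>t. C t v \<bullet> w) \<in> borel_measurable M" for v by (rule C)
      show "s i \<in> measurable M (count_space (s i ` space M))"
        using s(1)[of i] by (auto simp: simple_function_def measurable_count_space_eq2)
      show "countable (s i ` space M)"
        using s(1)[of i] by (simp add: simple_function_def countable_finite)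
    qed
  qed
qed

lemma Linfty_op_bound:
  assumes "Linfty_op T C"
  obtains K where "K > 0" "AE t in time T. norm (C t) \<le> K"
proof -
  obtain K where "AE t in time T. norm (C t) \<le> K" using assms by (auto simp: Linfty_op_def)
  then have "AE t in time T. norm (C t) \<le> \<bar>K\<bar> + 1" by eventually_elim auto
  then show thesis by (intro that[of "\<bar>K\<bar> + 1"]) auto
qed

lemma Linfty_op_L2_norm:
  fixes C :: "real \<Rightarrow> 'h::{real_inner, second_countable_topology} \<Rightarrow>\<^sub>L 'h"
  assumes C: "Linfty_op T C"
  obtains K where "K > 0"
    "\<And>y. y \<in> L2 (time T) \<Longrightarrow> (\<lambda>t. C t (y t)) \<in> L2 (time T)"
    "\<And>y. y \<in> L2 (time T) \<Longrightarrow> L2_norm (time T) (\<lambda>t. C t (y t)) \<le> K * L2_norm (time T) y"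
proof -
  obtain K where K: "K > 0" "AE t in time T. norm (C t) \<le> K" using Linfty_op_bound[OF C] .
  have meas: "(\<lambda>t. C t (y t)) \<in> borel_measurable (time T)" if "y \<in> L2 (time T)" for y
    using C L2_measurable[OF that] by (intro measurable_operator_family) (auto simp: Linfty_op_def)
  have le: "AE t in time T. norm (C t (y t)) \<le> K * norm (y t)" for y
    using K(2)
  proof eventually_elim
    case (elim t)
    then show ?case by (meson mult_right_mono norm_blinfun norm_ge_zero order_trans)
  qed
  show thesis
    using K(1) L2_bounded[OF _ meas le] L2_norm_bounded[OF _ meas _ le] by (intro that[of K]) auto
qed

lemma Linfty_op_adj:
  fixes C :: "real \<Rightarrow> 'h::{real_inner, banach} \<Rightarrow>\<^sub>L 'h"
  assumes "Linfty_op T C"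
  shows "Linfty_op T (\<lambda>t. adj (C t))"
proof -
  obtain K where "K > 0" and K: "AE t in time T. norm (C t) \<le> K" using Linfty_op_bound[OF assms] .
  from K have "AE t in time T. norm (adj (C t)) \<le> K"
    by eventually_elim (rule order_trans[OF norm_adj_le])
  moreover have "(\<lambda>t. adj (C t) v \<bullet> w) \<in> borel_measurable (time T)" for v w
  proof -
    have "(\<lambda>t. C t w \<bullet> v) \<in> borel_measurable (time T)" using assms by (simp add: Linfty_op_def)
    then show ?thesis by (simp add: inner_adj inner_commute[of v])
  qed
  ultimately show ?thesis by (auto simp: Linfty_op_def)
qed

text \<open>A map into the dual, read as an operator into the space itself through the Riesz map.
  For \<open>A t\<close> this is the operator called \<open>M t\<close> below, for \<open>B\<close>
  the control operator \<open>N\<close>.\<close>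

definition form_op :: "('a::real_normed_vector \<Rightarrow>\<^sub>L 'v::{real_inner, banach} \<Rightarrow>\<^sub>L real) \<Rightarrow> 'a \<Rightarrow>\<^sub>L 'v" where
  "form_op a = Blinfun (inv riesz) o\<^sub>L a"

lemma form_op_apply: "form_op a v = inv riesz (a v)"
  by (simp add: form_op_def bounded_linear_Blinfun_apply bounded_linear_inv_riesz)

text \<open>Under the Riesz identification the dual operators A'(t) and B' are Hilbert
  adjoints.\<close>

lemma inv_riesz_dual_op: "inv riesz (dual_op F x) = adj (form_op F) x"
  for F :: "'a::{real_inner, banach} \<Rightarrow>\<^sub>L 'b::{real_inner, banach} \<Rightarrow>\<^sub>L real"
  by (rule inner_eqI) (simp add: inner_adj dual_op_apply form_op_apply inner_commute[of x])

lemma riesz_add: "riesz (x + y) = riesz x + riesz y"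
  by (rule linear_add[OF bounded_linear.linear[OF bounded_linear_riesz]])

lemma inv_riesz_add: "inv riesz (f + g) = inv riesz f + (inv riesz g :: 'a::{real_inner, banach})"
  by (rule linear_add[OF bounded_linear.linear[OF bounded_linear_inv_riesz]])

lemma Linfty_op_form_op:
  assumes "Linfty_form T A"
  shows "Linfty_op T (\<lambda>t. form_op (A t))"
proof -
  obtain K where K: "AE t in time T. norm (A t) \<le> K" using assms by (auto simp: Linfty_form_def)
  have "AE t in time T. norm (form_op (A t)) \<le> norm (Blinfun (inv riesz) :: _ \<Rightarrow>\<^sub>L 'a) * K"
    using K unfolding form_op_def
    by eventually_elim (rule order_trans[OF norm_blinfun_compose mult_left_mono], simp_all)
  with assms show ?thesis by (auto simp: Linfty_op_def Linfty_form_def form_op_apply)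
qed


subsection \<open>Translations and Steklov averages\<close>

text \<open>Shifts, Fubini and the fundamental theorem of calculus are used on
  \<open>lborel\<close>, whereas \<open>time T\<close> is completed. For a Borel integrand the two
  integrals agree once it is cut off outside (0,T).\<close>

lemma integral_time_borel:
  fixes g :: "real \<Rightarrow> 'b::{banach, second_countable_topology}"
  assumes g: "g \<in> borel_measurable borel"
  shows "(LINT t|time T. g t) = (LINT t|lborel. indicator {0<..<T} t *\<^sub>R g t)"
    and "integrable (time T) g \<longleftrightarrow> integrable lborel (\<lambda>t. indicator {0<..<T} t *\<^sub>R g t)"
proof -
  have m: "(\<lambda>t. indicator {0<..<T} t *\<^sub>R g t) \<in> borel_measurable lborel" using g by simp
  show "(LINT t|time T. g t) = (LINT t|lborel. indicator {0<..<T} t *\<^sub>R g t)"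
    by (subst integral_restrict_space) (use integral_completion[OF m] in simp_all)
  show "integrable (time T) g \<longleftrightarrow> integrable lborel (\<lambda>t. indicator {0<..<T} t *\<^sub>R g t)"
    by (subst integrable_restrict_space) (use integrable_completion[OF m] in simp_all)
qed

lemma finite_measure_time: "finite_measure (time T)"
  by (rule finite_measureI) (cases "T \<ge> 0"; simp add: emeasure_restrict_space)

lemma borel_measurable_time_borel: "g \<in> borel_measurable borel \<Longrightarrow> g \<in> borel_measurable (time T)"
  by (intro measurable_restrict_space1 measurable_completion) simp

lemma L2_time_borel:
  fixes g :: "real \<Rightarrow> 'b::{real_inner, second_countable_topology}"
  assumes "g \<in> L2 lborel"
  shows "g \<in> L2 (time T)"
proof -
  have m: "g \<in> borel_measurable borel" using L2_measurable[OF assms] by simp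
  have i: "integrable lborel (\<lambda>t. indicator {0<..<T} t *\<^sub>R (norm (g t))\<^sup>2)"
    by (rule Bochner_Integration.integrable_bound[OF L2_integrable[OF assms]])
       (use m in \<open>auto simp: indicator_def\<close>)
  have "integrable (time T) (\<lambda>t. (norm (g t))\<^sup>2)"
    using m i by (subst integral_time_borel(2)) simp_all
  with m show ?thesis by (simp add: L2_def borel_measurable_time_borel)
qed

text \<open>A Lebesgue measurable simple function agrees a.e. with a Borel one, and \<open>f\<close>
  is a limit of simple functions. Because it vanishes outside (0,T), the representative can be
  shifted and averaged on the whole line.\<close>

lemma L2_time_borel_representative:
  fixes f :: "real \<Rightarrow> 'b::{real_inner, banach, second_countable_topology}"
  assumes f: "f \<in> L2 (time T)"
  obtains g where "g \<in> L2 lborel" "\<And>t. t \<notin> {0<..<T} \<Longrightarrow> g t = 0" "AE t in time T. f t = g t"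
proof -
  define f0 where "f0 = (\<lambda>t. indicator {0<..<T} t *\<^sub>R f t)"
  have f0: "f0 \<in> borel_measurable lebesgue"
    using L2_measurable[OF f] unfolding f0_def by (subst (asm) borel_measurable_restrict_space_iff) auto
  obtain s where s: "\<And>i. simple_function lebesgue (s i)" "\<And>x. (\<lambda>i. s i x) \<longlonglongrightarrow> f0 x"
    using borel_measurable_implies_sequence_metric[OF f0, of 0] by auto
  have "\<exists>s'. simple_function lborel s' \<and> (AE x in lborel. s i x = s' x)" for i
    using completion_ex_simple_function[OF s(1)] .
  then obtain s' where s': "\<And>i. simple_function lborel (s' i)" "\<And>i. AE x in lborel. s i x = s' i x"
    by metis
  have [measurable]: "s' i \<in> borel_measurable borel" for i
    using borel_measurable_simple_function[OF s'(1)] by simp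
  define g where "g = (\<lambda>t. indicator {0<..<T} t *\<^sub>R lim (\<lambda>i. s' i t))"
  have gm: "g \<in> borel_measurable borel"
    unfolding g_def by (intro borel_measurable_scaleR borel_measurable_lim_metric) simp_all
  have "AE x in lborel. \<forall>i. s i x = s' i x"
    using s'(2) by (simp add: AE_all_countable)
  then have "AE x in lborel. f0 x = g x"
  proof eventually_elim
    case (elim x)
    then have "lim (\<lambda>i. s' i x) = f0 x" using s(2)[of x] by (intro limI) simp
    then show ?case by (simp add: g_def f0_def indicator_def)
  qed
  then have "AE x in lebesgue. f0 x = g x" by (rule AE_completion)
  then have ae: "AE t in time T. f t = g t"
    by (subst AE_restrict_space_iff) (auto simp: f0_def indicator_def elim!: eventually_mono)
  have "g \<in> L2 (time T)"
    by (rule L2_cong_AE[OF f borel_measurable_time_borel[OF gm] ae])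
  then have "integrable (time T) (\<lambda>t. (norm (g t))\<^sup>2)" by (rule L2_integrable)
  then have "integrable lborel (\<lambda>t. indicator {0<..<T} t *\<^sub>R (norm (g t))\<^sup>2)"
    using gm by (subst integral_time_borel(2)[symmetric]) simp_all
  also have "(\<lambda>t. indicator {0<..<T} t *\<^sub>R (norm (g t))\<^sup>2) = (\<lambda>t. (norm (g t))\<^sup>2)"
    by (auto simp: g_def indicator_def)
  finally have "g \<in> L2 lborel" using gm by (simp add: L2_def)
  with ae show thesis by (intro that[of g]) (auto simp: g_def)
qed

lemma L2_norm_in_L2:
  assumes "f \<in> L2 M"
  shows "(\<lambda>t. norm (f t)) \<in> L2 M"
  using measurable_compose[OF L2_measurable[OF assms] borel_measurable_norm] L2_integrable[OF assms]
  by (simp add: L2_def)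

lemma L2_lborel_shift:
  fixes f :: "real \<Rightarrow> 'b::{real_inner, second_countable_topology}"
  assumes "f \<in> L2 lborel"
  shows "(\<lambda>t. f (t + h)) \<in> L2 lborel" "L2_norm lborel (\<lambda>t. f (t + h)) = L2_norm lborel f"
proof -
  have m: "f \<in> borel_measurable borel" using L2_measurable[OF assms] by simp
  then have "(\<lambda>t. f (t + h)) \<in> borel_measurable borel" by measurable
  moreover have "integrable lborel (\<lambda>t. (norm (f (h + 1 * t)))\<^sup>2)"
    by (rule lborel_integrable_real_affine[OF L2_integrable[OF assms]]) simp
  ultimately show "(\<lambda>t. f (t + h)) \<in> L2 lborel" by (simp add: L2_def add.commute)
  show "L2_norm lborel (\<lambda>t. f (t + h)) = L2_norm lborel f"
    unfolding L2_norm_def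
    using lborel_integral_real_affine[of 1 "\<lambda>t. (norm (f t))\<^sup>2" h] by (simp add: add.commute)
qed

section \<open>Continuity of translations in L^2\<close>

definition translation_continuous :: "(real \<Rightarrow> 'b::real_normed_vector) \<Rightarrow> bool" where
  "translation_continuous f \<longleftrightarrow> ((\<lambda>h. L2_norm lborel (\<lambda>t. f (t + h) - f t)) \<longlongrightarrow> 0) (at 0)"

text \<open>A three-epsilon argument. The approximation error enters twice, once shifted, and a
  shift does not change its norm.\<close>

lemma translation_continuous_approx:
  fixes f :: "real \<Rightarrow> 'b::{real_inner, second_countable_topology}"
  assumes f: "f \<in> L2 lborel"
    and approx: "\<And>e. e > 0 \<Longrightarrow> \<exists>g\<in>L2 lborel. translation_continuous g \<and> L2_norm lborel (\<lambda>t. f t - g t) < e"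
  shows "translation_continuous f"
  unfolding translation_continuous_def
proof (rule tendstoI)
  fix e :: real assume "e > 0"
  then obtain g where g: "g \<in> L2 lborel" "translation_continuous g" "L2_norm lborel (\<lambda>t. f t - g t) < e / 3"
    using approx[of "e / 3"] by auto
  have "\<forall>\<^sub>F h in at 0. dist (L2_norm lborel (\<lambda>t. g (t + h) - g t)) 0 < e / 3"
    using g(2) \<open>e > 0\<close> unfolding translation_continuous_def by (intro tendstoD) auto
  then show "\<forall>\<^sub>F h in at 0. dist (L2_norm lborel (\<lambda>t. f (t + h) - f t)) 0 < e"
  proof eventually_elim
    case (elim h)
    have fg: "(\<lambda>t. f t - g t) \<in> L2 lborel" using f g by (intro L2_diff)
    have gh: "(\<lambda>t. g (t + h) - g t) \<in> L2 lborel" using g by (intro L2_diff L2_lborel_shift)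
    have "(\<lambda>t. f (t + h) - f t) = (\<lambda>t. ((f (t + h) - g (t + h)) + (g (t + h) - g t)) - (f t - g t))"
      by auto
    then have "L2_norm lborel (\<lambda>t. f (t + h) - f t)
        \<le> L2_norm lborel (\<lambda>t. (f (t + h) - g (t + h)) + (g (t + h) - g t)) + L2_norm lborel (\<lambda>t. f t - g t)"
      using L2_norm_triangle_diff[OF L2_add[OF L2_lborel_shift(1)[OF fg, of h] gh] fg] by simp
    moreover have "L2_norm lborel (\<lambda>t. (f (t + h) - g (t + h)) + (g (t + h) - g t))
        \<le> L2_norm lborel (\<lambda>t. f t - g t) + L2_norm lborel (\<lambda>t. g (t + h) - g t)"
      using L2_norm_triangle[OF L2_lborel_shift(1)[OF fg, of h] gh] L2_lborel_shift(2)[OF fg, of h] by simp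
    ultimately show ?case using elim g(3) by simp
  qed
qed

lemma translation_continuous_add:
  fixes f g :: "real \<Rightarrow> 'b::{real_inner, second_countable_topology}"
  assumes f: "f \<in> L2 lborel" "translation_continuous f" and g: "g \<in> L2 lborel" "translation_continuous g"
  shows "translation_continuous (\<lambda>t. f t + g t)"
proof -
  have "((\<lambda>h. L2_norm lborel (\<lambda>t. f (t + h) - f t) + L2_norm lborel (\<lambda>t. g (t + h) - g t)) \<longlongrightarrow> 0 + 0) (at 0)"
    using f(2) g(2) unfolding translation_continuous_def by (intro tendsto_add)
  moreover have "L2_norm lborel (\<lambda>t. (f (t + h) + g (t + h)) - (f t + g t))
      \<le> L2_norm lborel (\<lambda>t. f (t + h) - f t) + L2_norm lborel (\<lambda>t. g (t + h) - g t)" for h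
    using L2_norm_triangle[OF L2_diff[OF L2_lborel_shift(1)[OF f(1)] f(1)] L2_diff[OF L2_lborel_shift(1)[OF g(1)] g(1)], of h h]
    by (simp add: algebra_simps)
  ultimately show ?thesis
    unfolding translation_continuous_def
    by - (rule Lim_null_comparison[where g = "\<lambda>h. L2_norm lborel (\<lambda>t. f (t + h) - f t) + L2_norm lborel (\<lambda>t. g (t + h) - g t)"], simp_all)
qed

text \<open>The two indicators differ on a symmetric difference. As \<open>K\<close> is closed, a
  point outside \<open>K\<close> stays outside under small shifts, so the measure of this set tends
  to zero by dominated convergence.\<close>

lemma translation_continuous_compact:
  fixes v :: "'b::{real_inner, banach, second_countable_topology}"
  assumes K: "compact K"
  shows "translation_continuous (\<lambda>t. indicator K t *\<^sub>R v)"
proof -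
  obtain R where R: "\<And>t. t \<in> K \<Longrightarrow> \<bar>t\<bar> \<le> R"
    using compact_imp_bounded[OF K] unfolding bounded_iff by auto
  have [measurable]: "K \<in> sets borel" using K by (rule borel_compact)
  have finK: "emeasure lborel K < \<infinity>"
    using emeasure_bounded_finite[OF compact_imp_bounded[OF K]] .
  \<comment> \<open>Half of the symmetric difference suffices: \<open>K\<close> and its translate
    have the same measure, so the other half is equally large. Hence the factor 2 in
    \<open>eq\<close>.\<close>
  define a where "a = (\<lambda>h. LINT t|lborel. indicator K (t + h) * (1 - indicator K t) :: real)"
  have a: "(a \<longlongrightarrow> 0) (at 0)"
  proof (subst tendsto_at_iff_sequentially, intro allI impI)
    fix X :: "nat \<Rightarrow> real" assume X: "X \<longlonglongrightarrow> 0"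
    \<comment> \<open>From \<open>N\<close> on the shifts are shorter than 1, and all integrands
      live on a fixed bounded interval that dominates them.\<close>
    have "\<forall>\<^sub>F i in sequentially. \<bar>X i\<bar> < 1" using tendstoD[OF X, of 1] by simp
    then obtain N where N: "\<And>i. i \<ge> N \<Longrightarrow> \<bar>X i\<bar> < 1" by (auto simp: eventually_sequentially)
    have "(\<lambda>i. LINT t|lborel. indicator K (t + X (i + N)) * (1 - indicator K t) :: real) \<longlonglongrightarrow> (LINT t|(lborel :: real measure). 0 :: real)"
    proof (rule integral_dominated_convergence[where w = "indicator {- R - 1..R + 1}"])
      show "AE t in lborel. (\<lambda>i. indicator K (t + X (i + N)) * (1 - indicator K t) :: real) \<longlonglongrightarrow> 0"
      proof (rule AE_I2)
        fix t
        show "(\<lambda>i. indicator K (t + X (i + N)) * (1 - indicator K t) :: real) \<longlonglongrightarrow> 0"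
        proof (cases "t \<in> K")
          case False
          have "(\<lambda>i. t + X (i + N)) \<longlonglongrightarrow> t + 0" by (intro tendsto_intros LIMSEQ_ignore_initial_segment X)
          moreover have "open (- K)" "t + 0 \<in> - K" using K False compact_imp_closed by auto
          ultimately have "\<forall>\<^sub>F i in sequentially. t + X (i + N) \<in> - K" by (rule topological_tendstoD)
          then show ?thesis by (intro tendsto_eventually) (auto elim!: eventually_mono)
        qed simp
      qed
      show "AE t in lborel. norm (indicator K (t + X (i + N)) * (1 - indicator K t) :: real) \<le> indicator {- R - 1..R + 1} t" for i
      proof (rule AE_I2)
        fix t
        have "\<bar>X (i + N)\<bar> < 1" by (rule N) simp
        then show "norm (indicator K (t + X (i + N)) * (1 - indicator K t) :: real) \<le> indicator {- R - 1..R + 1} t"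
          using R[of "t + X (i + N)"] by (auto simp: indicator_def)
      qed
      show "integrable lborel (indicator {- R - 1..R + 1} :: real \<Rightarrow> real)"
        by (rule integrable_real_indicator) (auto simp: emeasure_lborel_Icc_eq)
    qed simp_all
    then have "(\<lambda>i. a (X (i + N))) \<longlonglongrightarrow> 0" by (simp add: a_def)
    then show "(a \<circ> X) \<longlonglongrightarrow> 0" unfolding o_def by (rule LIMSEQ_offset)
  qed
  have ind_int: "integrable lborel (\<lambda>t. indicator K t :: real)"
    using finK by (intro integrable_real_indicator) auto
  have shift_int: "integrable lborel (\<lambda>t. indicator K (t + h) :: real)"
    and shift_eq: "(LINT t|lborel. indicator K (t + h) :: real) = (LINT t|lborel. indicator K t)" for h
    using lborel_integrable_real_affine[OF ind_int, of 1 h]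
      lborel_integral_real_affine[of 1 "\<lambda>t. indicator K t :: real" h] by (simp_all add: add.commute)
  have prod_int: "integrable lborel (\<lambda>t. indicator K (t + h) * indicator K t :: real)" for h
    by (rule Bochner_Integration.integrable_bound[OF ind_int]) (auto simp: indicator_def)
  have eq: "L2_norm lborel (\<lambda>t. indicator K (t + h) *\<^sub>R v - indicator K t *\<^sub>R v) = sqrt (2 * a h * (norm v)\<^sup>2)" for h
  proof -
    have "(norm (indicator K (t + h) *\<^sub>R v - indicator K t *\<^sub>R v))\<^sup>2
        = (indicator K (t + h) + indicator K t - 2 * (indicator K (t + h) * indicator K t)) * (norm v)\<^sup>2" for t
      by (auto simp: indicator_def)
    then have "(LINT t|lborel. (norm (indicator K (t + h) *\<^sub>R v - indicator K t *\<^sub>R v))\<^sup>2)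
        = (2 * (LINT t|lborel. indicator K t) - 2 * (LINT t|lborel. indicator K (t + h) * indicator K t)) * (norm v)\<^sup>2"
      using ind_int shift_int[of h] prod_int[of h] shift_eq[of h] by simp
    moreover have "a h = (LINT t|lborel. indicator K t) - (LINT t|lborel. indicator K (t + h) * indicator K t)"
      unfolding a_def right_diff_distrib using shift_int[of h] prod_int[of h] shift_eq[of h] by simp
    ultimately show ?thesis by (simp add: L2_norm_def)
  qed
  have "((\<lambda>h. sqrt (2 * a h * (norm v)\<^sup>2)) \<longlongrightarrow> sqrt (2 * 0 * (norm v)\<^sup>2)) (at 0)"
    by (intro tendsto_intros a)
  then show ?thesis unfolding translation_continuous_def eq by simp
qed

lemma L2_indicator:
  fixes v :: "'b::{real_inner, second_countable_topology}"
  assumes "E \<in> sets lborel" "emeasure lborel E < \<infinity>"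
  shows "(\<lambda>t. indicator E t *\<^sub>R v) \<in> L2 lborel"
proof -
  have "integrable lborel (\<lambda>t. indicator E t * (norm v)\<^sup>2)"
    using assms by (intro integrable_mult_left integrable_real_indicator) auto
  moreover have "(\<lambda>t. (norm (indicator E t *\<^sub>R v))\<^sup>2) = (\<lambda>t. indicator E t * (norm v)\<^sup>2)"
    by (auto simp: indicator_def)
  moreover have "(\<lambda>t. indicator E t *\<^sub>R v) \<in> borel_measurable lborel"
    using assms by (intro borel_measurable_scaleR borel_measurable_indicator borel_measurable_const)
  ultimately show ?thesis unfolding L2_def by simp
qed

text \<open>Inner regularity approximates \<open>E\<close> by a compact subset in measure, and hence
  its indicator in L^2.\<close>

lemma translation_continuous_bounded_set:
  fixes v :: "'b::{real_inner, banach, second_countable_topology}"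
  assumes E: "E \<in> sets borel" "bounded E"
  shows "translation_continuous (\<lambda>t. indicator E t *\<^sub>R v)"
proof (rule translation_continuous_approx)
  show "(\<lambda>t. indicator E t *\<^sub>R v) \<in> L2 lborel"
    using E emeasure_bounded_finite by (intro L2_indicator) auto
  fix e :: real assume e: "e > 0"
  \<comment> \<open>Chosen to give \<open>d * (norm v)\<^sup>2 < e\<^sup>2\<close>; the summand 1
    avoids division by zero for \<open>v = 0\<close>.\<close>
  define d where "d = e\<^sup>2 / ((norm v)\<^sup>2 + 1)"
  have d: "d > 0" using e by (simp add: d_def add_nonneg_pos)
  obtain K where K: "closed K" "K \<subseteq> E" "E - K \<in> lmeasurable" "emeasure lebesgue (E - K) < ennreal d"
    using sets_lebesgue_inner_closed[of E d] E d by auto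
  have cK: "compact K" using K E(2) bounded_subset compact_eq_bounded_closed by blast
  have [measurable]: "K \<in> sets borel" using cK by (rule borel_compact)
  have Km: "E - K \<in> sets lborel" using E by auto
  have fin: "emeasure lborel (E - K) < ennreal d" using K(4) Km by simp
  then have "ennreal (measure lborel (E - K)) < ennreal d"
    by (subst emeasure_eq_ennreal_measure[symmetric]) (use less_trans[OF fin ennreal_less_top] in auto)
  then have "measure lborel (E - K) < d" using d by (simp add: ennreal_less_iff)
  have "(\<lambda>t. indicator E t *\<^sub>R v - indicator K t *\<^sub>R v) = (\<lambda>t. indicator (E - K) t *\<^sub>R v)"
    using K(2) by (auto simp: indicator_def fun_eq_iff)
  moreover have "(\<lambda>t. (norm (indicator (E - K) t *\<^sub>R v))\<^sup>2) = (\<lambda>t. indicator (E - K) t * (norm v)\<^sup>2)"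
    by (auto simp: indicator_def)
  ultimately have "L2_norm lborel (\<lambda>t. indicator E t *\<^sub>R v - indicator K t *\<^sub>R v) = sqrt (measure lborel (E - K) * (norm v)\<^sup>2)"
    by (simp add: L2_norm_def)
  also have "\<dots> < e"
  proof (rule real_less_lsqrt)
    have "measure lborel (E - K) * (norm v)\<^sup>2 \<le> d * (norm v)\<^sup>2"
      using \<open>measure lborel (E - K) < d\<close> by (intro mult_right_mono) auto
    also have "\<dots> < d * ((norm v)\<^sup>2 + 1)" using d by simp
    also have "\<dots> = e\<^sup>2" by (simp add: d_def add_nonneg_pos less_imp_neq[symmetric])
    finally show "measure lborel (E - K) * (norm v)\<^sup>2 < e\<^sup>2" .
  qed (use e in auto)
  finally show "\<exists>g\<in>L2 lborel. translation_continuous g \<and> L2_norm lborel (\<lambda>t. indicator E t *\<^sub>R v - g t) < e"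
    using translation_continuous_compact[OF cK] emeasure_bounded_finite[OF compact_imp_bounded[OF cK]]
    by (intro bexI[of _ "\<lambda>t. indicator K t *\<^sub>R v"]) (auto intro!: L2_indicator)
qed

text \<open>Simple functions approximate \<open>f\<close> in L^2, and each of them is a finite
  combination of indicators of bounded sets.\<close>

lemma translation_continuous_bounded_support:
  fixes f :: "real \<Rightarrow> 'b::{real_inner, banach, second_countable_topology}"
  assumes f: "f \<in> L2 lborel" and supp: "bounded S" "\<And>t. t \<notin> S \<Longrightarrow> f t = 0"
  shows "translation_continuous f"
proof (rule translation_continuous_approx[OF f])
  obtain s where s: "\<And>i. simple_function lborel (s i)" "\<And>t. (\<lambda>i. s i t) \<longlonglongrightarrow> f t"
    "\<And>i t. norm (s i t) \<le> 2 * norm (f t)"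
    using borel_measurable_implies_sequence_metric[OF L2_measurable[OF f], of 0] by (auto simp: dist_norm)
  have sm: "s i \<in> borel_measurable lborel" for i by (rule borel_measurable_simple_function[OF s(1)])
  have sL2: "s i \<in> L2 lborel" for i
    by (rule L2_bounded[OF f sm]) (use s(3) in auto)
  have tc: "translation_continuous (s i)" for i
  proof -
    have fin: "finite (range (s i))" using s(1)[of i] by (simp add: simple_function_def)
    have "(\<lambda>t. \<Sum>v\<in>F. indicator (s i -` {v}) t *\<^sub>R v) \<in> L2 lborel \<and>
        translation_continuous (\<lambda>t. \<Sum>v\<in>F. indicator (s i -` {v}) t *\<^sub>R v)" if "finite F" for F
      using that
    proof induction
      case empty
      then show ?case by (simp add: translation_continuous_def L2_norm_def)
    next
      case (insert v F)
      have 1: "(\<lambda>t. indicator (s i -` {v}) t *\<^sub>R v) \<in> L2 lborel \<and> translation_continuous (\<lambda>t. indicator (s i -` {v}) t *\<^sub>R v)"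
      proof (cases "v = 0")
        case True
        then show ?thesis by (simp add: translation_continuous_def L2_norm_def)
      next
        case False
        \<comment> \<open>The domination by \<open>2 * norm (f t)\<close> lets a nonzero value occur
          only where \<open>f\<close> is nonzero, so its level set is bounded.\<close>
        have "s i -` {v} \<subseteq> S"
          using s(3)[of i] supp(2) False by (metis mult_zero_right norm_le_zero_iff norm_zero singletonD subsetI vimageE)
        then have "bounded (s i -` {v})" using supp(1) bounded_subset by blast
        moreover have "s i -` {v} \<in> sets borel"
          using simple_functionD(2)[OF s(1), of i "{v}"] by simp
        ultimately show ?thesis
          using emeasure_bounded_finite by (intro conjI L2_indicator translation_continuous_bounded_set) simp_all
      qed
      have 2: "(\<lambda>t. \<Sum>v\<in>F. indicator (s i -` {v}) t *\<^sub>R v) \<in> L2 lborel"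
        "translation_continuous (\<lambda>t. \<Sum>v\<in>F. indicator (s i -` {v}) t *\<^sub>R v)"
        using insert.IH by blast+
      show ?case
        unfolding sum.insert[OF insert.hyps] using 1 2
        by (intro conjI L2_add translation_continuous_add) blast+
    qed
    from this[OF fin] have "translation_continuous (\<lambda>t. \<Sum>v\<in>range (s i). indicator (s i -` {v}) t *\<^sub>R v)" by blast
    also have "(\<lambda>t. \<Sum>v\<in>range (s i). indicator (s i -` {v}) t *\<^sub>R v) = s i"
    proof
      fix t
      have "(\<Sum>v\<in>range (s i). indicator (s i -` {v}) t *\<^sub>R v) = (\<Sum>v\<in>range (s i). if v = s i t then v else 0)"
        by (rule sum.cong) (auto simp: indicator_def)
      then show "(\<Sum>v\<in>range (s i). indicator (s i -` {v}) t *\<^sub>R v) = s i t" using fin by simp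
    qed
    finally show ?thesis .
  qed
  fix e :: real assume e: "e > 0"
  \<comment> \<open>The factor 9 is the square of 3, from
    \<open>norm (f t - s i t) \<le> norm (f t) + 2 * norm (f t)\<close>.\<close>
  have "(\<lambda>i. LINT t|lborel. (norm (f t - s i t))\<^sup>2) \<longlonglongrightarrow> (LINT t|(lborel :: real measure). 0 :: real)"
  proof (rule integral_dominated_convergence[where w = "\<lambda>t. 9 * (norm (f t))\<^sup>2"])
    show "integrable lborel (\<lambda>t. 9 * (norm (f t))\<^sup>2)" using L2_integrable[OF f] by simp
    show "AE t in lborel. (\<lambda>i. (norm (f t - s i t))\<^sup>2) \<longlonglongrightarrow> 0"
    proof (rule AE_I2)
      fix t
      have "(\<lambda>i. (norm (f t - s i t))\<^sup>2) \<longlonglongrightarrow> (norm (f t - f t))\<^sup>2" by (intro tendsto_intros s(2))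
      then show "(\<lambda>i. (norm (f t - s i t))\<^sup>2) \<longlonglongrightarrow> 0" by simp
    qed
    show "AE t in lborel. norm ((norm (f t - s i t))\<^sup>2) \<le> 9 * (norm (f t))\<^sup>2" for i
    proof (rule AE_I2)
      fix t
      have "norm (f t - s i t) \<le> 3 * norm (f t)" using norm_triangle_ineq4[of "f t" "s i t"] s(3)[of i t] by linarith
      then have "(norm (f t - s i t))\<^sup>2 \<le> (3 * norm (f t))\<^sup>2" by (intro power_mono) auto
      then show "norm ((norm (f t - s i t))\<^sup>2) \<le> 9 * (norm (f t))\<^sup>2" by (simp add: power_mult_distrib)
    qed
  qed (use sm L2_measurable[OF f] in simp_all)
  then have "(\<lambda>i. L2_norm lborel (\<lambda>t. f t - s i t)) \<longlonglongrightarrow> 0"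
    unfolding L2_norm_def using tendsto_real_sqrt by fastforce
  then have "\<forall>\<^sub>F i in sequentially. L2_norm lborel (\<lambda>t. f t - s i t) < e"
    using e by (rule order_tendstoD)
  then obtain i where "L2_norm lborel (\<lambda>t. f t - s i t) < e"
    using eventually_happens trivial_limit_sequentially by blast
  with sL2 tc show "\<exists>g\<in>L2 lborel. translation_continuous g \<and> L2_norm lborel (\<lambda>t. f t - g t) < e" by blast
qed

text \<open>Backward for \<open>h < 0\<close>, forward for \<open>h > 0\<close>.\<close>

definition steklov :: "real \<Rightarrow> (real \<Rightarrow> 'b::{banach, second_countable_topology}) \<Rightarrow> real \<Rightarrow> 'b" where
  "steklov h f t = (LINT s|lborel. indicator {0..1} s *\<^sub>R f (t + h * s))"

lemma steklov_forward:
  assumes "h > 0"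
  shows "h *\<^sub>R steklov h f t = (LINT s|lborel. indicator {t..t + h} s *\<^sub>R f s)"
proof -
  have "(LINT s|lborel. indicator {t..t + h} s *\<^sub>R f s)
      = \<bar>h\<bar> *\<^sub>R (LINT s|lborel. indicator {t..t + h} (t + h * s) *\<^sub>R f (t + h * s))"
    using assms by (intro lborel_integral_real_affine) simp
  also have "(\<lambda>s. indicator {t..t + h} (t + h * s) :: real) = indicator {0..1}"
    using assms by (auto simp: indicator_def zero_le_mult_iff)
  finally show ?thesis using assms by (simp add: steklov_def)
qed

lemma steklov_backward:
  assumes "h > 0"
  shows "h *\<^sub>R steklov (- h) f t = (LINT s|lborel. indicator {t - h..t} s *\<^sub>R f s)"
proof -
  have "(LINT s|lborel. indicator {t - h..t} s *\<^sub>R f s)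
      = \<bar>- h\<bar> *\<^sub>R (LINT s|lborel. indicator {t - h..t} (t + - h * s) *\<^sub>R f (t + - h * s))"
    using assms by (intro lborel_integral_real_affine) simp
  also have "(\<lambda>s. indicator {t - h..t} (t + - h * s) :: real) = indicator {0..1}"
    using assms by (auto simp: indicator_def zero_le_mult_iff)
  finally show ?thesis using assms by (simp add: steklov_def)
qed

text \<open>The average differs from \<open>f\<close> by the mean of
  \<open>f (t + h * s) - f t\<close> over \<open>s\<close> in [0,1]. Jensen's inequality and an
  exchange of the integrals bound its norm by that of the worst translate.\<close>

lemma steklov_L2:
  fixes f :: "real \<Rightarrow> 'b::{real_inner, banach, second_countable_topology}"
  assumes f: "f \<in> L2 lborel" and h: "h \<noteq> 0"
    and e: "\<And>k. \<bar>k\<bar> \<le> \<bar>h\<bar> \<Longrightarrow> L2_norm lborel (\<lambda>t. f (t + k) - f t) \<le> e"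
  shows "steklov h f \<in> L2 lborel" and "L2_norm lborel (\<lambda>t. steklov h f t - f t) \<le> e"
proof -
  have fm [measurable]: "f \<in> borel_measurable borel" using L2_measurable[OF f] by simp
  have sm [measurable]: "steklov h f \<in> borel_measurable borel"
  proof -
    have "(\<lambda>t. LINT s|lborel. indicator {0..1} s *\<^sub>R f (t + h * s)) \<in> borel_measurable borel"
      by (rule lborel.borel_measurable_lebesgue_integral) measurable
    then show ?thesis by (simp add: steklov_def[abs_def])
  qed
  \<comment> \<open>The case \<open>k = 0\<close> of the hypothesis; the sign of \<open>e\<close> is
    needed to take the root at the end.\<close>
  have "L2_norm lborel (\<lambda>t. f (t + 0) - f t) \<le> e" by (rule e) simp
  then have e0: "e \<ge> 0" using L2_norm_nonneg order_trans by blast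
  \<comment> \<open>Jensen's inequality is Cauchy-Schwarz against the indicator of [0,1], which has
    norm 1.\<close>
  have jensen: "ennreal ((norm (steklov h f t - f t))\<^sup>2)
      \<le> (\<integral>\<^sup>+s. indicator {0..1} s * ennreal ((norm (f (t + h * s) - f t))\<^sup>2) \<partial>lborel)" for t
  proof -
    define k where "k = (\<lambda>s::real. indicator {0..1} s *\<^sub>R (f (t + h * s) - f t))"
    have one: "(\<lambda>s::real. indicator {0..1} s *\<^sub>R (1::real)) \<in> L2 lborel"
      by (rule L2_indicator) auto
    have fs: "(\<lambda>s. f (t + h * s)) \<in> L2 lborel"
      using lborel_integrable_real_affine[OF L2_integrable[OF f] h, of t] by (simp add: L2_def)
    have fL: "(\<lambda>s::real. indicator {0..1} s *\<^sub>R f (t + h * s)) \<in> L2 lborel"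
      by (rule L2_bounded[OF fs, where K = 1]) (auto simp: indicator_def)
    have cL: "(\<lambda>s::real. indicator {0..1} s *\<^sub>R f t) \<in> L2 lborel" by (rule L2_indicator) auto
    have kL: "k \<in> L2 lborel" using L2_diff[OF fL cL] by (simp add: k_def scaleR_diff_right)
    have int1: "integrable lborel (\<lambda>s::real. indicator {0..1} s *\<^sub>R f (t + h * s))"
    proof -
      have "integrable lborel (\<lambda>s::real. norm (indicator {0..1} s *\<^sub>R (1::real)) * norm (norm (indicator {0..1} s *\<^sub>R f (t + h * s))))"
        by (rule L2_norm_mult_integrable[OF one]) (rule L2_norm_in_L2[OF fL])
      also have "(\<lambda>s::real. norm (indicator {0..1} s *\<^sub>R (1::real)) * norm (norm (indicator {0..1} s *\<^sub>R f (t + h * s))))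
          = (\<lambda>s::real. norm (indicator {0..1} s *\<^sub>R f (t + h * s)))"
        by (auto simp: indicator_def)
      finally show ?thesis by (subst (asm) integrable_norm_iff) simp_all
    qed
    have int2: "integrable lborel (\<lambda>s::real. indicator {0..1} s *\<^sub>R f t)"
      by (intro integrable_scaleR_left integrable_real_indicator) auto
    have "steklov h f t - f t = (LINT s|lborel. k s)"
      unfolding k_def scaleR_diff_right using int1 int2 by (simp add: steklov_def integral_scaleR_left)
    then have "norm (steklov h f t - f t) \<le> (LINT s|lborel. norm (k s))" by simp
    also have "(\<lambda>s. norm (k s)) = (\<lambda>s::real. norm (indicator {0..1} s *\<^sub>R (1::real)) * norm (norm (k s)))"
      by (auto simp: k_def indicator_def)
    also have "(LINT s::real|lborel. norm (indicator {0..1} s *\<^sub>R (1::real)) * norm (norm (k s)))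
        \<le> L2_norm lborel (\<lambda>s::real. indicator {0..1} s *\<^sub>R (1::real)) * L2_norm lborel (\<lambda>s. norm (k s))"
      by (rule L2_norm_mult_le[OF one]) (rule L2_norm_in_L2[OF kL])
    also have "L2_norm lborel (\<lambda>s::real. indicator {0..1} s *\<^sub>R (1::real)) = 1"
    proof -
      have "(\<lambda>s::real. (norm (indicator {0..1} s *\<^sub>R (1::real)))\<^sup>2) = indicator {0..1::real}"
        by (auto simp: indicator_def)
      then show ?thesis by (simp add: L2_norm_def)
    qed
    finally have "(norm (steklov h f t - f t))\<^sup>2 \<le> (L2_norm lborel k)\<^sup>2" by (intro power_mono) auto
    also have "ennreal ((L2_norm lborel k)\<^sup>2) = (\<integral>\<^sup>+s. ennreal ((norm (k s))\<^sup>2) \<partial>lborel)"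
      unfolding L2_norm_square by (rule nn_integral_eq_integral[symmetric]) (use L2_integrable[OF kL] in auto)
    also have "\<dots> = (\<integral>\<^sup>+s. indicator {0..1} s * ennreal ((norm (f (t + h * s) - f t))\<^sup>2) \<partial>lborel)"
      by (rule nn_integral_cong) (auto simp: k_def indicator_def)
    finally show ?thesis by (simp add: ennreal_leI)
  qed
  have "(\<integral>\<^sup>+t. ennreal ((norm (steklov h f t - f t))\<^sup>2) \<partial>lborel)
      \<le> (\<integral>\<^sup>+t. \<integral>\<^sup>+s. indicator {0..1} s * ennreal ((norm (f (t + h * s) - f t))\<^sup>2) \<partial>lborel \<partial>lborel)"
    by (rule nn_integral_mono[OF jensen])
  also have "\<dots> = (\<integral>\<^sup>+s. \<integral>\<^sup>+t. indicator {0..1} s * ennreal ((norm (f (t + h * s) - f t))\<^sup>2) \<partial>lborel \<partial>lborel)"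
    by (rule lborel_pair.Fubini') measurable
  also have "\<dots> \<le> (\<integral>\<^sup>+s. ennreal (e\<^sup>2) * indicator {0..1::real} s \<partial>lborel)"
  proof (rule nn_integral_mono)
    fix s :: real
    show "(\<integral>\<^sup>+t. indicator {0..1} s * ennreal ((norm (f (t + h * s) - f t))\<^sup>2) \<partial>lborel) \<le> ennreal (e\<^sup>2) * indicator {0..1} s"
    proof (cases "s \<in> {0..1}")
      case True
      then have "\<bar>h * s\<bar> \<le> \<bar>h\<bar>" by (simp add: abs_mult mult_left_le)
      then have "(L2_norm lborel (\<lambda>t. f (t + h * s) - f t))\<^sup>2 \<le> e\<^sup>2" by (intro power_mono e) auto
      moreover have "(\<integral>\<^sup>+t. ennreal ((norm (f (t + h * s) - f t))\<^sup>2) \<partial>lborel) = ennreal ((L2_norm lborel (\<lambda>t. f (t + h * s) - f t))\<^sup>2)"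
        unfolding L2_norm_square
        by (rule nn_integral_eq_integral) (use L2_integrable[OF L2_diff[OF L2_lborel_shift(1)[OF f] f]] in auto)
      ultimately show ?thesis using True by (simp add: ennreal_leI)
    qed simp
  qed
  also have "\<dots> = ennreal (e\<^sup>2)" by (simp add: nn_integral_cmult)
  finally have le: "(\<integral>\<^sup>+t. ennreal ((norm (steklov h f t - f t))\<^sup>2) \<partial>lborel) \<le> ennreal (e\<^sup>2)" .
  have int: "integrable lborel (\<lambda>t. (norm (steklov h f t - f t))\<^sup>2)"
  proof (rule integrableI_nonneg)
    show "(\<integral>\<^sup>+t. ennreal ((norm (steklov h f t - f t))\<^sup>2) \<partial>lborel) < \<infinity>"
      using le by (rule le_less_trans) simp
  qed simp_all
  then have d: "(\<lambda>t. steklov h f t - f t) \<in> L2 lborel" by (simp add: L2_def)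
  from L2_add[OF d f] show "steklov h f \<in> L2 lborel" by simp
  have "ennreal ((L2_norm lborel (\<lambda>t. steklov h f t - f t))\<^sup>2) \<le> ennreal (e\<^sup>2)"
    using le by (simp add: L2_norm_square nn_integral_eq_integral[OF int])
  then have "(L2_norm lborel (\<lambda>t. steklov h f t - f t))\<^sup>2 \<le> e\<^sup>2"
    by (subst (asm) ennreal_le_iff) simp_all
  then show "L2_norm lborel (\<lambda>t. steklov h f t - f t) \<le> e"
    by (rule power2_le_imp_le) (rule e0)
qed

text \<open>The triangle inequality puts every translate within \<open>2 * L2_norm lborel f\<close>
  of \<open>f\<close>, a bound that holds whatever the size of \<open>h\<close>.\<close>

lemma steklov_in_L2:
  fixes f :: "real \<Rightarrow> 'b::{real_inner, banach, second_countable_topology}"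
  assumes f: "f \<in> L2 lborel" and h: "h \<noteq> 0"
  shows "steklov h f \<in> L2 lborel"
proof (rule steklov_L2(1)[OF f h])
  fix k
  show "L2_norm lborel (\<lambda>t. f (t + k) - f t) \<le> 2 * L2_norm lborel f"
    using L2_norm_triangle_diff[OF L2_lborel_shift(1)[OF f] f, of k] L2_lborel_shift(2)[OF f, of k] by simp
qed

text \<open>Near 0, continuity of translations bounds all translates by \<open>k\<close> with
  \<open>\<bar>k\<bar> \<le> \<bar>h\<bar>\<close> at once, which is the hypothesis of
  \<open>steklov_L2\<close>.\<close>

lemma steklov_tendsto:
  fixes f :: "real \<Rightarrow> 'b::{real_inner, banach, second_countable_topology}"
  assumes f: "f \<in> L2 lborel" and tc: "translation_continuous f"
  shows "((\<lambda>h. L2_norm lborel (\<lambda>t. steklov h f t - f t)) \<longlongrightarrow> 0) (at 0)"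
proof (rule tendstoI)
  fix e :: real assume e: "e > 0"
  then have "\<forall>\<^sub>F h in at 0. dist (L2_norm lborel (\<lambda>t. f (t + h) - f t)) 0 < e / 2"
    using tc unfolding translation_continuous_def by (intro tendstoD) auto
  then obtain d where d: "d > 0" "\<And>h. h \<noteq> 0 \<Longrightarrow> \<bar>h\<bar> < d \<Longrightarrow> L2_norm lborel (\<lambda>t. f (t + h) - f t) < e / 2"
    unfolding eventually_at by auto
  have "L2_norm lborel (\<lambda>t. steklov h f t - f t) \<le> e / 2" if h: "h \<noteq> 0" "\<bar>h\<bar> < d" for h
  proof (rule steklov_L2(2)[OF f h(1)])
    fix k assume "\<bar>k\<bar> \<le> \<bar>h\<bar>"
    then show "L2_norm lborel (\<lambda>t. f (t + k) - f t) \<le> e / 2"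
      using d(2)[of k] h e by (cases "k = 0") (auto simp: L2_norm_def)
  qed
  then show "\<forall>\<^sub>F h in at 0. dist (L2_norm lborel (\<lambda>t. steklov h f t - f t)) 0 < e"
    unfolding eventually_at using d(1) e by (intro exI[of _ d]) force
qed


subsection \<open>Weakly differentiable paths\<close>

lemma L2_inner_tendsto2:
  fixes f g :: "'i \<Rightarrow> 'a \<Rightarrow> 'b::{real_inner, second_countable_topology}"
  assumes f: "\<And>n. f n \<in> L2 M" "f' \<in> L2 M" and g: "\<And>n. g n \<in> L2 M" "g' \<in> L2 M"
    and limf: "((\<lambda>n. L2_norm M (\<lambda>t. f n t - f' t)) \<longlongrightarrow> 0) F"
    and limg: "((\<lambda>n. L2_norm M (\<lambda>t. g n t - g' t)) \<longlongrightarrow> 0) F"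
  shows "((\<lambda>n. LINT t|M. f n t \<bullet> g n t) \<longlongrightarrow> (LINT t|M. f' t \<bullet> g' t)) F"
proof -
  \<comment> \<open>The first three terms contain at most one varying factor each, and the last is a
    product of two small ones.\<close>
  have eq: "(LINT t|M. f n t \<bullet> g n t) = (LINT t|M. f n t \<bullet> g' t) + (LINT t|M. g n t \<bullet> f' t) - (LINT t|M. g' t \<bullet> f' t)
      + (LINT t|M. (f n t - f' t) \<bullet> (g n t - g' t))" for n
    using L2_inner_integrable[OF f(1) g(1)] L2_inner_integrable[OF f(1) g(2)]
      L2_inner_integrable[OF g(1) f(2)] L2_inner_integrable[OF g(2) f(2)]
      L2_inner_integrable[OF f(2) g(2)] L2_inner_integrable[OF f(2) g(1)]
    by (simp add: inner_diff_left inner_diff_right inner_commute)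
  have "((\<lambda>n. LINT t|M. (f n t - f' t) \<bullet> (g n t - g' t)) \<longlongrightarrow> 0) F"
  proof (rule Lim_null_comparison)
    show "\<forall>\<^sub>F n in F. norm (LINT t|M. (f n t - f' t) \<bullet> (g n t - g' t))
        \<le> L2_norm M (\<lambda>t. f n t - f' t) * L2_norm M (\<lambda>t. g n t - g' t)"
      using L2_inner_le[OF L2_diff[OF f] L2_diff[OF g]] by simp
    show "((\<lambda>n. L2_norm M (\<lambda>t. f n t - f' t) * L2_norm M (\<lambda>t. g n t - g' t)) \<longlongrightarrow> 0) F"
      using tendsto_mult[OF limf limg] by simp
  qed
  then have "((\<lambda>n. LINT t|M. f n t \<bullet> g n t) \<longlongrightarrow> (LINT t|M. f' t \<bullet> g' t) + (LINT t|M. g' t \<bullet> f' t) - (LINT t|M. g' t \<bullet> f' t) + 0) F"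
    unfolding eq by (intro tendsto_add tendsto_diff tendsto_const L2_inner_tendsto f g limf limg)
  then show ?thesis by simp
qed

text \<open>A shorter interval as a restriction of the longer one: measurability, a.e. statements
  and norms pass to initial intervals in this way.\<close>

lemma time_restrict: "t \<le> T \<Longrightarrow> time t = restrict_space (time T) {0<..<t}"
proof -
  assume "t \<le> T"
  then have "{0<..<T} \<inter> {0<..<t} = {0<..<t}" by auto
  moreover have "restrict_space (time T) {0<..<t} = restrict_space lebesgue ({0<..<T} \<inter> {0<..<t})"
    by (rule restrict_restrict_space) simp_all
  ultimately show ?thesis by (simp only:)
qed

lemma sets_time_initial [simp]: "{0<..<t} \<inter> space (time T) \<in> sets (time T)"
proof -
  have "space (time T) = {0<..<T}" by (simp add: space_restrict_space)
  then have eq: "{0<..<t} \<inter> space (time T) = {0<..<T} \<inter> {0<..<t}" by (simp only: Int_commute)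
  show ?thesis unfolding eq sets_restrict_space by (rule imageI) simp
qed

lemma AE_time_mono:
  assumes "t \<le> T" "AE s in time T. P s"
  shows "AE s in time t. P s"
proof -
  from assms(2) have "AE s in time T. s \<in> {0<..<t} \<longrightarrow> P s" by eventually_elim simp
  then show ?thesis
    unfolding time_restrict[OF assms(1)] by (simp add: AE_restrict_space_iff[OF sets_time_initial])
qed

lemma L2_time_mono:
  fixes f :: "real \<Rightarrow> 'b::{real_inner, banach, second_countable_topology}"
  assumes "t \<le> T" "f \<in> L2 (time T)"
  shows "f \<in> L2 (time t)" "L2_norm (time t) f \<le> L2_norm (time T) f"
proof -
  have m: "f \<in> borel_measurable (time t)"
    unfolding time_restrict[OF assms(1)] using L2_measurable[OF assms(2)] by (rule measurable_restrict_space1)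
  have i: "integrable (time T) (\<lambda>s. indicator {0<..<t} s *\<^sub>R (norm (f s))\<^sup>2)"
    using integrable_mult_indicator[OF sets_time_initial[of t T] L2_integrable[OF assms(2)]]
    by (rule Bochner_Integration.integrable_cong[THEN iffD1, OF refl, rotated]) (auto simp: indicator_def)
  show "f \<in> L2 (time t)"
  proof -
    have "integrable (restrict_space (time T) {0<..<t}) (\<lambda>s. (norm (f s))\<^sup>2)"
      using i by (rule integrable_restrict_space[OF sets_time_initial, THEN iffD2])
    with m show ?thesis unfolding L2_def time_restrict[OF assms(1)] by blast
  qed
  have "(LINT s|time t. (norm (f s))\<^sup>2) \<le> (LINT s|time T. (norm (f s))\<^sup>2)"
    unfolding time_restrict[OF assms(1)]
    by (subst integral_restrict_space[OF sets_time_initial], rule integral_mono[OF i L2_integrable[OF assms(2)]])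
       (auto simp: indicator_def)
  then show "L2_norm (time t) f \<le> L2_norm (time T) f" by (simp add: L2_norm_def)
qed

text \<open>In \<open>weak_path T \<iota> y z k\<close>, \<open>z\<close> is the representative of \<open>y\<close> in \<open>C([0,T];H)\<close> and \<open>k\<close> the Riesz
  representative in V of the derivative of \<open>y\<close> in V'.\<close>

definition weak_path :: "real \<Rightarrow> ('v::{real_inner, banach, second_countable_topology} \<Rightarrow>\<^sub>L
    'h::{real_inner, banach, second_countable_topology}) \<Rightarrow> (real \<Rightarrow> 'v) \<Rightarrow> (real \<Rightarrow> 'h) \<Rightarrow> (real \<Rightarrow> 'v) \<Rightarrow> bool" where
  "weak_path T \<iota> y z k \<longleftrightarrow> y \<in> L2 (time T) \<and> k \<in> L2 (time T) \<and> continuous_on {0..T} z \<and>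
     (AE t in time T. \<iota> (y t) = z t) \<and>
     (\<forall>t\<in>{0..T}. \<forall>v. z t \<bullet> \<iota> v = z 0 \<bullet> \<iota> v + (LINT s|time t. k s \<bullet> v))"

context
  fixes \<iota> :: "'v::{real_inner, banach, second_countable_topology} \<Rightarrow>\<^sub>L
    'h::{real_inner, banach, second_countable_topology}"
begin

lemma weak_pathD:
  assumes "weak_path T \<iota> y z k"
  shows "y \<in> L2 (time T)" "k \<in> L2 (time T)" "continuous_on {0..T} z" "AE t in time T. \<iota> (y t) = z t"
    and "t \<in> {0..T} \<Longrightarrow> z t \<bullet> \<iota> v = z 0 \<bullet> \<iota> v + (LINT s|time t. k s \<bullet> v)"
  using assms unfolding weak_path_def by blast+

lemma weak_pathI:
  assumes "y \<in> L2 (time T)" "k \<in> L2 (time T)" "continuous_on {0..T} z" "AE t in time T. \<iota> (y t) = z t"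
    and "\<And>t v. t \<in> {0..T} \<Longrightarrow> z t \<bullet> \<iota> v = z 0 \<bullet> \<iota> v + (LINT s|time t. k s \<bullet> v)"
  shows "weak_path T \<iota> y z k"
  using assms unfolding weak_path_def by blast

lemma L2_inner_const_integrable:
  fixes f :: "real \<Rightarrow> 'b::{real_inner, banach, second_countable_topology}"
  assumes "f \<in> L2 (time t)"
  shows "integrable (time t) (\<lambda>s. f s \<bullet> v)"
  using L2_imp_integrable[OF finite_measure_time assms] by simp

lemma weak_path_add:
  assumes "weak_path T \<iota> y z k" "weak_path T \<iota> y' z' k'"
  shows "weak_path T \<iota> (\<lambda>t. y t + y' t) (\<lambda>t. z t + z' t) (\<lambda>t. k t + k' t)"
  unfolding weak_path_def
proof (intro conjI ballI allI)
  show "AE t in time T. \<iota> (y t + y' t) = z t + z' t"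
  proof -
    have "AE t in time T. \<iota> (y t) = z t" "AE t in time T. \<iota> (y' t) = z' t"
      using assms unfolding weak_path_def by blast+
    then show ?thesis by eventually_elim (simp add: blinfun.add_right)
  qed
  fix t v assume t: "t \<in> {0..T}"
  then have "k \<in> L2 (time t)" "k' \<in> L2 (time t)"
    using assms L2_time_mono(1)[of t T] unfolding weak_path_def by auto
  then have "(LINT s|time t. (k s + k' s) \<bullet> v) = (LINT s|time t. k s \<bullet> v) + (LINT s|time t. k' s \<bullet> v)"
    by (simp add: inner_add_left L2_inner_const_integrable)
  moreover have "z t \<bullet> \<iota> v = z 0 \<bullet> \<iota> v + (LINT s|time t. k s \<bullet> v)" "z' t \<bullet> \<iota> v = z' 0 \<bullet> \<iota> v + (LINT s|time t. k' s \<bullet> v)"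
    using assms t unfolding weak_path_def by blast+
  ultimately show "(z t + z' t) \<bullet> \<iota> v = (z 0 + z' 0) \<bullet> \<iota> v + (LINT s|time t. (k s + k' s) \<bullet> v)"
    by (simp add: inner_add_left)
qed (intro L2_add continuous_intros weak_pathD(1-3)[OF assms(1)] weak_pathD(1-3)[OF assms(2)])+

lemma weak_path_scaleR:
  assumes "weak_path T \<iota> y z k"
  shows "weak_path T \<iota> (\<lambda>t. c *\<^sub>R y t) (\<lambda>t. c *\<^sub>R z t) (\<lambda>t. c *\<^sub>R k t)"
  unfolding weak_path_def
proof (intro conjI ballI allI)
  show "AE t in time T. \<iota> (c *\<^sub>R y t) = c *\<^sub>R z t"
  proof -
    have "AE t in time T. \<iota> (y t) = z t" using assms unfolding weak_path_def by blast
    then show ?thesis by eventually_elim (simp add: blinfun.scaleR_right)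
  qed
  fix t v assume t: "t \<in> {0..T}"
  have "z t \<bullet> \<iota> v = z 0 \<bullet> \<iota> v + (LINT s|time t. k s \<bullet> v)"
    using assms t unfolding weak_path_def by blast+
  then show "(c *\<^sub>R z t) \<bullet> \<iota> v = (c *\<^sub>R z 0) \<bullet> \<iota> v + (LINT s|time t. (c *\<^sub>R k s) \<bullet> v)"
    by (simp add: algebra_simps)
qed (intro L2_scaleR continuous_intros weak_pathD(1-3)[OF assms])+

lemma weak_path_diff:
  assumes "weak_path T \<iota> y z k" "weak_path T \<iota> y' z' k'"
  shows "weak_path T \<iota> (\<lambda>t. y t - y' t) (\<lambda>t. z t - z' t) (\<lambda>t. k t - k' t)"
  using weak_path_add[OF assms(1) weak_path_scaleR[OF assms(2), of "- 1"]] by simp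

lemma weak_path_restrict:
  assumes "weak_path T \<iota> y z k" "t \<le> T"
  shows "weak_path t \<iota> y z k"
proof (rule weak_pathI)
  show "continuous_on {0..t} z"
    by (rule continuous_on_subset[OF weak_pathD(3)[OF assms(1)]]) (use assms(2) in auto)
  show "z s \<bullet> \<iota> v = z 0 \<bullet> \<iota> v + (LINT r|time s. k r \<bullet> v)" if "s \<in> {0..t}" for s v
    by (rule weak_pathD(5)[OF assms(1)]) (use that assms(2) in auto)
qed (intro L2_time_mono(1)[OF assms(2)] AE_time_mono[OF assms(2)] weak_pathD[OF assms(1)])+

section \<open>Integration by parts and the energy estimate\<close>

text \<open>Square integrability implies integrability on a finite measure; since \<open>K\<close>
  vanishes off (0,T), the detour through \<open>time T\<close> loses nothing.\<close>

lemma integrable_lborel_of_L2_time: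
  fixes K :: "real \<Rightarrow> 'b::{real_inner, banach, second_countable_topology}"
  assumes K: "K \<in> L2 lborel" "\<And>t. t \<notin> {0<..<T} \<Longrightarrow> K t = 0"
  shows "integrable lborel K"
proof -
  have "integrable (time T) K" by (rule L2_imp_integrable[OF finite_measure_time L2_time_borel[OF K(1)]])
  then have "integrable lborel (\<lambda>t. indicator {0<..<T} t *\<^sub>R K t)"
    using integral_time_borel(2) L2_measurable[OF K(1)] by auto
  also have "(\<lambda>t. indicator {0<..<T} t *\<^sub>R K t) = K" using K(2) by (auto simp: indicator_def)
  finally show ?thesis .
qed

text \<open>The forward average at \<open>t\<close> looks at the interval from \<open>t\<close> to
  \<open>t + h\<close>, so it represents a difference quotient on [0,T] only up to
  \<open>T - h\<close>; the indicator keeps exactly these times. The strip that is cut off shrinks,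
  so it disappears in the limit by dominated convergence.\<close>

lemma steklov_cut_tendsto:
  fixes K :: "real \<Rightarrow> 'b::{real_inner, banach, second_countable_topology}"
  assumes K: "K \<in> L2 lborel" "\<And>t. t \<notin> {0<..<T} \<Longrightarrow> K t = 0"
    and h: "h \<longlonglongrightarrow> 0" "\<And>n. h n > 0"
  shows "(\<lambda>t. indicator {0..T - h n} t *\<^sub>R steklov (h n) K t) \<in> L2 lborel"
    and "(\<lambda>n. L2_norm lborel (\<lambda>t. indicator {0..T - h n} t *\<^sub>R steklov (h n) K t - K t)) \<longlonglongrightarrow> 0"
proof -
  have cut: "(\<lambda>t. indicator {0..T - h n} t *\<^sub>R f t) \<in> L2 lborel" "L2_norm lborel (\<lambda>t. indicator {0..T - h n} t *\<^sub>R f t) \<le> L2_norm lborel f"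
    if "f \<in> L2 lborel" for f :: "real \<Rightarrow> 'b" and n
  proof -
    have m: "(\<lambda>t. indicator {0..T - h n} t *\<^sub>R f t) \<in> borel_measurable lborel"
      using L2_measurable[OF that] by simp
    show "(\<lambda>t. indicator {0..T - h n} t *\<^sub>R f t) \<in> L2 lborel"
      by (rule L2_bounded[OF that m, where K = 1]) (auto simp: indicator_def)
    show "L2_norm lborel (\<lambda>t. indicator {0..T - h n} t *\<^sub>R f t) \<le> L2_norm lborel f"
      using L2_norm_bounded[OF that m, where K = 1] by (auto simp: indicator_def)
  qed
  have st: "steklov (h n) K \<in> L2 lborel" for n using h(2)[of n] by (intro steklov_in_L2[OF K(1)]) simp
  show "(\<lambda>t. indicator {0..T - h n} t *\<^sub>R steklov (h n) K t) \<in> L2 lborel" for n by (rule cut(1)[OF st])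
  have "filterlim h (at 0) sequentially" using h(1) h(2) by (auto simp: filterlim_at less_imp_neq[symmetric])
  moreover have "translation_continuous K"
    by (rule translation_continuous_bounded_support[OF K(1), of "{0<..<T}"]) (use K(2) in auto)
  ultimately have lim1: "(\<lambda>n. L2_norm lborel (\<lambda>t. steklov (h n) K t - K t)) \<longlonglongrightarrow> 0"
    by (rule filterlim_compose[OF steklov_tendsto[OF K(1)], rotated])
  have "(\<lambda>n. LINT t|lborel. (norm (indicator {0..T - h n} t *\<^sub>R K t - K t))\<^sup>2) \<longlonglongrightarrow> (LINT t|(lborel :: real measure). 0 :: real)"
  proof (rule integral_dominated_convergence[where w = "\<lambda>t. (norm (K t))\<^sup>2"])
    show "AE t in lborel. (\<lambda>n. (norm (indicator {0..T - h n} t *\<^sub>R K t - K t))\<^sup>2) \<longlonglongrightarrow> 0"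
    proof (rule AE_I2)
      fix t
      show "(\<lambda>n. (norm (indicator {0..T - h n} t *\<^sub>R K t - K t))\<^sup>2) \<longlonglongrightarrow> 0"
      proof (cases "t \<in> {0<..<T}")
        case True
        then have "\<forall>\<^sub>F n in sequentially. h n < T - t" using h(1) by (intro order_tendstoD) auto
        then have "\<forall>\<^sub>F n in sequentially. (norm (indicator {0..T - h n} t *\<^sub>R K t - K t))\<^sup>2 = 0"
          by eventually_elim (use True in \<open>simp add: indicator_def\<close>)
        then show ?thesis by (rule tendsto_eventually)
      qed (simp add: K(2))
    qed
  qed (use L2_measurable[OF K(1)] L2_integrable[OF K(1)] in \<open>auto simp: indicator_def\<close>)
  then have lim2: "(\<lambda>n. L2_norm lborel (\<lambda>t. indicator {0..T - h n} t *\<^sub>R K t - K t)) \<longlonglongrightarrow> 0"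
    unfolding L2_norm_def using tendsto_real_sqrt by fastforce
  show "(\<lambda>n. L2_norm lborel (\<lambda>t. indicator {0..T - h n} t *\<^sub>R steklov (h n) K t - K t)) \<longlonglongrightarrow> 0"
  proof (rule Lim_null_comparison)
    show "(\<lambda>n. L2_norm lborel (\<lambda>t. steklov (h n) K t - K t) + L2_norm lborel (\<lambda>t. indicator {0..T - h n} t *\<^sub>R K t - K t)) \<longlonglongrightarrow> 0"
      using tendsto_add[OF lim1 lim2] by simp
    show "\<forall>\<^sub>F n in sequentially. norm (L2_norm lborel (\<lambda>t. indicator {0..T - h n} t *\<^sub>R steklov (h n) K t - K t))
        \<le> L2_norm lborel (\<lambda>t. steklov (h n) K t - K t) + L2_norm lborel (\<lambda>t. indicator {0..T - h n} t *\<^sub>R K t - K t)"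
    proof (intro always_eventually allI)
      fix n
      have "(\<lambda>t. indicator {0..T - h n} t *\<^sub>R steklov (h n) K t - K t)
          = (\<lambda>t. indicator {0..T - h n} t *\<^sub>R (steklov (h n) K t - K t) + (indicator {0..T - h n} t *\<^sub>R K t - K t))"
        by (auto simp: algebra_simps)
      then show "norm (L2_norm lborel (\<lambda>t. indicator {0..T - h n} t *\<^sub>R steklov (h n) K t - K t))
        \<le> L2_norm lborel (\<lambda>t. steklov (h n) K t - K t) + L2_norm lborel (\<lambda>t. indicator {0..T - h n} t *\<^sub>R K t - K t)"
        using L2_norm_triangle[OF cut(1)[OF L2_diff[OF st K(1)]] L2_diff[OF cut(1)[OF K(1)] K(1)], of n n n]
          cut(2)[OF L2_diff[OF st K(1)], of n n]
        by simp
    qed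
  qed
qed

text \<open>Point and width move together: integration by parts takes averages of width
  \<open>h n\<close> at 0 and at \<open>T - h n\<close>. On the unit interval of the averaging
  variable this is dominated convergence.\<close>

lemma steklov_continuous_tendsto:
  fixes Z :: "real \<Rightarrow> real"
  assumes Z: "continuous_on UNIV Z" "\<And>t. \<bar>Z t\<bar> \<le> c" and a: "a \<longlonglongrightarrow> b" and h: "h \<longlonglongrightarrow> 0"
  shows "(\<lambda>n. steklov (h n) Z (a n)) \<longlonglongrightarrow> Z b"
proof -
  have [measurable]: "Z \<in> borel_measurable borel" by (rule borel_measurable_continuous_onI[OF Z(1)])
  have "(\<lambda>n. LINT s|lborel. indicator {0..1} s *\<^sub>R Z (a n + h n * s)) \<longlonglongrightarrow> (LINT s|lborel. indicator {0..1::real} s *\<^sub>R Z b)"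
  proof (rule integral_dominated_convergence[where w = "\<lambda>s. indicator {0..1} s * c"])
    show "AE s in lborel. (\<lambda>n. indicator {0..1} s *\<^sub>R Z (a n + h n * s)) \<longlonglongrightarrow> indicator {0..1} s *\<^sub>R Z b"
    proof (rule AE_I2)
      fix s
      have "(\<lambda>n. a n + h n * s) \<longlonglongrightarrow> b + 0 * s" by (intro tendsto_intros a h)
      then have "(\<lambda>n. Z (a n + h n * s)) \<longlonglongrightarrow> Z b"
        using Z(1) by (intro isCont_tendsto_compose[of b Z]) (auto simp: continuous_on_eq_continuous_at)
      then show "(\<lambda>n. indicator {0..1} s *\<^sub>R Z (a n + h n * s)) \<longlonglongrightarrow> indicator {0..1} s *\<^sub>R Z b"
        by (intro tendsto_intros)
    qed
    show "integrable lborel (\<lambda>s::real. indicator {0..1} s * c)"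
      by (intro integrable_mult_left integrable_real_indicator) auto
  qed (use Z(2) in \<open>auto simp: indicator_def\<close>)
  then show ?thesis by (simp add: steklov_def)
qed

lemma AE_lborel_shift:
  assumes "AE t in lborel. P t"
  shows "AE t in lborel. P (t + h :: real)"
proof -
  obtain N where N: "N \<in> null_sets lborel" "{t \<in> space lborel. \<not> P t} \<subseteq> N"
    using assms by (auto simp: eventually_ae_filter)
  have "AE t in lborel. h + 1 * t \<notin> N"
    using N(1) AE_not_in[OF N(1)] by (intro AE_borel_affine) (auto simp: pred_def)
  then show ?thesis by eventually_elim (use N(2) in \<open>auto simp: add.commute\<close>)
qed

text \<open>The weak formulation at \<open>t + h\<close> minus that at \<open>t\<close>. Increments
  of \<open>z\<close> are known only against vectors \<open>\<iota> v\<close>, which dictates the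
  form of the product rule in the integration by parts.\<close>

lemma weak_path_increment:
  assumes w: "weak_path T \<iota> y z k"
    and K: "K \<in> L2 lborel" "\<And>t. t \<notin> {0<..<T} \<Longrightarrow> K t = 0" "AE t in time T. k t = K t"
    and t: "0 \<le> t" "0 < h" "t + h \<le> T"
  shows "(z (t + h) - z t) \<bullet> \<iota> v = h * (steklov h K t \<bullet> v)"
proof -
  have Km [measurable]: "K \<in> borel_measurable borel" using L2_measurable[OF K(1)] by simp
  have Ki: "integrable lborel K" by (rule integrable_lborel_of_L2_time[OF K(1,2)])
  have z: "z s \<bullet> \<iota> v = z 0 \<bullet> \<iota> v + (LINT r|lborel. indicator {0<..<s} r *\<^sub>R (K r \<bullet> v))" if s: "s \<in> {0..T}" for s
  proof -
    have kL: "k \<in> L2 (time s)" using s by (intro L2_time_mono(1)[OF _ weak_pathD(2)[OF w]]) simp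
    have "(LINT r|time s. k r \<bullet> v) = (LINT r|time s. K r \<bullet> v)"
    proof (rule integral_cong_AE)
      show "(\<lambda>r. k r \<bullet> v) \<in> borel_measurable (time s)" using L2_measurable[OF kL] by measurable
      show "(\<lambda>r. K r \<bullet> v) \<in> borel_measurable (time s)" by (rule borel_measurable_time_borel) measurable
      show "AE r in time s. k r \<bullet> v = K r \<bullet> v"
      proof -
        have "AE r in time s. k r = K r" using s by (intro AE_time_mono[OF _ K(3)]) simp
        then show ?thesis by eventually_elim simp
      qed
    qed
    also have "\<dots> = (LINT r|lborel. indicator {0<..<s} r *\<^sub>R (K r \<bullet> v))" by (rule integral_time_borel) measurable
    finally show ?thesis using weak_pathD(5)[OF w s, of v] by simp
  qed
  have ii: "integrable lborel (\<lambda>r. indicator {a..b} r *\<^sub>R K r)" for a b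
    by (rule integrable_mult_indicator[OF _ Ki]) simp
  have i: "integrable lborel (\<lambda>r. indicator {0<..<s} r *\<^sub>R (K r \<bullet> v))" for s
    by (rule integrable_mult_indicator) (use Ki in auto)
  have "(z (t + h) - z t) \<bullet> \<iota> v = (LINT r|lborel. indicator {0<..<t + h} r *\<^sub>R (K r \<bullet> v)) - (LINT r|lborel. indicator {0<..<t} r *\<^sub>R (K r \<bullet> v))"
    using z[of t] z[of "t + h"] t by (simp add: inner_diff_left)
  also have "\<dots> = (LINT r|lborel. indicator {0<..<t + h} r *\<^sub>R (K r \<bullet> v) - indicator {0<..<t} r *\<^sub>R (K r \<bullet> v))"
    using i by simp
  \<comment> \<open>The integrands may differ only at \<open>r = t + h\<close>; for
    \<open>t = 0\<close> the left endpoint is covered by \<open>K 0 = 0\<close>.\<close>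
  also have "\<dots> = (LINT r|lborel. (indicator {t..t + h} r *\<^sub>R K r) \<bullet> v)"
  proof (rule integral_cong_AE)
    show "AE r in lborel. indicator {0<..<t + h} r *\<^sub>R (K r \<bullet> v) - indicator {0<..<t} r *\<^sub>R (K r \<bullet> v) = (indicator {t..t + h} r *\<^sub>R K r) \<bullet> v"
      using AE_lborel_singleton[of "t + h"] by eventually_elim (use t K(2) in \<open>auto simp: indicator_def\<close>)
  qed simp_all
  also have "\<dots> = (LINT r|lborel. indicator {t..t + h} r *\<^sub>R K r) \<bullet> v"
    by (rule integral_inner_left[OF ii])
  finally show ?thesis using steklov_forward[OF t(2), of K t, symmetric] by simp
qed

text \<open>The integral of the difference quotient of \<open>z1 \<bullet> z2\<close> over
  [0, T - h] is computed twice. It telescopes to averages near the two endpoints, which converge by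
  continuity; and by the product rule it pairs Steklov averages of the derivatives with the paths,
  which converges by L^2 continuity.\<close>

theorem weak_path_integration_by_parts:
  assumes w1: "weak_path T \<iota> y1 z1 k1" and w2: "weak_path T \<iota> y2 z2 k2" and T: "T > 0"
  shows "z1 T \<bullet> z2 T - z1 0 \<bullet> z2 0 = (LINT t|time T. k1 t \<bullet> y2 t) + (LINT t|time T. k2 t \<bullet> y1 t)"
proof -
  have mem: "y1 \<in> L2 (time T)" "k1 \<in> L2 (time T)" "y2 \<in> L2 (time T)" "k2 \<in> L2 (time T)"
    and cont: "continuous_on {0..T} z1" "continuous_on {0..T} z2"
    and ae: "AE t in time T. \<iota> (y1 t) = z1 t" "AE t in time T. \<iota> (y2 t) = z2 t"
    using weak_pathD[OF w1] weak_pathD[OF w2] by blast+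
  obtain Y1 where Y1: "Y1 \<in> L2 lborel" "\<And>t. t \<notin> {0<..<T} \<Longrightarrow> Y1 t = 0" "AE t in time T. y1 t = Y1 t"
    by (rule L2_time_borel_representative[OF mem(1)]) blast
  obtain K1 where K1: "K1 \<in> L2 lborel" "\<And>t. t \<notin> {0<..<T} \<Longrightarrow> K1 t = 0" "AE t in time T. k1 t = K1 t"
    by (rule L2_time_borel_representative[OF mem(2)]) blast
  obtain Y2 where Y2: "Y2 \<in> L2 lborel" "\<And>t. t \<notin> {0<..<T} \<Longrightarrow> Y2 t = 0" "AE t in time T. y2 t = Y2 t"
    by (rule L2_time_borel_representative[OF mem(3)]) blast
  obtain K2 where K2: "K2 \<in> L2 lborel" "\<And>t. t \<notin> {0<..<T} \<Longrightarrow> K2 t = 0" "AE t in time T. k2 t = K2 t"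
    by (rule L2_time_borel_representative[OF mem(4)]) blast
  \<comment> \<open>The shift by 2 makes \<open>h n < T\<close> true already for
    \<open>n = 0\<close>.\<close>
  define h where "h = (\<lambda>n. T / real (n + 2))"
  have h: "h n > 0" "h n < T" for n using T by (auto simp: h_def divide_less_eq add_pos_nonneg)
  have h_lim: "h \<longlonglongrightarrow> 0"
    unfolding h_def by (rule LIMSEQ_ignore_initial_segment[OF lim_const_over_n])
  \<comment> \<open>Clamping the time extends the product to a bounded continuous function on the
    line.\<close>
  define Z where "Z = (\<lambda>t. z1 (max 0 (min T t)) \<bullet> z2 (max 0 (min T t)))"
  have Z_eq: "Z t = z1 t \<bullet> z2 t" if "t \<in> {0..T}" for t using that by (simp add: Z_def)
  have clamp: "continuous_on UNIV (\<lambda>t. max 0 (min T t))" by (intro continuous_intros)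
  have Zc: "continuous_on UNIV Z"
    unfolding Z_def
    by (intro continuous_on_inner continuous_on_compose2[OF cont(1) clamp] continuous_on_compose2[OF cont(2) clamp])
       (use T in auto)
  have [measurable]: "Z \<in> borel_measurable borel" by (rule borel_measurable_continuous_onI[OF Zc])
  have "bounded ((\<lambda>t. z1 t \<bullet> z2 t) ` {0..T})"
    by (intro compact_imp_bounded compact_continuous_image continuous_intros cont) auto
  then obtain c where "\<And>t. t \<in> {0..T} \<Longrightarrow> \<bar>z1 t \<bullet> z2 t\<bar> \<le> c" unfolding bounded_iff by force
  then have Zb: "\<bar>Z t\<bar> \<le> c" for t unfolding Z_def using T by auto
  have ind_int: "integrable lborel (\<lambda>t. indicator {a..b} t *\<^sub>R Z t)" for a b
  proof (rule Bochner_Integration.integrable_bound)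
    show "integrable lborel (\<lambda>t. indicator {a..b} t * c)"
      by (intro integrable_mult_left integrable_real_indicator) (auto simp: emeasure_lborel_Icc_eq)
    show "AE t in lborel. norm (indicator {a..b} t *\<^sub>R Z t) \<le> norm (indicator {a..b} t * c)"
      using Zb by (auto simp: indicator_def intro: order_trans[OF _ abs_ge_self])
  qed measurable
  define I where "I = (\<lambda>n. LINT t|lborel. indicator {0..T - h n} t *\<^sub>R ((Z (t + h n) - Z t) / h n))"
  \<comment> \<open>Telescoping: after a shift of variables the contributions common to [h, T] and
    [0, T - h] cancel.\<close>
  have I1: "I n = steklov (h n) Z (T - h n) - steklov (h n) Z 0" for n
  proof -
    have shift_int: "integrable lborel (\<lambda>t. indicator {0..T - h n} t *\<^sub>R Z (t + h n))"
      and shift_eq: "(LINT t|lborel. indicator {0..T - h n} t *\<^sub>R Z (t + h n)) = (LINT t|lborel. indicator {h n..T} t *\<^sub>R Z t)"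
    proof -
      have eq: "(\<lambda>t. indicator {h n..T} (h n + 1 * t) *\<^sub>R Z (h n + 1 * t)) = (\<lambda>t. indicator {0..T - h n} t *\<^sub>R Z (t + h n))"
        by (rule ext) (auto simp: indicator_def add.commute)
      show "integrable lborel (\<lambda>t. indicator {0..T - h n} t *\<^sub>R Z (t + h n))"
        using lborel_integrable_real_affine[OF ind_int[of "h n" T], of 1 "h n"] unfolding eq by simp
      show "(LINT t|lborel. indicator {0..T - h n} t *\<^sub>R Z (t + h n)) = (LINT t|lborel. indicator {h n..T} t *\<^sub>R Z t)"
        using lborel_integral_real_affine[of 1 "\<lambda>t. indicator {h n..T} t *\<^sub>R Z t" "h n"] unfolding eq by simp
    qed
    have "h n * I n = (LINT t|lborel. h n * (indicator {0..T - h n} t *\<^sub>R ((Z (t + h n) - Z t) / h n)))"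
      by (simp add: I_def)
    also have "\<dots> = (LINT t|lborel. indicator {0..T - h n} t *\<^sub>R Z (t + h n) - indicator {0..T - h n} t *\<^sub>R Z t)"
      using h(1)[of n] by (intro Bochner_Integration.integral_cong) (auto simp: indicator_def)
    also have "\<dots> = (LINT t|lborel. indicator {h n..T} t *\<^sub>R Z t) - (LINT t|lborel. indicator {0..T - h n} t *\<^sub>R Z t)"
      using shift_int ind_int shift_eq by simp
    also have "\<dots> = (LINT t|lborel. indicator {T - h n..T} t *\<^sub>R Z t) - (LINT t|lborel. indicator {0..h n} t *\<^sub>R Z t)"
    proof -
      have "(LINT t|lborel. indicator {h n..T} t *\<^sub>R Z t) + (LINT t|lborel. indicator {0..h n} t *\<^sub>R Z t)
          = (LINT t|lborel. indicator {h n..T} t *\<^sub>R Z t + indicator {0..h n} t *\<^sub>R Z t)"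
        using ind_int by simp
      also have "\<dots> = (LINT t|lborel. indicator {0..T - h n} t *\<^sub>R Z t + indicator {T - h n..T} t *\<^sub>R Z t)"
      proof (rule integral_cong_AE)
        show "AE t in lborel. indicator {h n..T} t *\<^sub>R Z t + indicator {0..h n} t *\<^sub>R Z t
            = indicator {0..T - h n} t *\<^sub>R Z t + indicator {T - h n..T} t *\<^sub>R Z t"
          using AE_lborel_singleton[of "h n"] AE_lborel_singleton[of "T - h n"]
          by eventually_elim (use h[of n] in \<open>auto simp: indicator_def\<close>)
      qed simp_all
      also have "\<dots> = (LINT t|lborel. indicator {0..T - h n} t *\<^sub>R Z t) + (LINT t|lborel. indicator {T - h n..T} t *\<^sub>R Z t)"
        using ind_int by simp
      finally show ?thesis by simp
    qed
    also have "\<dots> = h n * steklov (h n) Z (T - h n) - h n * steklov (h n) Z 0"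
      using steklov_forward[OF h(1), of n Z "T - h n"] steklov_forward[OF h(1), of n Z 0] by simp
    finally have "h n * I n = h n * (steklov (h n) Z (T - h n) - steklov (h n) Z 0)" by (simp add: right_diff_distrib)
    then show ?thesis using h(1)[of n] by simp
  qed
  have "(\<lambda>n. T - h n) \<longlonglongrightarrow> T - 0" by (intro tendsto_intros h_lim)
  then have "(\<lambda>n. steklov (h n) Z (T - h n)) \<longlonglongrightarrow> Z T"
    by (intro steklov_continuous_tendsto[OF Zc Zb _ h_lim]) simp
  then have "I \<longlonglongrightarrow> Z T - Z 0"
    unfolding I1[abs_def] by (rule tendsto_diff) (rule steklov_continuous_tendsto[OF Zc Zb tendsto_const h_lim])
  then have lim1: "I \<longlonglongrightarrow> z1 T \<bullet> z2 T - z1 0 \<bullet> z2 0" using T by (simp add: Z_eq)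
  \<comment> \<open>On \<open>lborel\<close> the a.e. identity can be shifted together with
    \<open>Y2\<close>.\<close>
  have ae_lborel: "AE t in lborel. t \<in> {0<..<T} \<longrightarrow> \<iota> (Y t) = z t"
    if "AE t in time T. \<iota> (y t) = z t" "AE t in time T. y t = Y t"
      "continuous_on {0..T} z" "Y \<in> borel_measurable borel" for y Y z
  proof -
    have "AE t in time T. \<iota> (Y t) = z t" using that(1,2) by eventually_elim simp
    then have "AE t in lebesgue. t \<in> {0<..<T} \<longrightarrow> \<iota> (Y t) = z t"
      by (subst (asm) AE_restrict_space_iff) auto
    then show ?thesis by (rule AE_completion_iff[THEN iffD1, rotated])
  qed
  define a where "a = (\<lambda>n t. indicator {0..T - h n} t *\<^sub>R steklov (h n) K1 t)"
  define b where "b = (\<lambda>n t. indicator {0..T - h n} t *\<^sub>R steklov (h n) K2 t)"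
  have aL: "a n \<in> L2 lborel" and bL: "b n \<in> L2 lborel" for n
    unfolding a_def b_def by (rule steklov_cut_tendsto(1)[OF K1(1,2) h_lim h(1)] steklov_cut_tendsto(1)[OF K2(1,2) h_lim h(1)]; assumption)+
  have alim: "(\<lambda>n. L2_norm lborel (\<lambda>t. a n t - K1 t)) \<longlonglongrightarrow> 0"
    unfolding a_def by (rule steklov_cut_tendsto(2)[OF K1(1,2) h_lim h(1)])
  have blim: "(\<lambda>n. L2_norm lborel (\<lambda>t. b n t - K2 t)) \<longlonglongrightarrow> 0"
    unfolding b_def by (rule steklov_cut_tendsto(2)[OF K2(1,2) h_lim h(1)])
  have I2: "I n = (LINT t|lborel. a n t \<bullet> Y2 (t + h n)) + (LINT t|lborel. b n t \<bullet> Y1 t)" for n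
  proof -
    have "I n = (LINT t|lborel. a n t \<bullet> Y2 (t + h n) + b n t \<bullet> Y1 t)"
      unfolding I_def
    proof (rule integral_cong_AE)
      have "AE t in lborel. t \<in> {0<..<T} \<longrightarrow> \<iota> (Y1 t) = z1 t"
        by (rule ae_lborel[OF ae(1) Y1(3) cont(1)]) (use L2_measurable[OF Y1(1)] in simp)
      moreover have "AE t in lborel. t + h n \<in> {0<..<T} \<longrightarrow> \<iota> (Y2 (t + h n)) = z2 (t + h n)"
        by (rule AE_lborel_shift[OF ae_lborel[OF ae(2) Y2(3) cont(2)]]) (use L2_measurable[OF Y2(1)] in simp)
      ultimately show "AE t in lborel. indicator {0..T - h n} t *\<^sub>R ((Z (t + h n) - Z t) / h n) = a n t \<bullet> Y2 (t + h n) + b n t \<bullet> Y1 t"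
        using AE_lborel_singleton[of 0] AE_lborel_singleton[of "T - h n"]
      proof eventually_elim
        case (elim t)
        show ?case
        proof (cases "t \<in> {0..T - h n}")
          case True
          then have t: "0 < t" "t < T - h n" using elim by auto
          have e1: "\<iota> (Y1 t) = z1 t" and e2: "\<iota> (Y2 (t + h n)) = z2 (t + h n)"
            using elim t h[of n] by auto
          \<comment> \<open>The discrete product rule, with one factor frozen at
            \<open>t + h n\<close> and the other at \<open>t\<close>. Both frozen factors are images
            under \<open>\<iota>\<close>, as testing the increments requires.\<close>
          have "Z (t + h n) - Z t = (z1 (t + h n) - z1 t) \<bullet> z2 (t + h n) + (z2 (t + h n) - z2 t) \<bullet> z1 t"
            using t h[of n] by (simp add: Z_eq inner_diff_left inner_commute[of "z2 t" "z1 t"]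
                inner_commute[of "z2 (t + h n)" "z1 t"])
          also have "\<dots> = h n * (steklov (h n) K1 t \<bullet> Y2 (t + h n)) + h n * (steklov (h n) K2 t \<bullet> Y1 t)"
            using weak_path_increment[OF w1 K1 _ h(1), of t n "Y2 (t + h n)"]
              weak_path_increment[OF w2 K2 _ h(1), of t n "Y1 t"] t by (simp add: e1 e2)
          finally show ?thesis using True h(1)[of n] by (simp add: a_def b_def field_simps)
        qed (simp add: a_def b_def)
      qed
      show "(\<lambda>t. a n t \<bullet> Y2 (t + h n) + b n t \<bullet> Y1 t) \<in> borel_measurable lborel"
        using L2_inner_measurable[OF aL L2_lborel_shift(1)[OF Y2(1)]] L2_inner_measurable[OF bL Y1(1)]
        by (intro borel_measurable_add)
    qed measurable
    then show ?thesis
      using L2_inner_integrable[OF aL L2_lborel_shift(1)[OF Y2(1)]] L2_inner_integrable[OF bL Y1(1)] by simp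
  qed
  \<comment> \<open>The first pairing contains \<open>Y2\<close> at \<open>t + h n\<close>;
    continuity of translations removes this shift in the limit.\<close>
  have "translation_continuous Y2"
    by (rule translation_continuous_bounded_support[OF Y2(1), of "{0<..<T}"]) (use Y2(2) in auto)
  moreover have "filterlim h (at 0) sequentially" using h_lim h(1) by (auto simp: filterlim_at less_imp_neq[symmetric])
  ultimately have Y2lim: "(\<lambda>n. L2_norm lborel (\<lambda>t. Y2 (t + h n) - Y2 t)) \<longlonglongrightarrow> 0"
    unfolding translation_continuous_def by (rule filterlim_compose)
  have "I \<longlonglongrightarrow> (LINT t|lborel. K1 t \<bullet> Y2 t) + (LINT t|lborel. K2 t \<bullet> Y1 t)"
    unfolding I2[abs_def]
    by (intro tendsto_add L2_inner_tendsto2 L2_inner_tendsto aL bL K1(1) K2(1) Y1(1) Y2(1) L2_lborel_shift(1) alim blim Y2lim)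
  with lim1 have eq: "z1 T \<bullet> z2 T - z1 0 \<bullet> z2 0 = (LINT t|lborel. K1 t \<bullet> Y2 t) + (LINT t|lborel. K2 t \<bullet> Y1 t)"
    by (rule LIMSEQ_unique)
  have transfer: "(LINT t|lborel. K t \<bullet> Y t) = (LINT t|time T. k t \<bullet> y t)"
    if "AE t in time T. k t = K t" "AE t in time T. y t = Y t" "K \<in> L2 lborel" "Y \<in> L2 lborel"
      "k \<in> L2 (time T)" "y \<in> L2 (time T)" "\<And>t. t \<notin> {0<..<T} \<Longrightarrow> K t = 0"
    for k K y Y :: "real \<Rightarrow> 'v"
  proof -
    have m: "(\<lambda>t. K t \<bullet> Y t) \<in> borel_measurable borel" using L2_inner_measurable[OF that(3,4)] by simp
    have "(LINT t|time T. k t \<bullet> y t) = (LINT t|time T. K t \<bullet> Y t)"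
    proof (rule integral_cong_AE)
      show "AE t in time T. k t \<bullet> y t = K t \<bullet> Y t" using that(1,2) by eventually_elim simp
    qed (use L2_inner_measurable[OF that(5,6)] borel_measurable_time_borel[OF m] in auto)
    also have "\<dots> = (LINT t|lborel. indicator {0<..<T} t *\<^sub>R (K t \<bullet> Y t))" by (rule integral_time_borel(1)[OF m])
    also have "(\<lambda>t. indicator {0<..<T} t *\<^sub>R (K t \<bullet> Y t)) = (\<lambda>t. K t \<bullet> Y t)"
      by (rule ext) (use that(7) in \<open>force simp: indicator_def\<close>)
    finally show ?thesis ..
  qed
  show ?thesis
    using eq transfer[OF K1(3) Y2(3) K1(1) Y2(1) mem(2,3) K1(2)]
      transfer[OF K2(3) Y1(3) K2(1) Y1(1) mem(4,1) K2(2)] by linarith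
qed

text \<open>Test the equation with \<open>y\<close>: integration by parts of the path against itself
  turns twice the integral of \<open>k \<bullet> y\<close> into a difference of squared norms.
  Young's inequality with weight \<open>\<eta>\<close> spends half of the coercivity on
  \<open>F \<bullet> y\<close> and leaves the other half on the left.\<close>

lemma weak_path_energy:
  fixes M :: "real \<Rightarrow> 'v \<Rightarrow>\<^sub>L 'v"
  assumes w: "weak_path T \<iota> y z k" and M: "Linfty_op T M" and \<eta>: "\<eta> > 0"
    and coer: "\<And>t v. t \<in> {0<..<T} \<Longrightarrow> \<eta> * (norm v)\<^sup>2 \<le> M t v \<bullet> v"
    and F: "F \<in> L2 (time T)" and eq: "AE t in time T. k t + M t (y t) = F t"
    and t: "t \<in> {0..T}"
  shows "(norm (z t))\<^sup>2 + \<eta> * (L2_norm (time t) y)\<^sup>2 \<le> (norm (z 0))\<^sup>2 + (L2_norm (time T) F)\<^sup>2 / \<eta>"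
proof (cases "t = 0")
  \<comment> \<open>For \<open>t = 0\<close> the interval is empty, while integration by parts is
    stated for positive length.\<close>
  case True
  then show ?thesis using \<eta> by (simp add: L2_norm_square integral_restrict_space)
next
  case False
  then have t': "0 < t" "t \<le> T" using t by auto
  have wt: "weak_path t \<iota> y z k" using weak_path_restrict[OF w t'(2)] .
  then have y: "y \<in> L2 (time t)" and k: "k \<in> L2 (time t)" by (rule weak_pathD)+
  have Ft: "F \<in> L2 (time t)" "L2_norm (time t) F \<le> L2_norm (time T) F" using L2_time_mono[OF t'(2) F] by auto
  have le: "2 * (LINT s|time t. k s \<bullet> y s) \<le> (LINT s|time t. (norm (F s))\<^sup>2 / \<eta> - \<eta> * (norm (y s))\<^sup>2)"
  proof (subst integral_mult_right_zero[symmetric], rule integral_mono_AE)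
    show "AE s in time t. 2 * (k s \<bullet> y s) \<le> (norm (F s))\<^sup>2 / \<eta> - \<eta> * (norm (y s))\<^sup>2"
      using AE_time_mono[OF t'(2) eq] AE_space
    proof eventually_elim
      case (elim s)
      have "k s = F s - M s (y s)" using elim(1) by (simp add: algebra_simps)
      moreover have "\<eta> * (norm (y s))\<^sup>2 \<le> M s (y s) \<bullet> y s" using elim(2) t' by (intro coer) auto
      moreover have "2 * (F s \<bullet> y s) \<le> (norm (F s))\<^sup>2 / \<eta> + \<eta> * (norm (y s))\<^sup>2"
      proof -
        have "0 \<le> (norm (F s) - \<eta> * norm (y s))\<^sup>2 / \<eta>" using \<eta> by simp
        also have "\<dots> = (norm (F s))\<^sup>2 / \<eta> + \<eta> * (norm (y s))\<^sup>2 - 2 * (norm (F s) * norm (y s))"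
          using \<eta> by (simp add: field_simps power2_eq_square)
        finally show ?thesis using norm_cauchy_schwarz[of "F s" "y s"] by linarith
      qed
      ultimately show ?case by (simp add: inner_diff_left)
    qed
  qed (use L2_inner_integrable[OF k y] L2_integrable[OF Ft(1)] L2_integrable[OF y] in simp_all)
  also have "\<dots> = (L2_norm (time t) F)\<^sup>2 / \<eta> - \<eta> * (L2_norm (time t) y)\<^sup>2"
    using L2_integrable[OF Ft(1)] L2_integrable[OF y] by (simp add: L2_norm_square)
  also have "\<dots> \<le> (L2_norm (time T) F)\<^sup>2 / \<eta> - \<eta> * (L2_norm (time t) y)\<^sup>2"
    using \<eta> Ft(2) by (simp add: divide_right_mono power_mono)
  finally show ?thesis
    using weak_path_integration_by_parts[OF wt wt t'(1)] by (simp add: power2_norm_eq_inner)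
qed

end


subsection \<open>Existence for the parabolic problem\<close>

lemma L2_norm_time_le_lborel:
  fixes g :: "real \<Rightarrow> 'b::{real_inner, second_countable_topology}"
  assumes "g \<in> L2 lborel"
  shows "L2_norm (time T) g \<le> L2_norm lborel g"
proof -
  have m: "(\<lambda>t. (norm (g t))\<^sup>2) \<in> borel_measurable borel" using L2_measurable[OF assms] by simp
  have i: "integrable lborel (\<lambda>t. indicator {0<..<T} t *\<^sub>R (norm (g t))\<^sup>2)"
    using L2_integrable[OF L2_time_borel[OF assms]] integral_time_borel(2)[OF m] by blast
  have "(LINT t|time T. (norm (g t))\<^sup>2) \<le> (LINT t|lborel. (norm (g t))\<^sup>2)"
    unfolding integral_time_borel(1)[OF m]
    by (rule integral_mono[OF i L2_integrable[OF assms]]) (auto simp: indicator_def)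
  then show ?thesis by (simp add: L2_norm_def)
qed

lemma L2_time_continuous:
  fixes f :: "real \<Rightarrow> 'b::{real_inner, second_countable_topology}"
  assumes f: "continuous_on {0..T} f"
  shows "f \<in> L2 (time T)"
proof (cases "T > 0")
  case True
  interpret finite_measure "time T" by (rule finite_measure_time)
  \<comment> \<open>Clamped to [0,T], the function is continuous on the line and hence
    Borel.\<close>
  have "continuous_on UNIV (\<lambda>t. f (max 0 (min T t)))"
    by (rule continuous_on_compose2[OF f]) (use True in \<open>auto intro!: continuous_intros\<close>)
  then have "(\<lambda>t. f (max 0 (min T t))) \<in> borel_measurable (time T)"
    by (intro borel_measurable_time_borel borel_measurable_continuous_onI)
  then have m: "f \<in> borel_measurable (time T)"
    by (rule measurable_cong[THEN iffD1, rotated]) (auto simp: space_restrict_space)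
  have "bounded (f ` {0..T})" by (intro compact_imp_bounded compact_continuous_image f) auto
  then obtain c where c: "\<And>t. t \<in> {0..T} \<Longrightarrow> norm (f t) \<le> c" unfolding bounded_iff by force
  have "(\<lambda>t. 1 :: real) \<in> L2 (time T)" by (simp add: L2_def)
  then show ?thesis
    by (rule L2_bounded[OF _ m, where K = c]) (use c in \<open>auto intro!: AE_I2 simp: space_restrict_space\<close>)
next
  case False
  then have "space (time T) = {}" by (simp add: space_restrict_space)
  then show ?thesis by (simp add: L2_def integrable_iff_bounded measurable_def nn_integral_empty)
qed

lemma primitive_lborel:
  fixes w :: "real \<Rightarrow> 'b::{real_inner, banach, second_countable_topology}"
  assumes W: "W \<in> L2 lborel" "AE t in time T. w t = W t" and w: "w \<in> L2 (time T)" and t: "t \<le> T"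
  shows "(LINT s|time t. w s) = (LINT s|lborel. indicator {0<..<t} s *\<^sub>R W s)"
proof -
  have Wm: "W \<in> borel_measurable borel" using L2_measurable[OF W(1)] by simp
  have "(LINT s|time t. w s) = (LINT s|time t. W s)"
    by (rule integral_cong_AE[OF L2_measurable[OF L2_time_mono(1)[OF t w]] borel_measurable_time_borel[OF Wm]
          AE_time_mono[OF t W(2)]])
  then show ?thesis using integral_time_borel(1)[OF Wm] by simp
qed

text \<open>Dominated convergence: the indicators of the intervals converge at every point except
  the limiting endpoint.\<close>

lemma primitive_continuous:
  fixes w :: "real \<Rightarrow> 'b::{real_inner, banach, second_countable_topology}"
  assumes w: "w \<in> L2 (time T)"
  shows "continuous_on {0..T} (\<lambda>t. LINT s|time t. w s)"
proof -
  obtain W where W: "W \<in> L2 lborel" "\<And>t. t \<notin> {0<..<T} \<Longrightarrow> W t = 0" "AE t in time T. w t = W t"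
    by (rule L2_time_borel_representative[OF w]) blast
  have Wi: "integrable lborel W" by (rule integrable_lborel_of_L2_time[OF W(1,2)])
  then have [measurable]: "W \<in> borel_measurable borel" by auto
  have "continuous_on {0..T} (\<lambda>t. LINT s|lborel. indicator {0<..<t} s *\<^sub>R W s)"
  proof (rule continuous_on_sequentiallyI)
    fix u :: "nat \<Rightarrow> real" and a assume u: "u \<longlonglongrightarrow> a"
    show "(\<lambda>n. LINT s|lborel. indicator {0<..<u n} s *\<^sub>R W s) \<longlonglongrightarrow> (LINT s|lborel. indicator {0<..<a} s *\<^sub>R W s)"
    proof (rule integral_dominated_convergence[where w = "\<lambda>s. norm (W s)"])
      show "AE s in lborel. (\<lambda>n. indicator {0<..<u n} s *\<^sub>R W s) \<longlonglongrightarrow> indicator {0<..<a} s *\<^sub>R W s"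
        using AE_lborel_singleton[of a]
      proof eventually_elim
        case (elim s)
        have "\<forall>\<^sub>F n in sequentially. indicator {0<..<u n} s = (indicator {0<..<a} s :: real)"
        proof (cases "s < a")
          case True
          have "\<forall>\<^sub>F n in sequentially. s < u n" using True u by (intro order_tendstoD)
          then show ?thesis by eventually_elim (use True in \<open>auto simp: indicator_def\<close>)
        next
          case False
          then have "a < s" using elim by simp
          then have "\<forall>\<^sub>F n in sequentially. u n < s" using u by (intro order_tendstoD)
          then show ?thesis by eventually_elim (use False in \<open>auto simp: indicator_def\<close>)
        qed
        then have "\<forall>\<^sub>F n in sequentially. indicator {0<..<u n} s *\<^sub>R W s = indicator {0<..<a} s *\<^sub>R W s"
          by eventually_elim simp
        then show ?case by (rule tendsto_eventually)
      qed
      show "integrable lborel (\<lambda>s. norm (W s))" using Wi by simp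
    qed (auto simp: indicator_def)
  qed
  then show ?thesis
    by (rule continuous_on_cong[THEN iffD1, rotated -1]) (auto simp: primitive_lborel[OF W(1,3) w])
qed

lemma closure_range_inner_zero:
  assumes "closure (range f) = UNIV" and "\<And>v. g \<bullet> f v = 0"
  shows "g = (0 :: 'h::real_inner)"
proof -
  have "closed {x. g \<bullet> x = 0}" by (intro closed_Collect_eq continuous_intros)
  then have "closure (range f) \<subseteq> {x. g \<bullet> x = 0}" using assms(2) by (intro closure_minimal) auto
  then have "g \<bullet> g = 0" unfolding assms(1) by blast
  then show ?thesis by simp
qed

context
  fixes \<iota> :: "'v::{real_inner, banach, second_countable_topology} \<Rightarrow>\<^sub>L
    'h::{real_inner, banach, second_countable_topology}"
begin

text \<open>These are the test paths of the existence proof. They vanish at time 0, and the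
  functional \<open>v \<mapsto> \<iota> (w t) \<bullet> \<iota> v\<close>, which is the derivative
  in V', has the Riesz representative \<open>adj \<iota> (\<iota> (w t))\<close>.\<close>

lemma weak_path_primitive:
  assumes w: "w \<in> L2 (time T)"
  shows "weak_path T \<iota> (\<lambda>t. LINT s|time t. w s) (\<lambda>t. \<iota> (LINT s|time t. w s)) (\<lambda>t. adj \<iota> (\<iota> (w t)))"
proof (rule weak_pathI)
  have c: "continuous_on {0..T} (\<lambda>t. LINT s|time t. w s)" by (rule primitive_continuous[OF w])
  then show "(\<lambda>t. LINT s|time t. w s) \<in> L2 (time T)" by (rule L2_time_continuous)
  show "(\<lambda>t. adj \<iota> (\<iota> (w t))) \<in> L2 (time T)" by (intro L2_blinfun w)
  show "continuous_on {0..T} (\<lambda>t. \<iota> (LINT s|time t. w s))"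
    by (rule bounded_linear.continuous_on[OF blinfun.bounded_linear_right c])
  fix t v assume "t \<in> {0..T}"
  then have i: "integrable (time t) w"
    by (intro L2_imp_integrable[OF finite_measure_time] L2_time_mono(1)[OF _ w]) simp
  have "\<iota> (LINT s|time t. w s) \<bullet> \<iota> v = (LINT s|time t. w s) \<bullet> adj \<iota> (\<iota> v)" by (simp add: inner_adj_right)
  also have "\<dots> = (LINT s|time t. w s \<bullet> adj \<iota> (\<iota> v))" by (rule integral_inner_left[OF i, symmetric])
  also have "\<dots> = (LINT s|time t. adj \<iota> (\<iota> (w s)) \<bullet> v)" by (simp add: inner_adj_right inner_adj)
  finally have "\<iota> (LINT s|time t. w s) \<bullet> \<iota> v = (LINT s|time t. adj \<iota> (\<iota> (w s)) \<bullet> v)" .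
  moreover have "(LINT s|time 0. w s) = 0" 
    using Bochner_Integration.integral_cong[of "time 0" "time 0" w "\<lambda>_. 0"] by (simp add: space_restrict_space)
  ultimately show "\<iota> (LINT s|time t. w s) \<bullet> \<iota> v = \<iota> (LINT s|time 0. w s) \<bullet> \<iota> v + (LINT s|time t. adj \<iota> (\<iota> (w s)) \<bullet> v)"
    by simp
qed simp

lemma weak_path_const: "weak_path T \<iota> (\<lambda>t. v) (\<lambda>t. \<iota> v) (\<lambda>t. 0)"
  by (rule weak_pathI) (auto intro!: L2_time_continuous continuous_intros)

text \<open>Completeness of W(0,T) for the quantities that the energy estimate controls. Uniform
  convergence of \<open>z\<close> preserves the continuous representative, and the weak formulation
  passes to the limit for fixed \<open>t\<close> and \<open>v\<close>.\<close>

lemma weak_path_limit: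
  assumes T: "T > 0" and w: "\<And>n. weak_path T \<iota> (y n) (z n) (k n)"
    and y: "\<And>e. e > 0 \<Longrightarrow> \<exists>N. \<forall>m\<ge>N. \<forall>n\<ge>N. L2_norm (time T) (\<lambda>t. y m t - y n t) < e"
    and k: "\<And>e. e > 0 \<Longrightarrow> \<exists>N. \<forall>m\<ge>N. \<forall>n\<ge>N. L2_norm (time T) (\<lambda>t. k m t - k n t) < e"
    and z: "\<And>e. e > 0 \<Longrightarrow> \<exists>N. \<forall>m\<ge>N. \<forall>n\<ge>N. \<forall>t\<in>{0..T}. norm (z m t - z n t) < e"
  obtains y' z' k' where "weak_path T \<iota> y' z' k'" "(\<lambda>n. L2_norm (time T) (\<lambda>t. y n t - y' t)) \<longlonglongrightarrow> 0"
    "(\<lambda>n. L2_norm (time T) (\<lambda>t. k n t - k' t)) \<longlonglongrightarrow> 0" "(\<lambda>n. z n 0) \<longlonglongrightarrow> z' 0"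
proof -
  note yL = weak_pathD(1)[OF w] and kL = weak_pathD(2)[OF w] and zc = weak_pathD(3)[OF w]
  obtain y' where y': "y' \<in> L2 (time T)" "(\<lambda>n. L2_norm (time T) (\<lambda>t. y n t - y' t)) \<longlonglongrightarrow> 0"
    using L2_complete[OF finite_measure_time yL y] by blast
  obtain k' where k': "k' \<in> L2 (time T)" "(\<lambda>n. L2_norm (time T) (\<lambda>t. k n t - k' t)) \<longlonglongrightarrow> 0"
    using L2_complete[OF finite_measure_time kL k] by blast
  have "uniformly_Cauchy_on {0..T} z"
    unfolding uniformly_Cauchy_on_def dist_norm using z by meson
  then have "\<exists>l. uniform_limit {0..T} z l sequentially"
    by (simp add: uniformly_convergent_on_def[symmetric] uniformly_convergent_eq_Cauchy)
  then obtain z' where z': "uniform_limit {0..T} z z' sequentially" by blast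
  have z'c: "continuous_on {0..T} z'"
    by (rule uniform_limit_theorem[OF _ z']) (use zc in auto)
  have pt: "(\<lambda>n. z n t) \<longlonglongrightarrow> z' t" if "t \<in> {0..T}" for t by (rule tendsto_uniform_limitI[OF z' that])
  have z'L: "z' \<in> L2 (time T)" by (rule L2_time_continuous[OF z'c])
  have iy: "(\<lambda>t. \<iota> (y' t)) \<in> L2 (time T)" by (rule L2_blinfun[OF y'(1)])
  \<comment> \<open>The limits of \<open>y\<close> and \<open>z\<close> were obtained separately;
    the identity \<open>\<iota> (y n t) = z n t\<close>, valid a.e. for each \<open>n\<close>, ties
    them together.\<close>
  have "L2_norm (time T) (\<lambda>t. \<iota> (y' t) - z' t) = 0"
  proof (rule LIMSEQ_unique[OF tendsto_const])
    have zlim: "(\<lambda>n. L2_norm (time T) (\<lambda>t. z n t - z' t)) \<longlonglongrightarrow> 0"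
    proof (rule LIMSEQ_I)
      fix e :: real assume e: "e > 0"
      have "\<forall>\<^sub>F n in sequentially. \<forall>t\<in>{0..T}. dist (z n t) (z' t) < e / (sqrt T + 1)"
        using z' e T by (intro uniform_limitD) (auto simp: add_pos_pos)
      \<comment> \<open>The constant 1 has norm \<open>sqrt T\<close> on (0,T); the summand 1 makes
        the final inequality strict.\<close>
      then obtain N where N: "\<And>n t. n \<ge> N \<Longrightarrow> t \<in> {0..T} \<Longrightarrow> norm (z n t - z' t) < e / (sqrt T + 1)"
        unfolding eventually_sequentially dist_norm by blast
      interpret finite_measure "time T" by (rule finite_measure_time)
      have one: "(\<lambda>t. 1 :: real) \<in> L2 (time T)" by (simp add: L2_def)
      have none: "L2_norm (time T) (\<lambda>t. 1 :: real) = sqrt T"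
        using T by (simp add: L2_norm_def measure_restrict_space space_restrict_space)
      have "L2_norm (time T) (\<lambda>t. z n t - z' t) < e" if n: "n \<ge> N" for n
      proof -
        have "L2_norm (time T) (\<lambda>t. z n t - z' t) \<le> e / (sqrt T + 1) * L2_norm (time T) (\<lambda>t. 1 :: real)"
        proof (rule L2_norm_bounded[OF one])
          show "(\<lambda>t. z n t - z' t) \<in> borel_measurable (time T)"
            by (rule L2_measurable[OF L2_diff[OF L2_time_continuous[OF zc] z'L]])
          show "AE t in time T. norm (z n t - z' t) \<le> e / (sqrt T + 1) * norm (1::real)"
          proof (rule AE_I2)
            fix t assume "t \<in> space (time T)"
            then have "t \<in> {0..T}" by (simp add: space_restrict_space)
            then have "norm (z n t - z' t) < e / (sqrt T + 1)" using N n by blast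
            then show "norm (z n t - z' t) \<le> e / (sqrt T + 1) * norm (1::real)" by simp
          qed
        qed (use e T in \<open>simp add: add_nonneg_nonneg\<close>)
        also have "\<dots> = e * (sqrt T / (sqrt T + 1))" by (simp add: none)
        also have "\<dots> < e * 1" using e T by (intro mult_strict_left_mono) (auto simp: divide_less_eq add_pos_pos)
        finally show ?thesis by simp
      qed
      then show "\<exists>N. \<forall>n\<ge>N. norm (L2_norm (time T) (\<lambda>t. z n t - z' t) - 0) < e" by auto
    qed
    show "(\<lambda>n. L2_norm (time T) (\<lambda>t. \<iota> (y' t) - z' t)) \<longlonglongrightarrow> 0"
    proof (rule Lim_null_comparison)
      show "(\<lambda>n. norm \<iota> * L2_norm (time T) (\<lambda>t. y n t - y' t) + L2_norm (time T) (\<lambda>t. z n t - z' t)) \<longlonglongrightarrow> 0"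
        using tendsto_add[OF tendsto_mult_right_zero[OF y'(2)] zlim] by simp
      show "\<forall>\<^sub>F n in sequentially. norm (L2_norm (time T) (\<lambda>t. \<iota> (y' t) - z' t))
          \<le> norm \<iota> * L2_norm (time T) (\<lambda>t. y n t - y' t) + L2_norm (time T) (\<lambda>t. z n t - z' t)"
      proof (intro always_eventually allI)
        fix n
        have d: "(\<lambda>t. y n t - y' t) \<in> L2 (time T)" by (rule L2_diff[OF yL y'(1)])
        have e: "(\<lambda>t. z n t - z' t) \<in> L2 (time T)" by (rule L2_diff[OF L2_time_continuous[OF zc] z'L])
        have "L2_norm (time T) (\<lambda>t. \<iota> (y' t) - z' t) = L2_norm (time T) (\<lambda>t. (z n t - z' t) - \<iota> (y n t - y' t))"
        proof (rule L2_norm_cong_AE)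
          show "AE t in time T. \<iota> (y' t) - z' t = (z n t - z' t) - \<iota> (y n t - y' t)"
            using weak_pathD(4)[OF w, of n] by eventually_elim (simp add: blinfun.diff_right)
        qed (intro L2_measurable L2_diff iy z'L e L2_blinfun d)+
        also have "\<dots> \<le> L2_norm (time T) (\<lambda>t. z n t - z' t) + L2_norm (time T) (\<lambda>t. \<iota> (y n t - y' t))"
          by (rule L2_norm_triangle_diff[OF e L2_blinfun[OF d]])
        also have "L2_norm (time T) (\<lambda>t. \<iota> (y n t - y' t)) \<le> norm \<iota> * L2_norm (time T) (\<lambda>t. y n t - y' t)"
          by (rule L2_norm_blinfun[OF d])
        finally show "norm (L2_norm (time T) (\<lambda>t. \<iota> (y' t) - z' t))
          \<le> norm \<iota> * L2_norm (time T) (\<lambda>t. y n t - y' t) + L2_norm (time T) (\<lambda>t. z n t - z' t)" by simp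
      qed
    qed
  qed
  then have ae: "AE t in time T. \<iota> (y' t) = z' t"
    using L2_norm_eq_0_imp_AE[OF L2_diff[OF iy z'L]] by simp
  have "weak_path T \<iota> y' z' k'"
  proof (rule weak_pathI[OF y'(1) k'(1) z'c ae])
    fix t and v :: 'v assume t: "t \<in> {0..T}"
    have tT: "t \<le> T" using t by simp
    have "(\<lambda>n. L2_norm (time t) (\<lambda>s. k n s - k' s)) \<longlonglongrightarrow> 0"
      by (rule Lim_null_comparison[OF _ k'(2)])
         (use L2_time_mono(2)[OF tT L2_diff[OF kL k'(1)]] in simp)
    moreover have "(\<lambda>s. v) \<in> L2 (time t)" by (rule L2_time_continuous) simp
    ultimately have "(\<lambda>n. LINT s|time t. k n s \<bullet> v) \<longlonglongrightarrow> (LINT s|time t. k' s \<bullet> v)"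
      by - (rule L2_inner_tendsto[OF L2_time_mono(1)[OF tT kL] L2_time_mono(1)[OF tT k'(1)]])
    then have "(\<lambda>n. z n 0 \<bullet> \<iota> v + (LINT s|time t. k n s \<bullet> v)) \<longlonglongrightarrow> z' 0 \<bullet> \<iota> v + (LINT s|time t. k' s \<bullet> v)"
      using T by (intro tendsto_add tendsto_inner pt tendsto_const) auto
    then have "(\<lambda>n. z n t \<bullet> \<iota> v) \<longlonglongrightarrow> z' 0 \<bullet> \<iota> v + (LINT s|time t. k' s \<bullet> v)"
      using weak_pathD(5)[OF w t] by simp
    moreover have "(\<lambda>n. z n t \<bullet> \<iota> v) \<longlonglongrightarrow> z' t \<bullet> \<iota> v" by (intro tendsto_inner pt t tendsto_const)
    ultimately show "z' t \<bullet> \<iota> v = z' 0 \<bullet> \<iota> v + (LINT s|time t. k' s \<bullet> v)" using LIMSEQ_unique by blast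
  qed
  then show thesis using y'(2) k'(2) pt[of 0] T by (intro that) auto
qed

text \<open>Tested against its own backward Steklov averages, a function orthogonal to the range of the
  parabolic operator vanishes.\<close>

lemma parabolic_range_orthogonal:
  fixes M :: "real \<Rightarrow> 'v \<Rightarrow>\<^sub>L 'v"
  assumes T: "T > 0" and M: "Linfty_op T M" and \<eta>: "\<eta> > 0"
    and coer: "\<And>t v. t \<in> {0<..<T} \<Longrightarrow> \<eta> * (norm v)\<^sup>2 \<le> M t v \<bullet> v"
    and G: "G \<in> L2 (time T)"
    and orth: "\<And>w. w \<in> L2 (time T) \<Longrightarrow>
      (LINT t|time T. G t \<bullet> (adj \<iota> (\<iota> (w t)) + M t (LINT s|time t. w s))) = 0"
  shows "L2_norm (time T) G = 0"
proof -
  obtain K where K: "K > 0" "\<And>y. y \<in> L2 (time T) \<Longrightarrow> (\<lambda>t. M t (y t)) \<in> L2 (time T)"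
    "\<And>y. y \<in> L2 (time T) \<Longrightarrow> L2_norm (time T) (\<lambda>t. M t (y t)) \<le> K * L2_norm (time T) y"
    by (rule Linfty_op_L2_norm[OF M]) blast
  obtain g where g: "g \<in> L2 lborel" "\<And>t. t \<notin> {0<..<T} \<Longrightarrow> g t = 0" "AE t in time T. G t = g t"
    by (rule L2_time_borel_representative[OF G]) blast
  have gT: "g \<in> L2 (time T)" by (rule L2_time_borel[OF g(1)])
  have gm [measurable]: "g \<in> borel_measurable borel" using L2_measurable[OF g(1)] by simp
  have gi: "integrable lborel g" by (rule integrable_lborel_of_L2_time[OF g(1,2)])
  have le: "(LINT t|time T. M t (steklov (- h) g t) \<bullet> G t) \<le> 0" if h: "h > 0" for h
  proof -
    \<comment> \<open>The difference quotient whose primitive is the backward average of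
      \<open>g\<close>, which thereby becomes admissible in \<open>orth\<close>.\<close>
    define w where "w = (\<lambda>t. (1 / h) *\<^sub>R (g t - g (t + - h)))"
    have wl: "w \<in> L2 lborel" unfolding w_def by (intro L2_scaleR L2_diff g(1) L2_lborel_shift(1))
    have w: "w \<in> L2 (time T)" by (rule L2_time_borel[OF wl])
    have prim: "(LINT s|time t. w s) = steklov (- h) g t" if t: "t \<in> {0<..<T}" for t
    proof -
      have i: "integrable lborel (\<lambda>s. indicator {a<..<b} s *\<^sub>R g s)" for a b
        by (rule integrable_mult_indicator[OF _ gi]) simp
      have shift: "integrable lborel (\<lambda>s. indicator {0<..<t} s *\<^sub>R g (s + - h))"
        "(LINT s|lborel. indicator {0<..<t} s *\<^sub>R g (s + - h)) = (LINT s|lborel. indicator {- h<..<t - h} s *\<^sub>R g s)"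
      proof -
        have eq: "(\<lambda>s. indicator {- h<..<t - h} (- h + 1 * s) *\<^sub>R g (- h + 1 * s)) = (\<lambda>s. indicator {0<..<t} s *\<^sub>R g (s + - h))"
          by (rule ext) (auto simp: indicator_def add.commute)
        show "integrable lborel (\<lambda>s. indicator {0<..<t} s *\<^sub>R g (s + - h))"
          using lborel_integrable_real_affine[OF i[of "- h" "t - h"], of 1 "- h"] unfolding eq by simp
        show "(LINT s|lborel. indicator {0<..<t} s *\<^sub>R g (s + - h)) = (LINT s|lborel. indicator {- h<..<t - h} s *\<^sub>R g s)"
          using lborel_integral_real_affine[of 1 "\<lambda>s. indicator {- h<..<t - h} s *\<^sub>R g s" "- h"] unfolding eq by simp
      qed
      have "h *\<^sub>R (LINT s|time t. w s) = (LINT s|lborel. h *\<^sub>R (indicator {0<..<t} s *\<^sub>R w s))"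
        using t primitive_lborel[OF wl _ w, of t] by (simp only: integral_scaleR_right) simp
      also have "\<dots> = (LINT s|lborel. indicator {0<..<t} s *\<^sub>R g s - indicator {0<..<t} s *\<^sub>R g (s + - h))"
        using h by (intro Bochner_Integration.integral_cong) (auto simp: w_def algebra_simps)
      also have "\<dots> = (LINT s|lborel. indicator {0<..<t} s *\<^sub>R g s - indicator {- h<..<t - h} s *\<^sub>R g s)"
        using i shift by simp
      \<comment> \<open>Since \<open>g\<close> vanishes at nonpositive times, the shifted integral
        contributes nothing there and no term at time 0 appears. This is why the average looks
        backward.\<close>
      also have "\<dots> = (LINT s|lborel. indicator {t - h..t} s *\<^sub>R g s)"
      proof (rule integral_cong_AE)
        show "AE s in lborel. indicator {0<..<t} s *\<^sub>R g s - indicator {- h<..<t - h} s *\<^sub>R g s = indicator {t - h..t} s *\<^sub>R g s"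
          using AE_lborel_singleton[of t]
        proof eventually_elim
          case (elim s)
          then show ?case using g(2)[of s] h by (cases "0 < s") (auto simp: indicator_def)
        qed
      qed simp_all
      also have "\<dots> = h *\<^sub>R steklov (- h) g t" by (rule steklov_backward[OF h, symmetric])
      finally show ?thesis using h by simp
    qed
    have "(LINT t|time T. G t \<bullet> (adj \<iota> (\<iota> (w t)) + M t (LINT s|time t. w s))) = 0" by (rule orth[OF w])
    moreover have "(LINT t|time T. G t \<bullet> (adj \<iota> (\<iota> (w t)) + M t (LINT s|time t. w s)))
        = (LINT t|time T. g t \<bullet> adj \<iota> (\<iota> (w t)) + M t (steklov (- h) g t) \<bullet> G t)"
    proof (rule integral_cong_AE)
      have "AE t in time T. t \<in> {0<..<T}" by (rule AE_I2) (simp add: space_restrict_space)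
      with g(3) show "AE t in time T. G t \<bullet> (adj \<iota> (\<iota> (w t)) + M t (LINT s|time t. w s)) = g t \<bullet> adj \<iota> (\<iota> (w t)) + M t (steklov (- h) g t) \<bullet> G t"
        by eventually_elim (simp add: prim inner_add_right inner_commute)
      show "(\<lambda>t. G t \<bullet> (adj \<iota> (\<iota> (w t)) + M t (LINT s|time t. w s))) \<in> borel_measurable (time T)"
        by (intro L2_inner_measurable[OF G] L2_add L2_blinfun w K(2) weak_pathD(1)[OF weak_path_primitive[OF w]])
      show "(\<lambda>t. g t \<bullet> adj \<iota> (\<iota> (w t)) + M t (steklov (- h) g t) \<bullet> G t) \<in> borel_measurable (time T)"
        by (intro borel_measurable_add L2_inner_measurable gT G L2_blinfun w K(2) L2_time_borel steklov_in_L2 g(1)) (use h in simp)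
    qed
    moreover have "(LINT t|time T. g t \<bullet> adj \<iota> (\<iota> (w t)) + M t (steklov (- h) g t) \<bullet> G t)
        = (LINT t|time T. g t \<bullet> adj \<iota> (\<iota> (w t))) + (LINT t|time T. M t (steklov (- h) g t) \<bullet> G t)"
      by (intro Bochner_Integration.integral_add L2_inner_integrable gT G L2_blinfun w K(2) L2_time_borel steklov_in_L2 g(1)) (use h in simp)
    moreover have "(LINT t|time T. g t \<bullet> adj \<iota> (\<iota> (w t))) \<ge> 0"
    proof -
      define a where "a = (\<lambda>t. \<iota> (g t))"
      have a: "a \<in> L2 lborel" unfolding a_def by (rule L2_blinfun[OF g(1)])
      have am: "(\<lambda>t. g t \<bullet> adj \<iota> (\<iota> (w t))) \<in> borel_measurable borel"
        using L2_inner_measurable[OF g(1) L2_blinfun[OF L2_blinfun[OF wl]]] by simp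
      have "(LINT t|time T. g t \<bullet> adj \<iota> (\<iota> (w t))) = (LINT t|lborel. indicator {0<..<T} t *\<^sub>R (g t \<bullet> adj \<iota> (\<iota> (w t))))"
        by (rule integral_time_borel(1)[OF am])
      also have "\<dots> = (LINT t|lborel. (1 / h) * (a t \<bullet> a t - a (t + - h) \<bullet> a t))"
      proof (rule Bochner_Integration.integral_cong[OF refl])
        fix t
        show "indicator {0<..<T} t *\<^sub>R (g t \<bullet> adj \<iota> (\<iota> (w t))) = (1 / h) * (a t \<bullet> a t - a (t + - h) \<bullet> a t)"
          using g(2)[of t] by (cases "t \<in> {0<..<T}")
            (auto simp: a_def w_def inner_adj_right blinfun.scaleR_right blinfun.diff_right inner_diff_right inner_commute)
      qed
      also have "\<dots> = (1 / h) * ((L2_norm lborel a)\<^sup>2 - (LINT t|lborel. a (t + - h) \<bullet> a t))"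
        using L2_inner_integrable[OF a a] L2_inner_integrable[OF L2_lborel_shift(1)[OF a, of "- h"] a]
        by (simp add: L2_norm_square power2_norm_eq_inner)
      also have "\<dots> \<ge> 0"
      proof -
        have "(LINT t|lborel. a (t + - h) \<bullet> a t) \<le> L2_norm lborel a * L2_norm lborel a"
          using L2_inner_le[OF L2_lborel_shift(1)[OF a, of "- h"] a] L2_lborel_shift(2)[OF a, of "- h"] by simp
        then show ?thesis using h by (simp add: power2_eq_square)
      qed
      finally show ?thesis .
    qed
    ultimately show ?thesis by linarith
  qed
  define h where "h = (\<lambda>n::nat. 1 / real (Suc n))"
  have h: "h n > 0" for n by (simp add: h_def)
  have hlim: "h \<longlonglongrightarrow> 0" unfolding h_def using LIMSEQ_Suc[OF lim_1_over_n] by simp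
  then have "(\<lambda>n. - h n) \<longlonglongrightarrow> 0" using tendsto_minus by fastforce
  then have "filterlim (\<lambda>n. - h n) (at 0) sequentially"
    using h by (auto simp: filterlim_at less_imp_neq[symmetric])
  moreover have tc: "translation_continuous g"
    by (rule translation_continuous_bounded_support[OF g(1), of "{0<..<T}"]) (use g(2) in auto)
  ultimately have slim: "(\<lambda>n. L2_norm lborel (\<lambda>t. steklov (- h n) g t - g t)) \<longlonglongrightarrow> 0"
    by (rule filterlim_compose[OF steklov_tendsto[OF g(1)], rotated])
  have st: "steklov (- h n) g \<in> L2 lborel" for n using h[of n] by (intro steklov_in_L2[OF g(1)]) simp
  \<comment> \<open>Boundedness of \<open>M\<close> carries the convergence of the averages over to
    their images.\<close>
  have "(\<lambda>n. L2_norm (time T) (\<lambda>t. M t (steklov (- h n) g t) - M t (g t))) \<longlonglongrightarrow> 0"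
  proof (rule Lim_null_comparison)
    show "(\<lambda>n. K * L2_norm lborel (\<lambda>t. steklov (- h n) g t - g t)) \<longlonglongrightarrow> 0"
      by (rule tendsto_mult_right_zero[OF slim])
    show "\<forall>\<^sub>F n in sequentially. norm (L2_norm (time T) (\<lambda>t. M t (steklov (- h n) g t) - M t (g t)))
        \<le> K * L2_norm lborel (\<lambda>t. steklov (- h n) g t - g t)"
    proof (intro always_eventually allI)
      fix n
      have d: "(\<lambda>t. steklov (- h n) g t - g t) \<in> L2 lborel" by (rule L2_diff[OF st g(1)])
      have "L2_norm (time T) (\<lambda>t. M t (steklov (- h n) g t - g t)) \<le> K * L2_norm (time T) (\<lambda>t. steklov (- h n) g t - g t)"
        by (rule K(3)[OF L2_time_borel[OF d]])
      also have "\<dots> \<le> K * L2_norm lborel (\<lambda>t. steklov (- h n) g t - g t)"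
        using K(1) by (intro mult_left_mono L2_norm_time_le_lborel[OF d]) simp
      finally show "norm (L2_norm (time T) (\<lambda>t. M t (steklov (- h n) g t) - M t (g t)))
        \<le> K * L2_norm lborel (\<lambda>t. steklov (- h n) g t - g t)" by (simp add: blinfun.diff_right)
    qed
  qed
  then have "(\<lambda>n. LINT t|time T. M t (steklov (- h n) g t) \<bullet> G t) \<longlonglongrightarrow> (LINT t|time T. M t (g t) \<bullet> G t)"
    by (intro L2_inner_tendsto K(2) L2_time_borel[OF st] gT G)
  then have "(LINT t|time T. M t (g t) \<bullet> G t) \<le> 0"
    by (rule LIMSEQ_le_const2) (use le h in auto)
  \<comment> \<open>Coercivity bounds the same limit from below.\<close>
  moreover have "\<eta> * (L2_norm (time T) G)\<^sup>2 \<le> (LINT t|time T. M t (g t) \<bullet> G t)"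
  proof -
    have "(LINT t|time T. \<eta> * (norm (G t))\<^sup>2) \<le> (LINT t|time T. M t (g t) \<bullet> G t)"
    proof (rule integral_mono_AE)
      have "AE t in time T. t \<in> {0<..<T}" by (rule AE_I2) (simp add: space_restrict_space)
      with g(3) show "AE t in time T. \<eta> * (norm (G t))\<^sup>2 \<le> M t (g t) \<bullet> G t"
        by eventually_elim (metis coer)
    qed (use L2_integrable[OF G] L2_inner_integrable[OF K(2)[OF gT] G] in simp_all)
    then show ?thesis using L2_integrable[OF G] by (simp add: L2_norm_square)
  qed
  ultimately have "\<eta> * (L2_norm (time T) G)\<^sup>2 \<le> 0" by linarith
  then show ?thesis using \<eta> by (simp add: mult_le_0_iff)
qed

text \<open>On triples \<open>(y, z, k)\<close> the operator \<open>L\<close> and the initial value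
  \<open>Z\<close> respect linear combinations, so \<open>Q\<close> is a sum of two squared Hilbert
  norms of affine expressions. The stationarity condition \<open>orth\<close> couples the two
  defects; the choice of test path separates them, since primitives do not see the initial value
  and, once \<open>G = 0\<close>, constants see nothing else.\<close>

theorem parabolic_existence:
  fixes M :: "real \<Rightarrow> 'v \<Rightarrow>\<^sub>L 'v"
  assumes T: "T > 0" and dense: "closure (range (blinfun_apply \<iota>)) = UNIV"
    and M: "Linfty_op T M" and \<eta>: "\<eta> > 0"
    and coer: "\<And>t v. t \<in> {0<..<T} \<Longrightarrow> \<eta> * (norm v)\<^sup>2 \<le> M t v \<bullet> v"
    and F: "F \<in> L2 (time T)"
  shows "\<exists>y z k. weak_path T \<iota> y z k \<and> z 0 = y0 \<and> (AE t in time T. k t + M t (y t) = F t)"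
proof -
  obtain K where K: "K > 0" "\<And>y. y \<in> L2 (time T) \<Longrightarrow> (\<lambda>t. M t (y t)) \<in> L2 (time T)"
    "\<And>y. y \<in> L2 (time T) \<Longrightarrow> L2_norm (time T) (\<lambda>t. M t (y t)) \<le> K * L2_norm (time T) y"
    by (rule Linfty_op_L2_norm[OF M]) blast
  define X where "X = {(y, z, k). weak_path T \<iota> y z k}"
  define L :: "(real \<Rightarrow> 'v) \<times> (real \<Rightarrow> 'h) \<times> (real \<Rightarrow> 'v) \<Rightarrow> real \<Rightarrow> 'v"
    where "L = (\<lambda>(y, z, k) t. k t + M t (y t))"
  define Z :: "(real \<Rightarrow> 'v) \<times> (real \<Rightarrow> 'h) \<times> (real \<Rightarrow> 'v) \<Rightarrow> 'h"
    where "Z = (\<lambda>(y, z, k). z 0)"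
  define Q where "Q = (\<lambda>p. (L2_norm (time T) (\<lambda>t. F t - L p t))\<^sup>2 + (norm (y0 - Z p))\<^sup>2)"
  define D where "D = (\<lambda>p q. (L2_norm (time T) (\<lambda>t. L p t - L q t))\<^sup>2 + (norm (Z p - Z q))\<^sup>2)"
  have LX: "L p \<in> L2 (time T)" if "p \<in> X" for p
    using that K(2) by (auto simp: X_def L_def intro!: L2_add dest: weak_pathD(1,2))
  have comb: "\<exists>m\<in>X. L m = (\<lambda>t. a *\<^sub>R L p t + b *\<^sub>R L q t) \<and> Z m = a *\<^sub>R Z p + b *\<^sub>R Z q"
    if "p \<in> X" "q \<in> X" for p q a b
  proof -
    obtain y z k y' z' k' where pq: "p = (y, z, k)" "q = (y', z', k')" by (cases p, cases q) auto
    have "weak_path T \<iota> (\<lambda>t. a *\<^sub>R y t + b *\<^sub>R y' t) (\<lambda>t. a *\<^sub>R z t + b *\<^sub>R z' t) (\<lambda>t. a *\<^sub>R k t + b *\<^sub>R k' t)"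
      using that by (intro weak_path_add weak_path_scaleR) (auto simp: X_def pq)
    then show ?thesis
      by (intro bexI[of _ "(\<lambda>t. a *\<^sub>R y t + b *\<^sub>R y' t, \<lambda>t. a *\<^sub>R z t + b *\<^sub>R z' t, \<lambda>t. a *\<^sub>R k t + b *\<^sub>R k' t)"])
         (auto simp: X_def L_def Z_def pq blinfun.add_right blinfun.scaleR_right algebra_simps)
  qed
  have FL: "(\<lambda>t. F t - L p t) \<in> L2 (time T)" if "p \<in> X" for p by (rule L2_diff[OF F LX[OF that]])
  \<comment> \<open>The parallelogram identity for both squares: at the midpoint each defect is the
    mean of the two given ones.\<close>
  have mid: "\<exists>m\<in>X. Q m \<le> (Q p + Q q) / 2 - D p q / 4" if p: "p \<in> X" and q: "q \<in> X" for p q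
  proof -
    obtain m where m: "m \<in> X" "L m = (\<lambda>t. (1/2) *\<^sub>R L p t + (1/2) *\<^sub>R L q t)" "Z m = (1/2) *\<^sub>R Z p + (1/2) *\<^sub>R Z q"
      using comb[OF p q, of "1/2" "1/2"] by blast
    have "(\<lambda>t. F t - L m t) = (\<lambda>t. (1/2) *\<^sub>R ((F t - L p t) + (F t - L q t)))"
      by (rule ext) (simp add: m(2) algebra_simps flip: scaleR_add_left)
    then have "(L2_norm (time T) (\<lambda>t. F t - L m t))\<^sup>2 = (L2_norm (time T) (\<lambda>t. (F t - L p t) + (F t - L q t)))\<^sup>2 / 4"
      by (simp only: L2_norm_scaleR) (simp add: power2_eq_square)
    also have "\<dots> = ((L2_norm (time T) (\<lambda>t. F t - L p t))\<^sup>2 + (L2_norm (time T) (\<lambda>t. F t - L q t))\<^sup>2) / 2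
        - (L2_norm (time T) (\<lambda>t. (F t - L p t) - (F t - L q t)))\<^sup>2 / 4"
      by (simp only: L2_norm_add_square[OF FL[OF p] FL[OF q]] L2_norm_diff_square[OF FL[OF p] FL[OF q]])
         (simp add: field_simps)
    also have "L2_norm (time T) (\<lambda>t. (F t - L p t) - (F t - L q t)) = L2_norm (time T) (\<lambda>t. L p t - L q t)"
      using L2_norm_minus_commute[of "time T" "L q" "L p"] by simp
    finally have 1: "(L2_norm (time T) (\<lambda>t. F t - L m t))\<^sup>2 = ((L2_norm (time T) (\<lambda>t. F t - L p t))\<^sup>2 + (L2_norm (time T) (\<lambda>t. F t - L q t))\<^sup>2) / 2
        - (L2_norm (time T) (\<lambda>t. L p t - L q t))\<^sup>2 / 4" .
    have "y0 - Z m = (1/2) *\<^sub>R ((y0 - Z p) + (y0 - Z q))"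
      by (simp add: m(3) algebra_simps flip: scaleR_add_left)
    then have "(norm (y0 - Z m))\<^sup>2 = (norm ((y0 - Z p) + (y0 - Z q)))\<^sup>2 / 4"
      by (simp only: norm_scaleR) (simp add: power2_eq_square)
    also have "\<dots> = ((norm (y0 - Z p))\<^sup>2 + (norm (y0 - Z q))\<^sup>2) / 2 - (norm ((y0 - Z p) - (y0 - Z q)))\<^sup>2 / 4"
      unfolding power2_norm_eq_inner inner_add_left[of "y0 - Z p"] inner_add_right[of _ "y0 - Z p"]
        inner_diff_left[of "y0 - Z p"] inner_diff_right[of _ "y0 - Z p"] inner_commute[of "y0 - Z q" "y0 - Z p"]
      by (simp add: field_simps)
    also have "norm ((y0 - Z p) - (y0 - Z q)) = norm (Z p - Z q)" by (simp add: norm_minus_commute)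
    finally have 2: "(norm (y0 - Z m))\<^sup>2 = ((norm (y0 - Z p))\<^sup>2 + (norm (y0 - Z q))\<^sup>2) / 2 - (norm (Z p - Z q))\<^sup>2 / 4" .
    show ?thesis using m(1) unfolding Q_def D_def 1 2 by (intro bexI[of _ m]) (auto simp: Q_def 1 2 field_simps)
  qed
  have "(\<lambda>t. 0, \<lambda>t. \<iota> 0, \<lambda>t. 0) \<in> X" unfolding X_def using weak_path_const[of T 0] by simp
  then have ne: "X \<noteq> {}" by blast
  have Q0: "0 \<le> Q p" for p by (simp add: Q_def)
  obtain p where p: "\<And>n. p n \<in> X" and Qlim: "(\<lambda>n. Q (p n)) \<longlonglongrightarrow> Inf (Q ` X)"
    and cauchy: "\<And>e. e > 0 \<Longrightarrow> \<exists>N. \<forall>m\<ge>N. \<forall>n\<ge>N. D (p m) (p n) / 4 < e"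
    by (rule minimizing_sequence_Cauchy[of X 0 Q "\<lambda>p q. D p q / 4", OF ne Q0 mid]) blast+
  define y z k where "y = (\<lambda>n. fst (p n))" and "z = (\<lambda>n. fst (snd (p n)))" and "k = (\<lambda>n. snd (snd (p n)))"
  have p_eq: "p n = (y n, z n, k n)" for n by (simp add: y_def z_def k_def)
  have w: "weak_path T \<iota> (y n) (z n) (k n)" for n using p[of n] by (simp add: X_def p_eq)
  \<comment> \<open>It dominates both factors in the energy estimate, 1 for the initial value and
    \<open>1 / \<eta>\<close> for the right-hand side.\<close>
  define c where "c = 1 + 1 / \<eta>"
  have c: "c > 0" using \<eta> by (simp add: c_def add_pos_pos)
  \<comment> \<open>The difference of two paths solves the equation with right-hand side
    \<open>L (p m) - L (p n)\<close>, so the energy estimate bounds it by \<open>D\<close>.\<close>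
  have energy: "(norm (z m t - z n t))\<^sup>2 + \<eta> * (L2_norm (time t) (\<lambda>t. y m t - y n t))\<^sup>2 \<le> c * D (p m) (p n)"
    if "t \<in> {0..T}" for m n t
  proof -
    have "(norm (z m t - z n t))\<^sup>2 + \<eta> * (L2_norm (time t) (\<lambda>t. y m t - y n t))\<^sup>2
        \<le> (norm (z m 0 - z n 0))\<^sup>2 + (L2_norm (time T) (\<lambda>t. L (p m) t - L (p n) t))\<^sup>2 / \<eta>"
      by (rule weak_path_energy[OF weak_path_diff[OF w w] M \<eta> coer L2_diff[OF LX LX] _ that])
         (auto simp: p[unfolded p_eq] L_def p_eq blinfun.diff_right)
    also have "\<dots> \<le> c * D (p m) (p n)"
      using \<eta> by (simp add: c_def D_def Z_def p_eq algebra_simps add_nonneg_nonneg)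
    finally show ?thesis .
  qed
  have Dn: "0 \<le> D p q" for p q by (simp add: D_def)
  have z_cauchy: "\<exists>N. \<forall>m\<ge>N. \<forall>n\<ge>N. \<forall>t\<in>{0..T}. norm (z m t - z n t) < e" if e: "e > 0" for e
  proof -
    obtain N where N: "\<And>m n. m \<ge> N \<Longrightarrow> n \<ge> N \<Longrightarrow> D (p m) (p n) / 4 < e\<^sup>2 / (4 * c)"
      using cauchy[of "e\<^sup>2 / (4 * c)"] e c by auto
    have "norm (z m t - z n t) < e" if "m \<ge> N" "n \<ge> N" "t \<in> {0..T}" for m n t
    proof (rule power2_less_imp_less)
      have "(norm (z m t - z n t))\<^sup>2 \<le> c * D (p m) (p n)" using energy[OF that(3), of m n] \<eta>
        by (smt (verit) mult_nonneg_nonneg zero_le_power2)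
      also have "\<dots> < e\<^sup>2" using N[OF that(1,2)] c by (simp add: field_simps)
      finally show "(norm (z m t - z n t))\<^sup>2 < e\<^sup>2" .
    qed (use e in simp)
    then show ?thesis by blast
  qed
  have y_cauchy: "\<exists>N. \<forall>m\<ge>N. \<forall>n\<ge>N. L2_norm (time T) (\<lambda>t. y m t - y n t) < e" if e: "e > 0" for e
  proof -
    obtain N where N: "\<And>m n. m \<ge> N \<Longrightarrow> n \<ge> N \<Longrightarrow> D (p m) (p n) / 4 < \<eta> * e\<^sup>2 / (4 * c)"
      using cauchy[of "\<eta> * e\<^sup>2 / (4 * c)"] e c \<eta> by auto
    have "L2_norm (time T) (\<lambda>t. y m t - y n t) < e" if "m \<ge> N" "n \<ge> N" for m n
    proof (rule power2_less_imp_less)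
      have "\<eta> * (L2_norm (time T) (\<lambda>t. y m t - y n t))\<^sup>2 \<le> c * D (p m) (p n)"
        using energy[of T m n] T by (smt (verit) atLeastAtMost_iff zero_le_power2)
      also have "\<dots> < \<eta> * e\<^sup>2" using N[OF that(1,2)] c by (simp add: field_simps)
      finally show "(L2_norm (time T) (\<lambda>t. y m t - y n t))\<^sup>2 < e\<^sup>2" using \<eta> by simp
    qed (use e in simp)
    then show ?thesis by blast
  qed
  \<comment> \<open>The energy estimate does not speak about the derivative; it is recovered as
    \<open>k = L - M y\<close> from two quantities that are already Cauchy.\<close>
  have k_cauchy: "\<exists>N. \<forall>m\<ge>N. \<forall>n\<ge>N. L2_norm (time T) (\<lambda>t. k m t - k n t) < e" if e: "e > 0" for e
  proof -
    obtain N1 where N1: "\<And>m n. m \<ge> N1 \<Longrightarrow> n \<ge> N1 \<Longrightarrow> D (p m) (p n) / 4 < (e / 2)\<^sup>2 / 4"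
      using cauchy[of "(e / 2)\<^sup>2 / 4"] e by auto
    obtain N2 where N2: "\<And>m n. m \<ge> N2 \<Longrightarrow> n \<ge> N2 \<Longrightarrow> L2_norm (time T) (\<lambda>t. y m t - y n t) < e / (2 * K)"
      using y_cauchy[of "e / (2 * K)"] e K(1) by auto
    have "L2_norm (time T) (\<lambda>t. k m t - k n t) < e" if mn: "m \<ge> max N1 N2" "n \<ge> max N1 N2" for m n
    proof -
      have yd: "(\<lambda>t. y m t - y n t) \<in> L2 (time T)" by (intro L2_diff weak_pathD(1)[OF w])
      have Ld: "(\<lambda>t. L (p m) t - L (p n) t) \<in> L2 (time T)" by (intro L2_diff LX p)
      have "(\<lambda>t. k m t - k n t) = (\<lambda>t. (L (p m) t - L (p n) t) - M t (y m t - y n t))"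
        by (rule ext) (simp add: L_def p_eq blinfun.diff_right)
      then have "L2_norm (time T) (\<lambda>t. k m t - k n t)
          \<le> L2_norm (time T) (\<lambda>t. L (p m) t - L (p n) t) + K * L2_norm (time T) (\<lambda>t. y m t - y n t)"
        using L2_norm_triangle_diff[OF Ld K(2)[OF yd]] K(3)[OF yd] by simp
      moreover have "L2_norm (time T) (\<lambda>t. L (p m) t - L (p n) t) < e / 2"
      proof (rule power2_less_imp_less)
        show "(L2_norm (time T) (\<lambda>t. L (p m) t - L (p n) t))\<^sup>2 < (e / 2)\<^sup>2"
        proof -
          have "D (p m) (p n) < (e / 2)\<^sup>2" using N1[of m n] mn by simp
          moreover have "0 \<le> (norm (Z (p m) - Z (p n)))\<^sup>2" by simp
          ultimately show ?thesis unfolding D_def by linarith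
        qed
      qed (use e in simp)
      moreover have "K * L2_norm (time T) (\<lambda>t. y m t - y n t) < e / 2"
        using N2[of m n] mn K(1) by (simp add: field_simps)
      ultimately show ?thesis by simp
    qed
    then show ?thesis by blast
  qed
  obtain y' z' k' where w': "weak_path T \<iota> y' z' k'" and lim: "(\<lambda>n. L2_norm (time T) (\<lambda>t. y n t - y' t)) \<longlonglongrightarrow> 0"
    "(\<lambda>n. L2_norm (time T) (\<lambda>t. k n t - k' t)) \<longlonglongrightarrow> 0" "(\<lambda>n. z n 0) \<longlonglongrightarrow> z' 0"
    by (rule weak_path_limit[OF T w y_cauchy k_cauchy z_cauchy]) blast+
  define p' where "p' = (y', z', k')"
  have p': "p' \<in> X" by (simp add: p'_def X_def w')
  \<comment> \<open>The residual depends continuously on \<open>(y, k)\<close>, so \<open>Q\<close>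
    attains its infimum at the limit path.\<close>
  have Llim: "(\<lambda>n. L2_norm (time T) (\<lambda>t. (F t - L (p n) t) - (F t - L p' t))) \<longlonglongrightarrow> 0"
  proof (rule Lim_null_comparison)
    show "(\<lambda>n. L2_norm (time T) (\<lambda>t. k n t - k' t) + K * L2_norm (time T) (\<lambda>t. y n t - y' t)) \<longlonglongrightarrow> 0"
      using tendsto_add[OF lim(2) tendsto_mult_right_zero[OF lim(1)]] by simp
    show "\<forall>\<^sub>F n in sequentially. norm (L2_norm (time T) (\<lambda>t. (F t - L (p n) t) - (F t - L p' t)))
        \<le> L2_norm (time T) (\<lambda>t. k n t - k' t) + K * L2_norm (time T) (\<lambda>t. y n t - y' t)"
    proof (intro always_eventually allI)
      fix n
      have yd: "(\<lambda>t. y n t - y' t) \<in> L2 (time T)" by (intro L2_diff weak_pathD(1)[OF w] weak_pathD(1)[OF w'])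
      have kd: "(\<lambda>t. k n t - k' t) \<in> L2 (time T)" by (intro L2_diff weak_pathD(2)[OF w] weak_pathD(2)[OF w'])
      have "(\<lambda>t. (F t - L (p n) t) - (F t - L p' t)) = (\<lambda>t. - ((k n t - k' t) + M t (y n t - y' t)))"
        by (rule ext) (simp add: L_def p_eq p'_def blinfun.diff_right)
      then show "norm (L2_norm (time T) (\<lambda>t. (F t - L (p n) t) - (F t - L p' t)))
        \<le> L2_norm (time T) (\<lambda>t. k n t - k' t) + K * L2_norm (time T) (\<lambda>t. y n t - y' t)"
        using L2_norm_triangle[OF kd K(2)[OF yd]] K(3)[OF yd] by (simp only: L2_norm_uminus) simp
    qed
  qed
  have "(\<lambda>n. (LINT t|time T. (F t - L (p n) t) \<bullet> (F t - L (p n) t)) + (norm (y0 - z n 0))\<^sup>2)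
      \<longlonglongrightarrow> (LINT t|time T. (F t - L p' t) \<bullet> (F t - L p' t)) + (norm (y0 - z' 0))\<^sup>2"
    by (intro tendsto_add L2_inner_tendsto2 tendsto_intros lim(3) FL p p' Llim)
  then have "(\<lambda>n. Q (p n)) \<longlonglongrightarrow> Q p'"
    by (simp add: Q_def L2_norm_square power2_norm_eq_inner Z_def p_eq p'_def)
  then have Qp': "Q p' = Inf (Q ` X)" using Qlim LIMSEQ_unique by blast
  have Qmin: "Q p' \<le> Q q" if "q \<in> X" for q
    unfolding Qp' by (rule cINF_lower) (use that bdd_belowI2[of X 0 Q] Q0 in auto)
  define G where "G = (\<lambda>t. F t - L p' t)"
  have GL: "G \<in> L2 (time T)" unfolding G_def by (rule FL[OF p'])
  \<comment> \<open>The first variation of \<open>Q\<close> at its minimizer in direction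
    \<open>q\<close>.\<close>
  have orth: "(LINT t|time T. G t \<bullet> L q t) + (y0 - Z p') \<bullet> Z q = 0" if q: "q \<in> X" for q
  proof -
    have "0 \<le> s * (- 2 * ((LINT t|time T. G t \<bullet> L q t) + (y0 - Z p') \<bullet> Z q))
        + s\<^sup>2 * ((L2_norm (time T) (L q))\<^sup>2 + (norm (Z q))\<^sup>2)" for s
    proof -
      obtain m where m: "m \<in> X" "L m = (\<lambda>t. 1 *\<^sub>R L p' t + s *\<^sub>R L q t)" "Z m = 1 *\<^sub>R Z p' + s *\<^sub>R Z q"
        using comb[OF p' q, of 1 s] by blast
      have "(\<lambda>t. F t - L m t) = (\<lambda>t. G t - s *\<^sub>R L q t)" by (rule ext) (simp add: m(2) G_def)
      then have "(L2_norm (time T) (\<lambda>t. F t - L m t))\<^sup>2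
          = (L2_norm (time T) G)\<^sup>2 - 2 * s * (LINT t|time T. G t \<bullet> L q t) + s\<^sup>2 * (L2_norm (time T) (L q))\<^sup>2"
        by (simp add: L2_norm_diff_square[OF GL L2_scaleR[OF LX[OF q]]] L2_norm_scaleR power_mult_distrib)
      moreover have "(norm (y0 - Z m))\<^sup>2 = (norm (y0 - Z p'))\<^sup>2 - 2 * s * ((y0 - Z p') \<bullet> Z q) + s\<^sup>2 * (norm (Z q))\<^sup>2"
      proof -
        have eq: "y0 - Z m = (y0 - Z p') - s *\<^sub>R Z q" by (simp add: m(3))
        have "(norm (d - s *\<^sub>R Z q))\<^sup>2 = (norm d)\<^sup>2 - 2 * s * (d \<bullet> Z q) + s\<^sup>2 * (norm (Z q))\<^sup>2" for d
          unfolding power2_norm_eq_inner inner_diff_left inner_diff_right inner_scaleR_left inner_scaleR_right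
            inner_commute[of "Z q" d]
          by (simp add: algebra_simps power2_eq_square)
        then show ?thesis unfolding eq .
      qed
      ultimately have "Q m = Q p' + s * (- 2 * ((LINT t|time T. G t \<bullet> L q t) + (y0 - Z p') \<bullet> Z q))
        + s\<^sup>2 * ((L2_norm (time T) (L q))\<^sup>2 + (norm (Z q))\<^sup>2)"
        unfolding Q_def G_def by (simp add: algebra_simps)
      with Qmin[OF m(1)] show ?thesis by linarith
    qed
    from linear_coeff_zero[OF this] show ?thesis by simp
  qed
  have "L2_norm (time T) G = 0"
  proof (rule parabolic_range_orthogonal[OF T M \<eta> coer GL])
    fix u :: "real \<Rightarrow> 'v" assume u: "u \<in> L2 (time T)"
    have "(\<lambda>t. LINT s|time t. u s, \<lambda>t. \<iota> (LINT s|time t. u s), \<lambda>t. adj \<iota> (\<iota> (u t))) \<in> X"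
      using weak_path_primitive[OF u] by (simp add: X_def)
    from orth[OF this] have "(LINT t|time T. G t \<bullet> (adj \<iota> (\<iota> (u t)) + M t (LINT s|time t. u s)))
        + (y0 - Z p') \<bullet> \<iota> (LINT s|time 0. u s) = 0" by (simp add: L_def Z_def)
    moreover have "(LINT s|time 0. u s) = 0"
      using Bochner_Integration.integral_cong[of "time 0" "time 0" u "\<lambda>_. 0"] by (simp add: space_restrict_space)
    ultimately show "(LINT t|time T. G t \<bullet> (adj \<iota> (\<iota> (u t)) + M t (LINT s|time t. u s))) = 0" by simp
  qed
  then have G0: "AE t in time T. G t = 0" by (rule L2_norm_eq_0_imp_AE[OF GL])
  \<comment> \<open>Constant paths take every initial value \<open>\<iota> v\<close>, and these are
    dense in H.\<close>
  have "y0 - Z p' = 0"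
  proof (rule closure_range_inner_zero[OF dense])
    fix v
    have "(\<lambda>t. v, \<lambda>t. \<iota> v, \<lambda>t. 0) \<in> X" using weak_path_const by (simp add: X_def)
    from orth[OF this] have "(LINT t|time T. G t \<bullet> M t v) + (y0 - Z p') \<bullet> \<iota> v = 0" by (simp add: L_def Z_def)
    moreover have "(LINT t|time T. G t \<bullet> M t v) = 0"
      by (rule integral_eq_zero_AE) (use G0 in eventually_elim, simp)
    ultimately show "(y0 - Z p') \<bullet> \<iota> v = 0" by simp
  qed
  moreover have "AE t in time T. k' t + M t (y' t) = F t"
    using G0 by eventually_elim (simp add: G_def L_def p'_def)
  ultimately show ?thesis using w' by (intro exI[of _ y'] exI[of _ z'] exI[of _ k']) (simp add: Z_def p'_def)
qed

end


subsection \<open>Equivalence with the distributional formulation\<close>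

text \<open>The classical flat function \<open>exp (- 1 / x)\<close>, extended by zero.
  Differentiation produces powers of \<open>1 / x\<close> in front of it, so they are carried along
  to make the family closed under derivatives.\<close>

definition flat :: "nat \<Rightarrow> real \<Rightarrow> real" where
  "flat k x = (if x > 0 then (1 / x) ^ k * exp (- (1 / x)) else 0)"

lemma flat_tendsto_0: "((\<lambda>x. flat k x / x) \<longlongrightarrow> 0) (at 0)"
proof -
  have "((\<lambda>x::real. (inverse x) ^ Suc k / exp (inverse x)) \<longlongrightarrow> 0) (at_right 0)"
    by (rule filterlim_compose[OF tendsto_power_div_exp_0 filterlim_inverse_at_top_right])
  then have r: "((\<lambda>x. flat k x / x) \<longlongrightarrow> 0) (at_right 0)"
  proof (rule Lim_transform_eventually)
    show "\<forall>\<^sub>F x in at_right (0::real). (inverse x) ^ Suc k / exp (inverse x) = flat k x / x"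
      using eventually_at_right_less[of 0]
      by eventually_elim (simp add: flat_def exp_minus divide_simps)
  qed
  have "\<forall>\<^sub>F x in at_left (0::real). x < 0" by (simp add: eventually_at_filter)
  then have "\<forall>\<^sub>F x in at_left (0::real). 0 = flat k x / x"
    by eventually_elim (simp add: flat_def)
  then have l: "((\<lambda>x. flat k x / x) \<longlongrightarrow> 0) (at_left 0)"
    by (rule Lim_transform_eventually[OF tendsto_const])
  from l r show ?thesis by (simp add: filterlim_split_at)
qed

text \<open>At 0 the difference quotient is \<open>flat k x / x\<close>, which tends to 0 because
  the exponential beats every power; elsewhere this is the product rule.\<close>

lemma flat_derivative: "(flat k has_real_derivative flat (k + 2) x - real k * flat (k + 1) x) (at x)"
proof -
  consider "x < 0" | "x = 0" | "x > 0" by linarith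
  then show ?thesis
  proof cases
    case 1
    have "((\<lambda>x. 0) has_real_derivative 0) (at x)" by simp
    then have "(flat k has_real_derivative 0) (at x)"
      by (rule has_field_derivative_transform_within_open[of _ _ _ "{..<0}"]) (use 1 in \<open>auto simp: flat_def\<close>)
    then show ?thesis using 1 by (simp add: flat_def)
  next
    case 2
    have "(flat k has_real_derivative 0) (at 0)"
      unfolding has_field_derivative_iff using flat_tendsto_0[of k] by (simp add: flat_def[of k 0])
    then show ?thesis using 2 by (simp add: flat_def)
  next
    case 3
    have "((\<lambda>x. (1 / x) ^ k * exp (- (1 / x))) has_real_derivative
        (1 / x) ^ (k + 2) * exp (- (1 / x)) - real k * ((1 / x) ^ (k + 1) * exp (- (1 / x)))) (at x)"
    proof -
      have inv: "((\<lambda>x. 1 / x) has_real_derivative - ((1 / x)\<^sup>2)) (at x)"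
        using 3 by (auto intro!: derivative_eq_intros simp: power2_eq_square)
      have "((\<lambda>x. exp (- (1 / x))) has_real_derivative exp (- (1 / x)) * (1 / x)\<^sup>2) (at x)"
        using DERIV_chain2[OF DERIV_exp DERIV_minus[OF inv]] by simp
      moreover have "((\<lambda>x. (1 / x) ^ k) has_real_derivative - (real k * (1 / x) ^ (k + 1))) (at x)"
      proof (cases k)
        case (Suc j)
        have "((\<lambda>x. (1 / x) ^ Suc j) has_real_derivative (1 + of_nat j) * (- ((1 / x)\<^sup>2) * (1 / x) ^ j)) (at x)"
          by (rule DERIV_power_Suc[OF inv])
        then show ?thesis unfolding Suc by (rule DERIV_cong) (simp add: power2_eq_square)
      qed simp
      ultimately show ?thesis
        by (rule DERIV_mult[rotated, THEN DERIV_cong]) (simp add: power2_eq_square algebra_simps)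
    qed
    then have "(flat k has_real_derivative
        (1 / x) ^ (k + 2) * exp (- (1 / x)) - real k * ((1 / x) ^ (k + 1) * exp (- (1 / x)))) (at x)"
      by (rule has_field_derivative_transform_within_open[of _ _ _ "{0<..}"]) (use 3 in \<open>auto simp: flat_def\<close>)
    then show ?thesis using 3 by (simp add: flat_def)
  qed
qed

text \<open>Closed under differentiation, so every member is infinitely differentiable.\<close>

inductive_set smooth_family :: "(real \<Rightarrow> real) set" where
  flat: "(\<lambda>t. flat k (a * t + b)) \<in> smooth_family"
| const: "(\<lambda>t. c) \<in> smooth_family"
| add: "f \<in> smooth_family \<Longrightarrow> g \<in> smooth_family \<Longrightarrow> (\<lambda>t. f t + g t) \<in> smooth_family"
| mult: "f \<in> smooth_family \<Longrightarrow> g \<in> smooth_family \<Longrightarrow> (\<lambda>t. f t * g t) \<in> smooth_family"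
| primitive: "f \<in> smooth_family \<Longrightarrow> (\<And>t. (F has_real_derivative f t) (at t)) \<Longrightarrow> F \<in> smooth_family"

lemma smooth_family_derivative:
  "f \<in> smooth_family \<Longrightarrow> \<exists>f'\<in>smooth_family. \<forall>t. (f has_real_derivative f' t) (at t)"
proof (induction rule: smooth_family.induct)
  case (flat k a b)
  have "((\<lambda>t. flat k (a * t + b)) has_real_derivative
      a * (flat (k + 2) (a * t + b) + - real k * flat (k + 1) (a * t + b))) (at t)" for t
    by (rule DERIV_cong[OF DERIV_chain2[OF flat_derivative]]) (auto intro!: derivative_eq_intros)
  then show ?case
    by (intro bexI[of _ "\<lambda>t. a * (flat (k + 2) (a * t + b) + - real k * flat (k + 1) (a * t + b))"]
          allI smooth_family.mult smooth_family.add smooth_family.const smooth_family.flat)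
next
  case (const c)
  then show ?case by (intro bexI[of _ "\<lambda>t. 0"]) (auto intro: smooth_family.const)
next
  case (add f g)
  then obtain f' g' where "f' \<in> smooth_family" "\<forall>t. (f has_real_derivative f' t) (at t)"
    "g' \<in> smooth_family" "\<forall>t. (g has_real_derivative g' t) (at t)" by blast
  then show ?case
    by (intro bexI[of _ "\<lambda>t. f' t + g' t"]) (auto intro!: derivative_eq_intros smooth_family.add)
next
  case (mult f g)
  then obtain f' g' where "f' \<in> smooth_family" "\<forall>t. (f has_real_derivative f' t) (at t)"
    "g' \<in> smooth_family" "\<forall>t. (g has_real_derivative g' t) (at t)" by blast
  with mult show ?case
    by (intro bexI[of _ "\<lambda>t. f' t * g t + f t * g' t"])
       (auto intro!: smooth_family.add smooth_family.mult DERIV_mult'[THEN DERIV_cong])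
next
  case (primitive f F)
  then show ?case by blast
qed

lemma smooth_family_differentiable:
  assumes "f \<in> smooth_family"
  shows "(deriv ^^ n) f \<in> smooth_family" "(deriv ^^ n) f differentiable at t"
proof -
  show *: "(deriv ^^ n) f \<in> smooth_family" for n
  proof (induction n)
    case (Suc n)
    then obtain f' where "f' \<in> smooth_family" "\<forall>t. ((deriv ^^ n) f has_real_derivative f' t) (at t)"
      using smooth_family_derivative by blast
    moreover from this have "deriv ((deriv ^^ n) f) = f'" by (auto intro: DERIV_imp_deriv)
    ultimately show ?case by simp
  qed (simp add: assms)
  show "(deriv ^^ n) f differentiable at t"
    using smooth_family_derivative[OF *[of n]] real_differentiable_def by blast
qed

text \<open>\<open>\<Phi>\<close> is the normalized primitive of a bump on [0,1], so that
  \<open>\<Phi> (n * (t - a))\<close> with large \<open>n\<close> climbs from 0 to 1 just to the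
  right of \<open>a\<close>. It is known only as an antiderivative, which is the reason for the rule
  \<open>primitive\<close> of \<open>smooth_family\<close>.\<close>

lemma smooth_step:
  obtains \<Phi> \<rho> :: "real \<Rightarrow> real" where "\<And>n a. (\<lambda>t. \<Phi> (n * (t - a))) \<in> smooth_family"
    "\<And>x. (\<Phi> has_real_derivative \<rho> x) (at x)" "continuous_on UNIV \<rho>" "\<And>x. 0 \<le> \<rho> x"
    "\<And>x. x \<notin> {0..1} \<Longrightarrow> \<rho> x = 0" "\<And>x. x \<le> 0 \<Longrightarrow> \<Phi> x = 0" "\<And>x. 1 \<le> x \<Longrightarrow> \<Phi> x = 1"
    "\<And>x. 0 \<le> \<Phi> x \<and> \<Phi> x \<le> 1"
proof -
  \<comment> \<open>The first factor vanishes for \<open>x \<le> 0\<close>, the second for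
    \<open>x \<ge> 1\<close>.\<close>
  define r where "r = (\<lambda>x. flat 0 (1 * x + 0) * flat 0 (- 1 * x + 1))"
  have rS: "(\<lambda>t. r (n * t + a)) \<in> smooth_family" for n a
  proof -
    have "(\<lambda>t. flat 0 (n * t + a) * flat 0 (- n * t + (1 - a))) \<in> smooth_family"
      by (intro smooth_family.mult smooth_family.flat)
    then show ?thesis by (simp add: r_def algebra_simps)
  qed
  have rc: "isCont r x" for x
  proof -
    have "(\<lambda>t. r (1 * t + 0)) \<in> smooth_family" by (rule rS)
    then obtain r' where "\<forall>t. (r has_real_derivative r' t) (at t)" using smooth_family_derivative by fastforce
    then show ?thesis using DERIV_isCont by blast
  qed
  have r0: "0 \<le> r x" "x \<notin> {0<..<1} \<Longrightarrow> r x = 0" "x \<in> {0<..<1} \<Longrightarrow> 0 < r x" for x by (auto simp: r_def flat_def)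
  obtain F where "\<forall>x::real. - \<infinity> < ereal x \<longrightarrow> ereal x < \<infinity> \<longrightarrow> (F has_vector_derivative r x) (at x)"
    using einterval_antiderivative[of "- \<infinity>" \<infinity> r] rc by auto
  then have F: "(F has_real_derivative r x) (at x)" for x
    by (simp add: has_real_derivative_iff_has_vector_derivative)
  have mono: "F x \<le> F y" if "x \<le> y" for x y
    by (rule DERIV_nonneg_imp_nondecreasing[OF that]) (use F r0(1) in blast)
  have lo: "F x = F 0" if "x \<le> 0" for x
  proof (cases "x < 0")
    case True
    obtain \<xi> where "x < \<xi>" "\<xi> < 0" "F 0 - F x = (0 - x) * r \<xi>" using MVT2[OF True, of F r] F by blast
    then show ?thesis using r0(2)[of \<xi>] by auto
  qed (use that in simp)
  have hi: "F x = F 1" if "1 \<le> x" for x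
  proof (cases "1 < x")
    case True
    obtain \<xi> where "1 < \<xi>" "\<xi> < x" "F x - F 1 = (x - 1) * r \<xi>" using MVT2[OF True, of F r] F by blast
    then show ?thesis using r0(2)[of \<xi>] by auto
  qed (use that in simp)
  \<comment> \<open>The total mass of the bump, positive by the mean value theorem.\<close>
  define c where "c = F 1 - F 0"
  have c: "c > 0"
  proof -
    obtain \<xi> where "0 < \<xi>" "\<xi> < 1" "F 1 - F 0 = (1 - 0) * r \<xi>" using MVT2[of 0 1 F r] F by auto
    then show ?thesis using r0(3)[of \<xi>] by (simp add: c_def)
  qed
  show thesis
  proof (rule that[of "\<lambda>x. (F x - F 0) / c" "\<lambda>x. r x / c"])
    show D: "((\<lambda>x. (F x - F 0) / c) has_real_derivative r x / c) (at x)" for x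
    proof -
      have "((\<lambda>x. F x - F 0) has_real_derivative r x) (at x)"
        using DERIV_diff[OF F[of x] DERIV_const[of "F 0"]] by simp
      then show ?thesis by (rule DERIV_cdivide)
    qed
    show "(\<lambda>t. (F (n * (t - a)) - F 0) / c) \<in> smooth_family" for n a
    proof (rule smooth_family.primitive)
      show "(\<lambda>t. n / c * r (n * t + - n * a)) \<in> smooth_family"
        by (intro smooth_family.mult smooth_family.const rS)
      show "((\<lambda>t. (F (n * (t - a)) - F 0) / c) has_real_derivative n / c * r (n * t + - n * a)) (at t)" for t
      proof -
        have "((\<lambda>t. n * (t - a)) has_real_derivative n) (at t)" by (auto intro!: derivative_eq_intros)
        from DERIV_chain2[OF D this] show ?thesis by (simp add: algebra_simps)
      qed
    qed
    show "continuous_on UNIV (\<lambda>x. r x / c)"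
      using rc c by (auto intro!: continuous_at_imp_continuous_on continuous_intros)
    show "0 \<le> r x / c" for x using r0(1) c by simp
    show "x \<notin> {0..1} \<Longrightarrow> r x / c = 0" for x using r0(2)[of x] by auto
    show "x \<le> 0 \<Longrightarrow> (F x - F 0) / c = 0" for x using lo[of x] by simp
    show "1 \<le> x \<Longrightarrow> (F x - F 0) / c = 1" for x using hi[of x] c by (simp add: c_def)
    show "0 \<le> (F x - F 0) / c \<and> (F x - F 0) / c \<le> 1" for x
    proof -
      have "F 0 \<le> F x" using mono[of 0 x] lo[of x] by linarith
      moreover have "F x \<le> F 1" using mono[of x 1] hi[of x] by linarith
      ultimately show ?thesis using c by (simp add: c_def divide_le_eq)
    qed
  qed
qed

lemma integral_time_FTC:
  fixes f F :: "real \<Rightarrow> real"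
  assumes "0 \<le> t" "\<And>x. (F has_real_derivative f x) (at x)" "continuous_on UNIV f"
  shows "(LINT s|time t. f s) = F t - F 0"
proof -
  have fm: "f \<in> borel_measurable borel" by (rule borel_measurable_continuous_onI[OF assms(3)])
  have "(LINT s|time t. f s) = (LINT s|lborel. indicator {0<..<t} s *\<^sub>R f s)" by (rule integral_time_borel(1)[OF fm])
  also have "\<dots> = (LINT s|lborel. f s * indicator {0..t} s)"
  proof (rule integral_cong_AE)
    show "AE s in lborel. indicator {0<..<t} s *\<^sub>R f s = f s * indicator {0..t} s"
      using AE_lborel_singleton[of 0] AE_lborel_singleton[of t]
      by eventually_elim (auto simp: indicator_def)
  qed (use fm in simp_all)
  also have "\<dots> = F t - F 0"
    by (rule integral_FTC_Icc_real[OF assms(1)]) (use assms(2,3) in \<open>auto simp: continuous_on_eq_continuous_at\<close>)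
  finally show ?thesis .
qed

lemma test_function_derivative:
  assumes "\<phi> \<in> test_functions T"
  shows "(\<phi> has_real_derivative deriv \<phi> t) (at t)" "continuous_on UNIV (deriv \<phi>)"
proof -
  have d: "(deriv ^^ n) \<phi> differentiable at t" for n t using assms by (simp add: test_functions_def)
  have "\<phi> differentiable at t" using d[of 0] by simp
  then show "(\<phi> has_real_derivative deriv \<phi> t) (at t)"
    by (metis DERIV_deriv_iff_real_differentiable)
  have "deriv \<phi> differentiable at t" for t using d[of 1] by simp
  then show "continuous_on UNIV (deriv \<phi>)"
    by (intro continuous_at_imp_continuous_on ballI differentiable_imp_continuous_within)
qed

text \<open>An approximate identity: the kernels are nonnegative, have mass one for large
  \<open>n\<close> and live on an interval of length \<open>1 / n\<close> to the right of
  \<open>a\<close>, where \<open>g\<close> is close to \<open>g a\<close>.\<close>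

lemma smooth_step_concentrates:
  fixes g :: "real \<Rightarrow> real"
  assumes D: "\<And>x. (\<Phi> has_real_derivative \<rho> x) (at x)" and c: "continuous_on UNIV \<rho>" and pos: "\<And>x. 0 \<le> \<rho> x"
    and supp: "\<And>x. x \<notin> {0..1} \<Longrightarrow> \<rho> x = 0" and lo: "\<And>x. x \<le> 0 \<Longrightarrow> \<Phi> x = 0" and hi: "\<And>x. 1 \<le> x \<Longrightarrow> \<Phi> x = 1"
    and g: "continuous_on {0..T} g" and a: "0 < a" "a < T"
  shows "(\<lambda>n. LINT t|time T. real n * \<rho> (real n * (t - a)) * g t) \<longlonglongrightarrow> g a"
proof (rule LIMSEQ_I)
  fix e :: real assume e: "e > 0"
  obtain d where d: "d > 0" "\<And>t. t \<in> {0..T} \<Longrightarrow> dist t a < d \<Longrightarrow> dist (g t) (g a) < e / 2"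
    using g[unfolded continuous_on_iff, rule_format, of a "e / 2"] a e by auto
  \<comment> \<open>Including \<open>T - a\<close> in the minimum keeps the support of the kernel
    inside the time interval, so that its mass there is one.\<close>
  define d' where "d' = min d (T - a)"
  have d': "d' > 0" using d a by (simp add: d'_def)
  obtain N :: nat where N: "N > 0" "1 / real N < d'" using real_arch_inverse[of d'] d' by (auto simp: inverse_eq_divide)
  show "\<exists>N. \<forall>n\<ge>N. norm ((LINT t|time T. real n * \<rho> (real n * (t - a)) * g t) - g a) < e"
  proof (intro exI allI impI)
    fix n assume n: "n \<ge> N"
    define r where "r = (\<lambda>t. real n * \<rho> (real n * (t - a)))"
    have n0: "real n > 0" using n N by simp
    have "1 / real n \<le> 1 / real N" using n N by (simp add: frac_le)
    then have nd: "1 / real n < d'" using N by simp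
    have rc: "continuous_on UNIV r" unfolding r_def
      by (intro continuous_intros continuous_on_compose2[OF c]) auto
    have rL: "r \<in> L2 (time T)" by (rule L2_time_continuous[OF continuous_on_subset[OF rc]]) simp
    have gL: "g \<in> L2 (time T)" by (rule L2_time_continuous[OF g])
    have int1: "(LINT t|time T. r t) = 1"
    proof -
      have "((\<lambda>t. \<Phi> (real n * (t - a))) has_real_derivative r t) (at t)" for t
      proof -
        have "((\<lambda>t. real n * (t - a)) has_real_derivative real n) (at t)" by (auto intro!: derivative_eq_intros)
        from DERIV_chain2[OF D this] show ?thesis by (simp add: r_def mult.commute)
      qed
      then have "(LINT t|time T. r t) = \<Phi> (real n * (T - a)) - \<Phi> (real n * (0 - a))"
        using a by (intro integral_time_FTC rc) auto
      also have "\<Phi> (real n * (0 - a)) = 0" using a n0 by (intro lo) (simp add: mult_nonneg_nonpos)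
      also have "\<Phi> (real n * (T - a)) = 1"
      proof (rule hi)
        have "1 / real n < T - a" using nd by (simp add: d'_def)
        then show "1 \<le> real n * (T - a)" using n0 by (simp add: field_simps)
      qed
      finally show ?thesis by simp
    qed
    have ri: "integrable (time T) r" by (rule L2_imp_integrable[OF finite_measure_time rL])
    have rgi: "integrable (time T) (\<lambda>t. r t * g t)" using L2_inner_integrable[OF rL gL] by simp
    have "(LINT t|time T. r t * g t) - g a = (LINT t|time T. r t * g t - r t * g a)"
      using ri rgi int1 by simp
    also have "norm \<dots> \<le> (LINT t|time T. r t * (e / 2))"
    proof (rule integral_abs_bound[THEN order_trans, unfolded real_norm_def[symmetric]], rule integral_mono)
      fix t assume "t \<in> space (time T)"
      then have t: "t \<in> {0..T}" by (simp add: space_restrict_space)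
      show "norm (r t * g t - r t * g a) \<le> r t * (e / 2)"
      proof (cases "real n * (t - a) \<in> {0..1}")
        case True
        then have "0 \<le> t - a" "t - a \<le> 1 / real n" using n0 by (auto simp: zero_le_mult_iff field_simps)
        then have "dist t a < d" using nd by (simp add: dist_real_def d'_def)
        then have "\<bar>g t - g a\<bar> \<le> e / 2" using d(2)[OF t] by (simp add: dist_real_def)
        moreover have "0 \<le> r t" using pos by (simp add: r_def)
        ultimately have "r t * \<bar>g t - g a\<bar> \<le> r t * (e / 2)" by (intro mult_left_mono)
        then show ?thesis using \<open>0 \<le> r t\<close> by (simp add: abs_mult flip: right_diff_distrib)
      next
        case False
        then show ?thesis using supp by (simp add: r_def)
      qed
    qed (use ri rgi in simp_all)
    also have "\<dots> = e / 2" using int1 by simp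
    finally show "norm ((LINT t|time T. real n * \<rho> (real n * (t - a)) * g t) - g a) < e"
      using e by (simp add: r_def)
  qed
qed

section \<open>Passage between test functions and the integrated weak derivative\<close>

context
  fixes \<iota> :: "'v::{real_inner, banach, second_countable_topology} \<Rightarrow>\<^sub>L
    'h::{real_inner, banach, second_countable_topology}"
begin

text \<open>A test function times \<open>v\<close> is itself a weak path, namely the primitive of
  \<open>deriv \<phi> t *\<^sub>R v\<close>, and it vanishes at both ends. Integration by parts
  against it is the distributional identity.\<close>

lemma weak_path_imp_W:
  assumes T: "T > 0" and w: "weak_path T \<iota> y z k"
  shows "has_W_derivative T \<iota> y (\<lambda>t. riesz (k t))"
  unfolding has_W_derivative_def Ltwo_eq_L2
proof (intro conjI ballI allI)
  show "y \<in> L2 (time T)" by (rule weak_pathD(1)[OF w])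
  have k: "k \<in> L2 (time T)" by (rule weak_pathD(2)[OF w])
  obtain K where K: "\<And>x::'v. norm (riesz x) \<le> norm x * K"
    using bounded_linear.bounded[OF bounded_linear_riesz] by blast
  show "(\<lambda>t. riesz (k t)) \<in> L2 (time T)"
  proof (rule L2_bounded[OF k, where K = K])
    show "(\<lambda>t. riesz (k t)) \<in> borel_measurable (time T)"
      using linear_continuous_on[OF bounded_linear_riesz] L2_measurable[OF k]
      by (rule borel_measurable_continuous_on)
  qed (use K in \<open>simp add: mult.commute\<close>)
  fix \<phi> and v :: 'v assume \<phi>: "\<phi> \<in> test_functions T"
  note D = test_function_derivative[OF \<phi>]
  define u where "u = (\<lambda>t. deriv \<phi> t *\<^sub>R v)"
  have u: "u \<in> L2 (time T)"
    unfolding u_def by (intro L2_time_continuous continuous_intros continuous_on_subset[OF D(2)]) simp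
  obtain a b where ab: "0 < a" "b < T" "\<And>t. t \<notin> {a..b} \<Longrightarrow> \<phi> t = 0"
    using \<phi> by (auto simp: test_functions_def)
  have \<phi>0: "\<phi> 0 = 0" "\<phi> T = 0" using ab by auto
  have prim: "(LINT s|time t. u s) = \<phi> t *\<^sub>R v" if "0 \<le> t" for t
  proof -
    have i: "integrable (time t) (deriv \<phi>)"
      by (intro L2_imp_integrable[OF finite_measure_time] L2_time_continuous continuous_on_subset[OF D(2)]) simp
    have "(LINT s|time t. u s) = (LINT s|time t. deriv \<phi> s) *\<^sub>R v"
      unfolding u_def by (rule integral_scaleR_left) (use i in simp)
    also have "(LINT s|time t. deriv \<phi> s) = \<phi> t" using integral_time_FTC[OF that D] \<phi>0 by simp
    finally show ?thesis .
  qed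
  have T0: "(LINT s|time 0. u s) = 0" "(LINT s|time T. u s) = 0" using prim[of 0] prim[of T] \<phi>0 T by simp_all
  have "(LINT t|time T. k t \<bullet> (LINT s|time t. u s)) + (LINT t|time T. adj \<iota> (\<iota> (u t)) \<bullet> y t) = 0"
    using weak_path_integration_by_parts[OF w weak_path_primitive[OF u] T] by (simp add: T0)
  moreover have "(LINT t|time T. k t \<bullet> (LINT s|time t. u s)) = (LINT t|time T. \<phi> t * riesz (k t) v)"
    by (rule Bochner_Integration.integral_cong) (auto simp: prim space_restrict_space)
  moreover have "(LINT t|time T. adj \<iota> (\<iota> (u t)) \<bullet> y t) = (LINT t|time T. deriv \<phi> t * to_dual \<iota> (\<iota> (y t)) v)"
    by (rule Bochner_Integration.integral_cong)
       (auto simp: u_def to_dual_eq inner_adj blinfun.scaleR_right inner_commute[of "\<iota> v"])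
  ultimately show "(LINT t|time T. deriv \<phi> t * to_dual \<iota> (\<iota> (y t)) v) = - (LINT t|time T. \<phi> t * riesz (k t) v)"
    by linarith
qed

lemma weak_path_imp_value_at:
  assumes "weak_path T \<iota> y z k"
  shows "has_value_at T \<iota> y s (z s)"
  unfolding has_value_at_def using weak_pathD(3,4)[OF assms] by blast

text \<open>Smooth approximations of the indicator of an interval, used as test functions, turn the
  distributional identity into the increment formula at interior times; continuity extends it to the
  endpoints. The representative \<open>z\<close> is an argument because \<open>has_value_at\<close>
  supplies it separately from the derivative.\<close>

lemma W_imp_weak_path:
  assumes T: "T > 0" and W: "has_W_derivative T \<iota> y y'"
    and z: "continuous_on {0..T} z" "AE t in time T. \<iota> (y t) = z t"
  shows "weak_path T \<iota> y z (\<lambda>t. inv riesz (y' t))"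
proof -
  define k where "k = (\<lambda>t. inv riesz (y' t) :: 'v)"
  have y: "y \<in> L2 (time T)" and y': "y' \<in> L2 (time T)" using W by (auto simp: has_W_derivative_def Ltwo_eq_L2)
  obtain K where K: "\<And>x::'v \<Rightarrow>\<^sub>L real. norm (inv riesz x) \<le> norm x * K"
    using bounded_linear.bounded[OF bounded_linear_inv_riesz] by blast
  have k: "k \<in> L2 (time T)"
    unfolding k_def
  proof (rule L2_bounded[OF y', where K = K])
    show "(\<lambda>t. inv riesz (y' t)) \<in> borel_measurable (time T)"
      using linear_continuous_on[OF bounded_linear_inv_riesz] L2_measurable[OF y']
      by (rule borel_measurable_continuous_on)
  qed (use K in \<open>simp add: mult.commute\<close>)
  obtain \<Phi> \<rho> :: "real \<Rightarrow> real" where step: "\<And>n a. (\<lambda>t. \<Phi> (n * (t - a))) \<in> smooth_family"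
    and D: "\<And>x. (\<Phi> has_real_derivative \<rho> x) (at x)" and c: "continuous_on UNIV \<rho>" and pos: "\<And>x. 0 \<le> \<rho> x"
    and supp: "\<And>x. x \<notin> {0..1} \<Longrightarrow> \<rho> x = 0" and lo: "\<And>x. x \<le> 0 \<Longrightarrow> \<Phi> x = 0" and hi: "\<And>x. 1 \<le> x \<Longrightarrow> \<Phi> x = 1"
    and range: "\<And>x. 0 \<le> \<Phi> x \<and> \<Phi> x \<le> 1"
    using smooth_step by blast
  have \<Phi>c: "continuous_on UNIV \<Phi>" using D DERIV_isCont by (intro continuous_at_imp_continuous_on) blast
  have incr: "z b \<bullet> \<iota> v - z a \<bullet> \<iota> v = (LINT s|time b. k s \<bullet> v) - (LINT s|time a. k s \<bullet> v)"
    if ab: "0 < a" "a < b" "b < T" for a b v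
  proof -
    define g where "g = (\<lambda>t. z t \<bullet> \<iota> v)"
    have gc: "continuous_on {0..T} g" unfolding g_def by (intro continuous_intros z(1))
    have gL: "g \<in> L2 (time T)" by (rule L2_time_continuous[OF gc])
    have kv: "(\<lambda>s. k s \<bullet> v) \<in> borel_measurable (time T)" using L2_measurable[OF k] by measurable
    \<comment> \<open>Rises at \<open>a\<close> and falls at \<open>b\<close>. The form with the
      factor \<open>- 1\<close> matches the rules of \<open>smooth_family\<close>, which has sums,
      products and constants.\<close>
    define \<phi> where "\<phi> = (\<lambda>n::nat. \<lambda>t. \<Phi> (real n * (t - a)) + - 1 * \<Phi> (real n * (t - b)))"
    define d\<phi> where "d\<phi> = (\<lambda>n::nat. \<lambda>t. real n * \<rho> (real n * (t - a)) - real n * \<rho> (real n * (t - b)))"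
    have D\<phi>: "(\<phi> n has_real_derivative d\<phi> n t) (at t)" for n t
    proof -
      have "((\<lambda>t. \<Phi> (real n * (t - c))) has_real_derivative real n * \<rho> (real n * (t - c))) (at t)" for c
      proof -
        have "((\<lambda>t. real n * (t - c)) has_real_derivative real n) (at t)" by (auto intro!: derivative_eq_intros)
        from DERIV_chain2[OF D this] show ?thesis by (simp add: mult.commute)
      qed
      from DERIV_diff[OF this[of a] this[of b]] show ?thesis by (simp add: \<phi>_def d\<phi>_def)
    qed
    have \<rho>L: "(\<lambda>t. real n * \<rho> (real n * (t - c))) \<in> L2 (time T)" for n c
      by (intro L2_time_continuous continuous_intros continuous_on_compose2[OF c]) auto
    \<comment> \<open>From \<open>N\<close> on the support, which reaches up to
      \<open>b + 1 / n\<close>, is a compact part of (0,T).\<close>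
    obtain N :: nat where N: "N > 0" "1 / real N < T - b"
      using real_arch_inverse[of "T - b"] ab by (auto simp: inverse_eq_divide)
    have test: "\<phi> n \<in> test_functions T" if "n \<ge> N" for n
    proof -
      have n0: "real n > 0" "1 / real n \<le> 1 / real N" using that N by (auto simp: frac_le)
      have "\<phi> n \<in> smooth_family" 
        unfolding \<phi>_def by (intro smooth_family.add smooth_family.mult smooth_family.const step)
      moreover have "\<phi> n t = 0" if "t \<notin> {a..b + 1 / real n}" for t
      proof (cases "t < a")
        case True
        then have "real n * (t - a) \<le> 0" "real n * (t - b) \<le> 0" using n0 ab by (auto simp: mult_le_0_iff)
        then show ?thesis by (simp add: \<phi>_def lo)
      next
        case False
        then have "1 / real n < t - b" using that by auto
        then have 1: "1 \<le> real n * (t - b)" using n0(1) by (simp add: field_simps)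
        also have "\<dots> \<le> real n * (t - a)" using n0(1) ab by (intro mult_left_mono) auto
        finally have "1 \<le> real n * (t - a)" .
        with 1 show ?thesis by (simp add: \<phi>_def hi)
      qed
      moreover have "b + 1 / real n < T" using n0 N by linarith
      ultimately show ?thesis
        unfolding test_functions_def using smooth_family_differentiable(2) ab(1) by blast
    qed
    have eq: "(LINT t|time T. real n * \<rho> (real n * (t - a)) * g t) - (LINT t|time T. real n * \<rho> (real n * (t - b)) * g t)
        = - (LINT t|time T. \<phi> n t * (k t \<bullet> v))" if "n \<ge> N" for n
    proof -
      have "(LINT t|time T. real n * \<rho> (real n * (t - a)) * g t) - (LINT t|time T. real n * \<rho> (real n * (t - b)) * g t)
          = (LINT t|time T. d\<phi> n t * g t)"
        using L2_inner_integrable[OF \<rho>L gL] by (simp add: d\<phi>_def left_diff_distrib)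
      also have "\<dots> = (LINT t|time T. deriv (\<phi> n) t * to_dual \<iota> (\<iota> (y t)) v)"
      proof (rule integral_cong_AE)
        show "AE t in time T. d\<phi> n t * g t = deriv (\<phi> n) t * to_dual \<iota> (\<iota> (y t)) v"
          using z(2) by eventually_elim (simp add: DERIV_imp_deriv[OF D\<phi>] g_def to_dual_eq inner_adj)
        have "d\<phi> n \<in> L2 (time T)" unfolding d\<phi>_def by (rule L2_diff[OF \<rho>L \<rho>L])
        then show "(\<lambda>t. d\<phi> n t * g t) \<in> borel_measurable (time T)"
          using L2_inner_measurable[OF _ gL, of "d\<phi> n"] by simp
        have "(\<lambda>t. (\<iota> (y t)) \<bullet> \<iota> v) \<in> borel_measurable (time T)"
          using L2_measurable[OF L2_blinfun[OF y, of \<iota>]] by measurable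
        then show "(\<lambda>t. deriv (\<phi> n) t * to_dual \<iota> (\<iota> (y t)) v) \<in> borel_measurable (time T)"
          using L2_measurable[OF \<open>d\<phi> n \<in> L2 (time T)\<close>] by (simp add: DERIV_imp_deriv[OF D\<phi>] to_dual_eq inner_adj)
      qed
      also have "\<dots> = - (LINT t|time T. \<phi> n t * y' t v)"
        using W test[OF that] by (simp add: has_W_derivative_def)
      finally show ?thesis by (simp add: k_def)
    qed
    have lhs: "(\<lambda>n. (LINT t|time T. real n * \<rho> (real n * (t - a)) * g t) - (LINT t|time T. real n * \<rho> (real n * (t - b)) * g t))
        \<longlonglongrightarrow> g a - g b"
      using ab by (intro tendsto_diff smooth_step_concentrates[OF D c pos supp lo hi gc]) auto
    have kvi: "integrable (time T) (\<lambda>s. k s \<bullet> v)" by (rule L2_inner_const_integrable[OF k])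
    have "(\<lambda>n. LINT t|time T. \<phi> n t * (k t \<bullet> v)) \<longlonglongrightarrow> (LINT t|time T. indicator {a<..b} t * (k t \<bullet> v))"
    proof (rule integral_dominated_convergence[where w = "\<lambda>t. norm (k t \<bullet> v)"])
      show "(\<lambda>t. indicator {a<..b} t * (k t \<bullet> v)) \<in> borel_measurable (time T)"
        by (intro borel_measurable_times kv borel_measurable_time_borel) simp
      have "continuous_on UNIV (\<phi> n)" for n
        unfolding \<phi>_def by (intro continuous_intros continuous_on_compose2[OF \<Phi>c]) auto
      then show "(\<lambda>t. \<phi> n t * (k t \<bullet> v)) \<in> borel_measurable (time T)" for n
        by (intro borel_measurable_times kv borel_measurable_time_borel borel_measurable_continuous_onI)
      show "integrable (time T) (\<lambda>t. norm (k t \<bullet> v))" using kvi by simp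
      \<comment> \<open>At \<open>t = c\<close> the value is \<open>\<Phi> 0 = 0\<close> for every
        \<open>n\<close>; hence the half-open interval in the limit.\<close>
      have lim: "(\<lambda>n. \<Phi> (real n * (t - c))) \<longlonglongrightarrow> indicator {c<..} t" for t c
      proof (cases "c < t")
        case True
        obtain N :: nat where N: "N > 0" "1 / real N < t - c"
          using real_arch_inverse[of "t - c"] True by (auto simp: inverse_eq_divide)
        have "\<forall>\<^sub>F n in sequentially. \<Phi> (real n * (t - c)) = 1"
          using eventually_ge_at_top[of N]
        proof eventually_elim
          case (elim n)
          have "1 < real N * (t - c)" using N by (simp add: field_simps)
          also have "\<dots> \<le> real n * (t - c)" using elim True by (intro mult_right_mono) auto
          finally show ?case by (intro hi) simp
        qed
        then show ?thesis using True by (simp add: tendsto_eventually)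
      next
        case False
        then have "real n * (t - c) \<le> 0" for n by (simp add: mult_nonneg_nonpos)
        then show ?thesis using False by (simp add: lo)
      qed
      have "(\<lambda>n. \<phi> n t * (k t \<bullet> v)) \<longlonglongrightarrow> indicator {a<..b} t * (k t \<bullet> v)" for t
      proof -
        have "\<phi> = (\<lambda>n t. \<Phi> (real n * (t - a)) - \<Phi> (real n * (t - b)))" by (simp add: \<phi>_def)
        moreover have "indicator {a<..b} t = indicator {a<..} t - (indicator {b<..} t :: real)"
          using ab by (auto simp: indicator_def)
        ultimately show ?thesis by (simp only:) (intro tendsto_intros lim)
      qed
      then show "AE t in time T. (\<lambda>n. \<phi> n t * (k t \<bullet> v)) \<longlonglongrightarrow> indicator {a<..b} t * (k t \<bullet> v)" by simp
      have "\<bar>\<phi> n t\<bar> \<le> 1" for n t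
        using range[of "real n * (t - a)"] range[of "real n * (t - b)"] by (simp add: \<phi>_def abs_le_iff)
      then show "AE t in time T. norm (\<phi> n t * (k t \<bullet> v)) \<le> norm (k t \<bullet> v)" for n
        by (auto simp: abs_mult intro!: mult_left_le_one_le)
    qed
    then have "(\<lambda>n. - (LINT t|time T. \<phi> n t * (k t \<bullet> v))) \<longlonglongrightarrow> - (LINT t|time T. indicator {a<..b} t * (k t \<bullet> v))"
      by (rule tendsto_minus)
    then have "(\<lambda>n. (LINT t|time T. real n * \<rho> (real n * (t - a)) * g t) - (LINT t|time T. real n * \<rho> (real n * (t - b)) * g t))
        \<longlonglongrightarrow> - (LINT t|time T. indicator {a<..b} t * (k t \<bullet> v))"
    proof (rule Lim_transform_eventually)
      show "\<forall>\<^sub>F n in sequentially. - (LINT t|time T. \<phi> n t * (k t \<bullet> v))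
          = (LINT t|time T. real n * \<rho> (real n * (t - a)) * g t) - (LINT t|time T. real n * \<rho> (real n * (t - b)) * g t)"
        using eventually_ge_at_top[of N] by eventually_elim (use eq in simp)
    qed
    with lhs have "g a - g b = - (LINT t|time T. indicator {a<..b} t * (k t \<bullet> v))" by (rule LIMSEQ_unique)
    moreover have "(LINT t|time T. indicator {a<..b} t * (k t \<bullet> v)) = (LINT s|time b. k s \<bullet> v) - (LINT s|time a. k s \<bullet> v)"
    proof -
      have r: "(LINT s|time c. k s \<bullet> v) = (LINT s|time T. indicator {0<..<c} s *\<^sub>R (k s \<bullet> v))"
        and i: "integrable (time T) (\<lambda>s. indicator {0<..<c} s *\<^sub>R (k s \<bullet> v))" if "c \<le> T" for c
      proof -
        have "integrable (restrict_space (time T) {0<..<c}) (\<lambda>s. k s \<bullet> v)"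
          using L2_inner_const_integrable[OF L2_time_mono(1)[OF that k]] unfolding time_restrict[OF that] .
        then show "integrable (time T) (\<lambda>s. indicator {0<..<c} s *\<^sub>R (k s \<bullet> v))"
          by (subst (asm) integrable_restrict_space[OF sets_time_initial])
        show "(LINT s|time c. k s \<bullet> v) = (LINT s|time T. indicator {0<..<c} s *\<^sub>R (k s \<bullet> v))"
          unfolding time_restrict[OF that] by (rule integral_restrict_space[OF sets_time_initial])
      qed
      have "(LINT s|time b. k s \<bullet> v) - (LINT s|time a. k s \<bullet> v)
          = (LINT s|time T. indicator {0<..<b} s *\<^sub>R (k s \<bullet> v) - indicator {0<..<a} s *\<^sub>R (k s \<bullet> v))"
        using r[of a] r[of b] i[of a] i[of b] ab by simp
      also have "\<dots> = (LINT t|time T. indicator {a<..b} t * (k t \<bullet> v))"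
      proof (rule integral_cong_AE)
        have "AE t in lborel. t \<noteq> a \<and> t \<noteq> b"
          using AE_lborel_singleton[of a] AE_lborel_singleton[of b] by eventually_elim simp
        then have "AE t in lebesgue. t \<noteq> a \<and> t \<noteq> b" by (rule AE_completion)
        then have "AE t in lebesgue. t \<in> {0<..<T} \<longrightarrow> t \<noteq> a \<and> t \<noteq> b" by eventually_elim simp
        then have "AE t in time T. t \<noteq> a \<and> t \<noteq> b" by (subst AE_restrict_space_iff) auto
        moreover have "AE t in time T. t \<in> {0<..<T}" by (rule AE_I2) (simp add: space_restrict_space)
        ultimately show "AE s in time T. indicator {0<..<b} s *\<^sub>R (k s \<bullet> v) - indicator {0<..<a} s *\<^sub>R (k s \<bullet> v)
            = indicator {a<..b} s * (k s \<bullet> v)"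
          by eventually_elim (use ab in \<open>auto simp: indicator_def\<close>)
        show "(\<lambda>s. indicator {0<..<b} s *\<^sub>R (k s \<bullet> v) - indicator {0<..<a} s *\<^sub>R (k s \<bullet> v)) \<in> borel_measurable (time T)"
          using i[of a] i[of b] ab by auto
        show "(\<lambda>t. indicator {a<..b} t * (k t \<bullet> v)) \<in> borel_measurable (time T)"
          by (intro borel_measurable_times kv borel_measurable_time_borel) simp
      qed
      finally show ?thesis ..
    qed
    ultimately show ?thesis by (simp add: g_def)
  qed
  have "z t \<bullet> \<iota> v = z 0 \<bullet> \<iota> v + (LINT s|time t. k s \<bullet> v)" if t: "t \<in> {0..T}" for t v
  proof -
    \<comment> \<open>The increment formula says that \<open>f\<close> is constant on the open
      interval. Being continuous, it is constant on [0,T]; the midpoint \<open>T / 2\<close> serves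
      as reference.\<close>
    define f where "f = (\<lambda>t. z t \<bullet> \<iota> v - (LINT s|time t. k s \<bullet> v))"
    have "(\<lambda>s. k s \<bullet> v) \<in> L2 (time T)"
    proof (rule L2_bounded[OF k, where K = "norm v"])
      show "(\<lambda>s. k s \<bullet> v) \<in> borel_measurable (time T)" using L2_measurable[OF k] by measurable
    qed (use Cauchy_Schwarz_ineq2[of _ v] in \<open>simp add: mult.commute[of "norm v"]\<close>)
    then have fc: "continuous_on {0..T} f" unfolding f_def
      by (intro continuous_intros z(1) primitive_continuous)
    have mid: "f s = f (T / 2)" if s: "s \<in> {0<..<T}" for s
    proof (cases "s = T / 2")
      case False
      then show ?thesis
        using incr[of s "T / 2" v] incr[of "T / 2" s v] s by (cases "s < T / 2") (simp_all add: f_def)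
    next
      case True
      then show ?thesis by (rule arg_cong)
    qed
    have cl: "closure {0<..<T} = {0..T}" using T by simp
    have *: "f s = f (T / 2)" if "s \<in> {0..T}" for s
      by (rule continuous_constant_on_closure[of "{0<..<T}" f, unfolded cl, OF fc mid that])
    have "f t = f 0" using *[OF t] *[of 0] T by (metis atLeastAtMost_iff less_imp_le order_refl)
    moreover have "(LINT s|time 0. k s \<bullet> v) = 0"
      using Bochner_Integration.integral_cong[of "time 0" "time 0" "\<lambda>s. k s \<bullet> v" "\<lambda>_. 0"] by (simp add: space_restrict_space)
    ultimately show ?thesis by (simp add: f_def)
  qed
  from weak_pathI[OF y k z this] show ?thesis unfolding k_def .
qed

end


subsection \<open>The reduced control problem\<close>

lemma measurable_reflect_time: "(\<lambda>t. T - t) \<in> measurable (time T) (time T)"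
proof -
  have "(\<lambda>t::real. T + (- 1) * t) \<in> lebesgue \<rightarrow>\<^sub>M lebesgue"
    using lebesgue_affine_measurable[where c = "\<lambda>x::real. - 1" and t = T] by simp
  then have "(\<lambda>t. T - t) \<in> lebesgue \<rightarrow>\<^sub>M lebesgue" by simp
  then show ?thesis
    by (intro measurable_restrict_space2 measurable_restrict_space1) (auto simp: space_restrict_space)
qed

lemma AE_reflect_time:
  assumes "AE t in time T. P t"
  shows "AE t in time T. P (T - t)"
proof -
  have "AE t in lebesgue. t \<in> {0<..<T} \<longrightarrow> P t" using assms by (subst (asm) AE_restrict_space_iff) auto
  then have "AE t in lborel. t \<in> {0<..<T} \<longrightarrow> P t" by (simp only: AE_completion_iff)
  then obtain N where N: "N \<in> null_sets lborel" "{t \<in> space lborel. \<not> (t \<in> {0<..<T} \<longrightarrow> P t)} \<subseteq> N"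
    unfolding eventually_ae_filter by blast
  have "AE t in lborel. T + (- 1) * t \<notin> N"
    using N(1) AE_not_in[OF N(1)] by (intro AE_borel_affine) (auto simp: pred_def)
  then have "AE t in lborel. t \<in> {0<..<T} \<longrightarrow> P (T - t)"
  proof eventually_elim
    case (elim t)
    then show ?case using subsetD[OF N(2), of "T - t"] by auto
  qed
  then have "AE t in lebesgue. t \<in> {0<..<T} \<longrightarrow> P (T - t)" by (rule AE_completion)
  then show ?thesis by (subst AE_restrict_space_iff) auto
qed

lemma integral_reflect_time:
  fixes g :: "real \<Rightarrow> real"
  assumes g: "integrable (time T) g" and t: "t \<in> {0..T}"
  shows "(LINT s|time t. g (T - s)) = (LINT s|time T. g s) - (LINT s|time (T - t). g s)"
proof -
  have ind: "(LINT s|time c. f s) = (LINT s|lebesgue. indicator {0<..<c} s *\<^sub>R f s)" for f :: "real \<Rightarrow> real" and c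
    by (rule integral_restrict_space) simp
  have i: "integrable lebesgue (\<lambda>s. indicator {0<..<c} s *\<^sub>R g s)" if "c \<le> T" for c
  proof -
    have "integrable lebesgue (\<lambda>s. indicator {0<..<c} s *\<^sub>R (indicator {0<..<T} s *\<^sub>R g s))"
      by (rule integrable_mult_indicator) (use g in \<open>simp_all add: integrable_restrict_space\<close>)
    also have "(\<lambda>s. indicator {0<..<c} s *\<^sub>R (indicator {0<..<T} s *\<^sub>R g s)) = (\<lambda>s. indicator {0<..<c} s *\<^sub>R g s)"
      using that by (auto simp: indicator_def fun_eq_iff)
    finally show ?thesis .
  qed
  have j: "integrable lebesgue (\<lambda>s. indicator {T - t<..<T} s *\<^sub>R g s)"
  proof -
    have "integrable lebesgue (\<lambda>s. indicator {T - t<..<T} s *\<^sub>R (indicator {0<..<T} s *\<^sub>R g s))"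
      by (rule integrable_mult_indicator) (use g in \<open>simp_all add: integrable_restrict_space\<close>)
    also have "(\<lambda>s. indicator {T - t<..<T} s *\<^sub>R (indicator {0<..<T} s *\<^sub>R g s)) = (\<lambda>s. indicator {T - t<..<T} s *\<^sub>R g s)"
      using t by (auto simp: indicator_def fun_eq_iff)
    finally show ?thesis .
  qed
  have "(LINT s|time t. g (T - s)) = (LINT s|lebesgue. indicator {T - t<..<T} (T + (- 1) * s) *\<^sub>R g (T + (- 1) * s))"
    unfolding ind by (rule Bochner_Integration.integral_cong) (auto simp: indicator_def)
  also have "\<dots> = (LINT s|lebesgue. indicator {T - t<..<T} s *\<^sub>R g s)"
    using lebesgue_integral_real_affine[of "- 1" "\<lambda>s. indicator {T - t<..<T} s *\<^sub>R g s" T] by simp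
  also have "\<dots> = (LINT s|lebesgue. indicator {0<..<T} s *\<^sub>R g s - indicator {0<..<T - t} s *\<^sub>R g s)"
  proof (rule integral_cong_AE)
    have "AE s in lborel. s \<noteq> T - t" by (rule AE_lborel_singleton)
    then have "AE s in lebesgue. s \<noteq> T - t" by (rule AE_completion)
    then show "AE s in lebesgue. indicator {T - t<..<T} s *\<^sub>R g s = indicator {0<..<T} s *\<^sub>R g s - indicator {0<..<T - t} s *\<^sub>R g s"
      by eventually_elim (use t in \<open>auto simp: indicator_def\<close>)
  qed (use i[of T] i[of "T - t"] j t in \<open>auto intro!: borel_measurable_diff\<close>)
  also have "\<dots> = (LINT s|time T. g s) - (LINT s|time (T - t). g s)"
    unfolding ind using i[of T] i[of "T - t"] t by (intro Bochner_Integration.integral_diff) auto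
  finally show ?thesis .
qed

lemma L2_reflect_time:
  fixes f :: "real \<Rightarrow> 'b::{real_inner, second_countable_topology}"
  assumes f: "f \<in> L2 (time T)"
  shows "(\<lambda>t. f (T - t)) \<in> L2 (time T)"
proof -
  have m: "(\<lambda>t. f (T - t)) \<in> borel_measurable (time T)"
    by (rule measurable_compose[OF measurable_reflect_time L2_measurable[OF f]])
  have "integrable lebesgue (\<lambda>s. indicator {0<..<T} s *\<^sub>R (norm (f s))\<^sup>2)"
    using L2_integrable[OF f] by (simp add: integrable_restrict_space)
  then have "integrable lebesgue (\<lambda>s. indicator {0<..<T} (T + (- 1) * s) *\<^sub>R (norm (f (T + (- 1) * s)))\<^sup>2)"
    by (rule lebesgue_integrable_real_affine) simp
  also have "(\<lambda>s. indicator {0<..<T} (T + (- 1) * s) *\<^sub>R (norm (f (T + (- 1) * s)))\<^sup>2)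
      = (\<lambda>s. indicator {0<..<T} s *\<^sub>R (norm (f (T - s)))\<^sup>2)"
    by (auto simp: indicator_def fun_eq_iff)
  finally show ?thesis using m by (simp add: L2_def integrable_restrict_space)
qed

lemma Linfty_op_reflect_time:
  assumes "Linfty_op T C"
  shows "Linfty_op T (\<lambda>t. C (T - t))"
proof -
  obtain K where "AE t in time T. norm (C t) \<le> K" using assms by (auto simp: Linfty_op_def)
  then have "AE t in time T. norm (C (T - t)) \<le> K" by (rule AE_reflect_time)
  moreover have "(\<lambda>t. C (T - t) v \<bullet> w) \<in> borel_measurable (time T)" for v w
  proof -
    have "(\<lambda>t. C t v \<bullet> w) \<in> borel_measurable (time T)" using assms by (simp add: Linfty_op_def)
    then show ?thesis by (rule measurable_compose[OF measurable_reflect_time])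
  qed
  ultimately show ?thesis by (auto simp: Linfty_op_def)
qed

context
  fixes \<iota> :: "'v::{real_inner, banach, second_countable_topology} \<Rightarrow>\<^sub>L
    'h::{real_inner, banach, second_countable_topology}"
begin

text \<open>The chain rule flips the sign of the derivative. In integrated form, the reflected
  integral over (0,t) is one over (T - t, T), that is, a difference of two integrals starting at
  0.\<close>

lemma weak_path_reflect:
  assumes T: "T > 0" and w: "weak_path T \<iota> y z k"
  shows "weak_path T \<iota> (\<lambda>t. y (T - t)) (\<lambda>t. z (T - t)) (\<lambda>t. - k (T - t))"
proof (rule weak_pathI)
  show "(\<lambda>t. y (T - t)) \<in> L2 (time T)" by (rule L2_reflect_time[OF weak_pathD(1)[OF w]])
  show "(\<lambda>t. - k (T - t)) \<in> L2 (time T)"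
    using L2_scaleR[OF L2_reflect_time[OF weak_pathD(2)[OF w]], of "- 1"] by simp
  show "continuous_on {0..T} (\<lambda>t. z (T - t))"
    by (rule continuous_on_compose2[OF weak_pathD(3)[OF w]]) (auto intro!: continuous_intros)
  show "AE t in time T. \<iota> (y (T - t)) = z (T - t)" by (rule AE_reflect_time[OF weak_pathD(4)[OF w]])
  fix t v assume t: "t \<in> {0..T}"
  have "(LINT s|time t. - k (T - s) \<bullet> v) = - (LINT s|time t. k (T - s) \<bullet> v)" by simp
  also have "(LINT s|time t. k (T - s) \<bullet> v) = (LINT s|time T. k s \<bullet> v) - (LINT s|time (T - t). k s \<bullet> v)"
    by (rule integral_reflect_time[OF L2_inner_const_integrable[OF weak_pathD(2)[OF w]] t])
  also have "\<dots> = z T \<bullet> \<iota> v - z (T - t) \<bullet> \<iota> v"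
    using weak_pathD(5)[OF w, of T v] weak_pathD(5)[OF w, of "T - t" v] t T by simp
  finally show "z (T - t) \<bullet> \<iota> v = z (T - 0) \<bullet> \<iota> v + (LINT s|time t. - k (T - s) \<bullet> v)" by simp
qed

text \<open>In reversed time this is a forward problem for the reversed operator family, with the
  final value as initial value.\<close>

theorem parabolic_backward_existence:
  fixes M :: "real \<Rightarrow> 'v \<Rightarrow>\<^sub>L 'v"
  assumes T: "T > 0" and dense: "closure (range (blinfun_apply \<iota>)) = UNIV"
    and M: "Linfty_op T M" and \<eta>: "\<eta> > 0"
    and coer: "\<And>t v. t \<in> {0<..<T} \<Longrightarrow> \<eta> * (norm v)\<^sup>2 \<le> M t v \<bullet> v"
    and F: "F \<in> L2 (time T)"
  shows "\<exists>y z k. weak_path T \<iota> y z k \<and> z T = yT \<and> (AE t in time T. - k t + M t (y t) = F t)"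
proof -
  have "\<exists>y z k. weak_path T \<iota> y z k \<and> z 0 = yT \<and> (AE t in time T. k t + M (T - t) (y t) = F (T - t))"
    by (rule parabolic_existence[OF T dense Linfty_op_reflect_time[OF M] \<eta> _ L2_reflect_time[OF F]])
       (rule coer, auto)
  then obtain y z k where w: "weak_path T \<iota> y z k" "z 0 = yT"
    and eq: "AE t in time T. k t + M (T - t) (y t) = F (T - t)" by blast
  have "AE t in time T. - (- k (T - t)) + M t (y (T - t)) = F t"
    using AE_reflect_time[OF eq] by eventually_elim simp
  then show ?thesis using weak_path_reflect[OF T w(1)] w(2)
    by (intro exI[of _ "\<lambda>t. y (T - t)"] exI[of _ "\<lambda>t. z (T - t)"] exI[of _ "\<lambda>t. - k (T - t)"]) simp
qed

end

section \<open>State equation, adjoint equation and the operator CS\<close>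

locale parabolic_control =
  fixes T \<beta> :: real
    and \<iota> :: "'v::{real_inner, banach, second_countable_topology} \<Rightarrow>\<^sub>L
              'h::{real_inner, banach, second_countable_topology}"
    and A :: "real \<Rightarrow> 'v \<Rightarrow>\<^sub>L 'v \<Rightarrow>\<^sub>L real"
    and B :: "'u::{real_inner, banach, second_countable_topology} \<Rightarrow>\<^sub>L 'v \<Rightarrow>\<^sub>L real"
    and C :: "real \<Rightarrow> 'h \<Rightarrow>\<^sub>L 'h"
    and yd :: "real \<Rightarrow> 'h" and \<eta> :: real
  assumes T: "T > 0" and dense: "closure (range (blinfun_apply \<iota>)) = UNIV"
    and A: "Linfty_form T A" and \<eta>: "\<eta> > 0"
    and coercive: "\<And>t v. t \<in> {0<..<T} \<Longrightarrow> \<eta> * (norm v)\<^sup>2 \<le> A t v v"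
    and C: "Linfty_op T C" and \<beta>: "\<beta> > 0" and yd: "yd \<in> L2 (time T)"
begin

abbreviation M where "M t \<equiv> form_op (A t)"
abbreviation N where "N \<equiv> form_op B"

lemma M_bounded: "Linfty_op T M" by (rule Linfty_op_form_op[OF A])

lemma M_coercive: "t \<in> {0<..<T} \<Longrightarrow> \<eta> * (norm v)\<^sup>2 \<le> M t v \<bullet> v"
  using coercive by (simp add: form_op_apply)

lemma adj_M_coercive: "t \<in> {0<..<T} \<Longrightarrow> \<eta> * (norm v)\<^sup>2 \<le> adj (M t) v \<bullet> v"
  using M_coercive[of t v] by (simp add: inner_adj inner_commute[of v])

lemma C_L2: "f \<in> L2 (time T) \<Longrightarrow> (\<lambda>t. C t (f t)) \<in> L2 (time T)"
  by (rule Linfty_op_L2_norm[OF C]) blast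

lemma adj_C_L2: "f \<in> L2 (time T) \<Longrightarrow> (\<lambda>t. adj (C t) (f t)) \<in> L2 (time T)"
  by (rule Linfty_op_L2_norm[OF Linfty_op_adj[OF C]]) blast

text \<open>The Riesz map carries the equation from V' to V, and the continuous function behind
  \<open>has_value_at\<close> becomes the component \<open>z\<close> of the weak path. All later
  work on the state uses the right-hand side.\<close>

lemma solves_state_iff:
  "solves_state T \<iota> A B h u y \<longleftrightarrow>
    (\<exists>z k. weak_path T \<iota> y z k \<and> z 0 = h \<and> (AE t in time T. k t + M t (y t) = N (u t)))"
proof
  assume "solves_state T \<iota> A B h u y"
  then obtain y' z where W: "has_W_derivative T \<iota> y y'" and eq: "AE t in time T. y' t + A t (y t) = B (u t)"
    and z: "continuous_on {0..T} z" "AE t in time T. \<iota> (y t) = z t" "z 0 = h"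
    unfolding solves_state_def has_value_at_def by blast
  have "AE t in time T. inv riesz (y' t) + M t (y t) = N (u t)"
    using eq by eventually_elim (simp add: form_op_apply flip: inv_riesz_add)
  then show "\<exists>z k. weak_path T \<iota> y z k \<and> z 0 = h \<and> (AE t in time T. k t + M t (y t) = N (u t))"
    using W_imp_weak_path[OF T W z(1,2)] z(3) by blast
next
  assume "\<exists>z k. weak_path T \<iota> y z k \<and> z 0 = h \<and> (AE t in time T. k t + M t (y t) = N (u t))"
  then obtain z k where w: "weak_path T \<iota> y z k" "z 0 = h" and eq: "AE t in time T. k t + M t (y t) = N (u t)" by blast
  have "AE t in time T. riesz (k t) + A t (y t) = B (u t)"
    using eq
  proof eventually_elim
    case (elim t)
    have "riesz (k t) + A t (y t) = riesz (k t + M t (y t))" by (simp add: riesz_add form_op_apply)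
    also have "\<dots> = B (u t)" unfolding elim by (simp add: form_op_apply)
    finally show ?case .
  qed
  then show "solves_state T \<iota> A B h u y"
    unfolding solves_state_def using weak_path_imp_W[OF T w(1)] weak_path_imp_value_at[OF w(1), of 0, unfolded w(2)]
    by (intro conjI exI[of _ "\<lambda>t. riesz (k t)"])
qed

text \<open>Here A'(t) becomes \<open>adj (M t)\<close>, and the observation defect in H reaches V
  through \<open>adj \<iota>\<close>.\<close>

lemma solves_adjoint_iff:
  "solves_adjoint T \<iota> A C yd y p \<longleftrightarrow>
    (\<exists>z k. weak_path T \<iota> p z k \<and> z T = 0 \<and>
      (AE t in time T. - k t + adj (M t) (p t) = adj \<iota> (adj (C t) (C t (y t) - yd t))))"
proof
  assume "solves_adjoint T \<iota> A C yd y p"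
  then obtain p' z where W: "has_W_derivative T \<iota> p p'"
    and eq: "AE t in time T. - p' t + dual_op (A t) (p t) = to_dual \<iota> (adjoint (blinfun_apply (C t)) (C t (y t) - yd t))"
    and z: "continuous_on {0..T} z" "AE t in time T. \<iota> (p t) = z t" "z T = 0"
    unfolding solves_adjoint_def has_value_at_def by blast
  have "AE t in time T. - inv riesz (p' t) + adj (M t) (p t) = adj \<iota> (adj (C t) (C t (y t) - yd t))"
    using eq
  proof eventually_elim
    case (elim t)
    have "- inv riesz (p' t) + adj (M t) (p t) = inv riesz (- p' t + dual_op (A t) (p t))"
      by (simp only: inv_riesz_add inv_riesz_dual_op linear_neg[OF bounded_linear.linear[OF bounded_linear_inv_riesz]])
    also have "\<dots> = adj \<iota> (adj (C t) (C t (y t) - yd t))"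
      unfolding elim by (simp add: to_dual_eq adjoint_eq_adj)
    finally show ?case .
  qed
  then show "\<exists>z k. weak_path T \<iota> p z k \<and> z T = 0 \<and>
      (AE t in time T. - k t + adj (M t) (p t) = adj \<iota> (adj (C t) (C t (y t) - yd t)))"
    using W_imp_weak_path[OF T W z(1,2)] z(3) by blast
next
  assume "\<exists>z k. weak_path T \<iota> p z k \<and> z T = 0 \<and>
      (AE t in time T. - k t + adj (M t) (p t) = adj \<iota> (adj (C t) (C t (y t) - yd t)))"
  then obtain z k where w: "weak_path T \<iota> p z k" "z T = 0"
    and eq: "AE t in time T. - k t + adj (M t) (p t) = adj \<iota> (adj (C t) (C t (y t) - yd t))" by blast
  have "AE t in time T. - riesz (k t) + dual_op (A t) (p t) = to_dual \<iota> (adjoint (blinfun_apply (C t)) (C t (y t) - yd t))"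
    using eq
  proof eventually_elim
    case (elim t)
    have "dual_op (A t) (p t) = riesz (adj (M t) (p t))" by (simp flip: inv_riesz_dual_op)
    then have "- riesz (k t) + dual_op (A t) (p t) = riesz (- k t + adj (M t) (p t))"
      by (simp only: riesz_add linear_neg[OF bounded_linear.linear[OF bounded_linear_riesz]])
    also have "\<dots> = to_dual \<iota> (adjoint (blinfun_apply (C t)) (C t (y t) - yd t))"
      unfolding elim by (simp add: to_dual_eq adjoint_eq_adj)
    finally show ?case .
  qed
  then show "solves_adjoint T \<iota> A C yd y p"
    unfolding solves_adjoint_def using weak_path_imp_W[OF T w(1)] weak_path_imp_value_at[OF w(1), of T, unfolded w(2)]
    by (intro conjI exI[of _ "\<lambda>t. riesz (k t)"])
qed

lemma solves_state_add:
  assumes "solves_state T \<iota> A B h u y" "solves_state T \<iota> A B h' u' y'"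
  shows "solves_state T \<iota> A B (h + h') (\<lambda>t. u t + u' t) (\<lambda>t. y t + y' t)"
proof -
  obtain z k where 1: "weak_path T \<iota> y z k" "z 0 = h" "AE t in time T. k t + M t (y t) = N (u t)"
    using assms(1) unfolding solves_state_iff by blast
  obtain z' k' where 2: "weak_path T \<iota> y' z' k'" "z' 0 = h'" "AE t in time T. k' t + M t (y' t) = N (u' t)"
    using assms(2) unfolding solves_state_iff by blast
  have "AE t in time T. (k t + k' t) + M t (y t + y' t) = N (u t + u' t)"
    using 1(3) 2(3)
  proof eventually_elim
    case (elim t)
    have "(k t + k' t) + M t (y t + y' t) = (k t + M t (y t)) + (k' t + M t (y' t))"
      by (simp add: blinfun.add_right)
    then show ?case unfolding elim by (simp add: blinfun.add_right)
  qed
  then show ?thesis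
    unfolding solves_state_iff using weak_path_add[OF 1(1) 2(1)] 1(2) 2(2) by blast
qed

text \<open>The energy estimate at time \<open>T\<close> with zero initial value. Applied to the
  difference of two solutions it also gives uniqueness.\<close>

lemma state_bound:
  assumes "solves_state T \<iota> A B 0 u y" and u: "u \<in> L2 (time T)"
  shows "L2_norm (time T) y \<le> norm N / \<eta> * L2_norm (time T) u"
proof -
  obtain z k where w: "weak_path T \<iota> y z k" "z 0 = 0" "AE t in time T. k t + M t (y t) = N (u t)"
    using assms(1) unfolding solves_state_iff by blast
  have "(norm (z T))\<^sup>2 + \<eta> * (L2_norm (time T) y)\<^sup>2 \<le> (norm (z 0))\<^sup>2 + (L2_norm (time T) (\<lambda>t. N (u t)))\<^sup>2 / \<eta>"
    by (rule weak_path_energy[OF w(1) M_bounded \<eta> M_coercive L2_blinfun[OF u] w(3)]) (use T in simp_all)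
  moreover have "0 \<le> (norm (z T))\<^sup>2" "(norm (z 0))\<^sup>2 = 0" using w(2) by simp_all
  ultimately have "\<eta> * (L2_norm (time T) y)\<^sup>2 \<le> (L2_norm (time T) (\<lambda>t. N (u t)))\<^sup>2 / \<eta>"
    by linarith
  then have "(L2_norm (time T) y)\<^sup>2 \<le> (L2_norm (time T) (\<lambda>t. N (u t)) / \<eta>)\<^sup>2"
    using \<eta> by (simp add: field_simps power2_eq_square)
  then have "L2_norm (time T) y \<le> L2_norm (time T) (\<lambda>t. N (u t)) / \<eta>"
    by (rule power2_le_imp_le) (use \<eta> in simp)
  also have "\<dots> \<le> norm N * L2_norm (time T) u / \<eta>"
    using L2_norm_blinfun[OF u, of N] \<eta> by (intro divide_right_mono) auto
  finally show ?thesis by simp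
qed

lemma solves_state_L2: "solves_state T \<iota> A B h u y \<Longrightarrow> y \<in> L2 (time T)"
  unfolding solves_state_iff by (blast dest: weak_pathD(1))

lemma solves_state_unique:
  assumes "solves_state T \<iota> A B h u y" "solves_state T \<iota> A B h u y'"
  shows "AE t in time T. y t = y' t"
proof -
  obtain z k where 1: "weak_path T \<iota> y z k" "z 0 = h" "AE t in time T. k t + M t (y t) = N (u t)"
    using assms(1) unfolding solves_state_iff by blast
  obtain z' k' where 2: "weak_path T \<iota> y' z' k'" "z' 0 = h" "AE t in time T. k' t + M t (y' t) = N (u t)"
    using assms(2) unfolding solves_state_iff by blast
  have "AE t in time T. (k t - k' t) + M t (y t - y' t) = N 0"
    using 1(3) 2(3)
  proof eventually_elim
    case (elim t)
    have "(k t - k' t) + M t (y t - y' t) = (k t + M t (y t)) - (k' t + M t (y' t))"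
      by (simp add: blinfun.diff_right)
    then show ?case unfolding elim by simp
  qed
  then have "solves_state T \<iota> A B 0 (\<lambda>t. 0) (\<lambda>t. y t - y' t)"
    unfolding solves_state_iff using weak_path_diff[OF 1(1) 2(1)] 1(2) 2(2)
    by (intro exI[of _ "\<lambda>t. z t - z' t"] exI[of _ "\<lambda>t. k t - k' t"]) simp
  from state_bound[OF this] have "L2_norm (time T) (\<lambda>t. y t - y' t) \<le> 0"
    by (simp add: L2_norm_def[of _ "\<lambda>t. 0 :: 'u"])
  then have "L2_norm (time T) (\<lambda>t. y t - y' t) = 0" using L2_norm_nonneg by (rule antisym)
  then have "AE t in time T. y t - y' t = 0"
    by (rule L2_norm_eq_0_imp_AE[OF L2_diff[OF solves_state_L2[OF assms(1)] solves_state_L2[OF assms(2)]]])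
  then show ?thesis by eventually_elim simp
qed

lemma state_solves:
  assumes "u \<in> L2 (time T)"
  shows "solves_state T \<iota> A B h u (state T \<iota> A B h u)"
proof -
  have "\<exists>y. solves_state T \<iota> A B h u y"
    using parabolic_existence[OF T dense M_bounded \<eta> M_coercive L2_blinfun[OF assms, of N], of h]
    unfolding solves_state_iff by blast
  then show ?thesis unfolding state_def by (rule someI_ex)
qed

lemma state_L2: "u \<in> L2 (time T) \<Longrightarrow> state T \<iota> A B h u \<in> L2 (time T)"
  by (rule solves_state_L2[OF state_solves])

text \<open>Solutions superpose, and uniqueness transfers this to the chosen representatives, hence
  only a.e. The initial value stays with \<open>u\<close>, so the increment caused by
  \<open>v\<close> is a solution starting at 0.\<close>

lemma state_add:
  assumes "u \<in> L2 (time T)" "v \<in> L2 (time T)"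
  shows "AE t in time T. state T \<iota> A B h (\<lambda>t. u t + v t) t = state T \<iota> A B h u t + state T \<iota> A B 0 v t"
  using solves_state_unique[OF state_solves[OF L2_add[OF assms]]]
    solves_state_add[OF state_solves[OF assms(1)] state_solves[OF assms(2)], of h 0] by simp

abbreviation CS where "CS \<equiv> CS_operator T \<iota> A B C"

lemma CS_L2: "u \<in> L2 (time T) \<Longrightarrow> CS u \<in> L2 (time T)"
  unfolding CS_operator_def by (intro C_L2 L2_blinfun state_L2)

lemma CS_add:
  assumes "u \<in> L2 (time T)" "v \<in> L2 (time T)"
  shows "AE t in time T. CS (\<lambda>t. u t + v t) t = CS u t + CS v t"
  using state_add[OF assms, of 0] by eventually_elim (simp add: CS_operator_def blinfun.add_right)

text \<open>A finite bound makes the supremum in \<open>Ltwo_opnorm\<close> meaningful, and it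
  controls the quadratic remainders in the expansions of the cost.\<close>

lemma CS_bounded:
  obtains K where "K > 0" "\<And>u. u \<in> L2 (time T) \<Longrightarrow> L2_norm (time T) (CS u) \<le> K * L2_norm (time T) u"
proof -
  obtain c where c: "c > 0" "\<And>f. f \<in> L2 (time T) \<Longrightarrow> L2_norm (time T) (\<lambda>t. C t (f t)) \<le> c * L2_norm (time T) f"
    by (rule Linfty_op_L2_norm[OF C]) blast
  define K where "K = c * (norm \<iota> * (norm N / \<eta>)) + 1"
  have K: "K > 0" using c \<eta> by (simp add: K_def add_nonneg_pos)
  have "L2_norm (time T) (CS u) \<le> K * L2_norm (time T) u" if u: "u \<in> L2 (time T)" for u
  proof -
    have "L2_norm (time T) (CS u) \<le> c * L2_norm (time T) (\<lambda>t. \<iota> (state T \<iota> A B 0 u t))"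
      unfolding CS_operator_def by (rule c(2)[OF L2_blinfun[OF state_L2[OF u]]])
    also have "\<dots> \<le> c * (norm \<iota> * L2_norm (time T) (state T \<iota> A B 0 u))"
      using c(1) by (intro mult_left_mono L2_norm_blinfun state_L2 u) simp
    also have "\<dots> \<le> c * (norm \<iota> * (norm N / \<eta> * L2_norm (time T) u))"
      using c(1) by (intro mult_left_mono state_bound state_solves u) simp_all
    also have "\<dots> \<le> K * L2_norm (time T) u" by (simp add: K_def algebra_simps)
    finally show ?thesis .
  qed
  with K show thesis by (rule that)
qed

lemma CS_opnorm:
  assumes u: "u \<in> L2 (time T)"
  shows "L2_norm (time T) (CS u) \<le> Ltwo_opnorm T CS * L2_norm (time T) u"
proof -
  obtain K where K: "K > 0" "\<And>u. u \<in> L2 (time T) \<Longrightarrow> L2_norm (time T) (CS u) \<le> K * L2_norm (time T) u"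
    by (rule CS_bounded) blast
  \<comment> \<open>For a control of norm zero the quotient in the supremum is 0 by convention and
    carries no information; the bound by \<open>K\<close> settles this case.\<close>
  show ?thesis
  proof (cases "L2_norm (time T) u = 0")
    case True
    then show ?thesis using K(2)[OF u] by simp
  next
    case False
    then have pos: "L2_norm (time T) u > 0" using L2_norm_nonneg[of "time T" u] by linarith
    have "L2_norm (time T) (CS u) / L2_norm (time T) u \<le> Ltwo_opnorm T CS"
      unfolding Ltwo_opnorm_def Ltwo_eq_L2 Ltwo_norm_eq_L2_norm
    proof (rule cSUP_upper[OF u])
      show "bdd_above ((\<lambda>u. L2_norm (time T) (CS u) / L2_norm (time T) u) ` L2 (time T))"
      proof (rule bdd_aboveI2)
        fix v :: "real \<Rightarrow> 'u" assume v: "v \<in> L2 (time T)"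
        show "L2_norm (time T) (CS v) / L2_norm (time T) v \<le> K"
        proof (cases "L2_norm (time T) v = 0")
          case False
          then have "L2_norm (time T) v > 0" using L2_norm_nonneg[of "time T" v] by linarith
          then show ?thesis using K(2)[OF v] by (simp add: divide_le_eq)
        qed (use K(1) in simp)
      qed
    qed
    then show ?thesis using pos by (simp add: divide_le_eq)
  qed
qed

lemma adjoint_state_solves:
  assumes "y \<in> L2 (time T)"
  shows "solves_adjoint T \<iota> A C yd y (adjoint_state T \<iota> A C yd y)"
proof -
  have "(\<lambda>t. adj \<iota> (adj (C t) (C t (y t) - yd t))) \<in> L2 (time T)"
    by (intro L2_blinfun adj_C_L2 L2_diff C_L2 yd assms)
  from parabolic_backward_existence[OF T dense Linfty_op_adj[OF M_bounded] \<eta> adj_M_coercive this, of 0]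
  have "\<exists>p. solves_adjoint T \<iota> A C yd y p" unfolding solves_adjoint_iff by blast
  then show ?thesis unfolding adjoint_state_def by (rule someI_ex)
qed

text \<open>Integrate the adjoint state by parts against the state \<open>q\<close> that
  \<open>h\<close> produces from initial value 0. No boundary terms arise, as \<open>p\<close>
  vanishes at \<open>T\<close> and \<open>q\<close> at 0; the terms with \<open>M\<close> cancel
  because one equation carries its adjoint.\<close>

lemma adjoint_duality:
  assumes p: "solves_adjoint T \<iota> A C yd y p" and y: "y \<in> L2 (time T)" and h: "h \<in> L2 (time T)"
  shows "(LINT t|time T. adj N (p t) \<bullet> h t) = (LINT t|time T. (C t (y t) - yd t) \<bullet> CS h t)"
proof -
  define q where "q = state T \<iota> A B 0 h"
  obtain zp kp where P: "weak_path T \<iota> p zp kp" "zp T = 0"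
    and eqp: "AE t in time T. - kp t + adj (M t) (p t) = adj \<iota> (adj (C t) (C t (y t) - yd t))"
    using p unfolding solves_adjoint_iff by blast
  obtain zq kq where Q: "weak_path T \<iota> q zq kq" "zq 0 = 0" and eqq: "AE t in time T. kq t + M t (q t) = N (h t)"
    using state_solves[OF h, of 0] unfolding solves_state_iff q_def by blast
  note pL = weak_pathD(1)[OF P(1)] and kpL = weak_pathD(2)[OF P(1)]
    and qL = weak_pathD(1)[OF Q(1)] and kqL = weak_pathD(2)[OF Q(1)]
  have rL: "(\<lambda>t. C t (y t) - yd t) \<in> L2 (time T)" by (intro L2_diff C_L2 yd y)
  have NpL: "(\<lambda>t. adj N (p t)) \<in> L2 (time T)" by (rule L2_blinfun[OF pL])
  have "0 = (LINT t|time T. kp t \<bullet> q t) + (LINT t|time T. kq t \<bullet> p t)"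
    using weak_path_integration_by_parts[OF P(1) Q(1) T] P(2) Q(2) by simp
  also have "\<dots> = (LINT t|time T. kp t \<bullet> q t + kq t \<bullet> p t)"
    by (rule Bochner_Integration.integral_add[symmetric]) (intro L2_inner_integrable kpL qL kqL pL)+
  also have "\<dots> = (LINT t|time T. adj N (p t) \<bullet> h t - (C t (y t) - yd t) \<bullet> CS h t)"
  proof (rule integral_cong_AE)
    show "AE t in time T. kp t \<bullet> q t + kq t \<bullet> p t = adj N (p t) \<bullet> h t - (C t (y t) - yd t) \<bullet> CS h t"
      using eqp eqq
    proof eventually_elim
      case (elim t)
      define r where "r = C t (y t) - yd t"
      have "kp t = adj (M t) (p t) - adj \<iota> (adj (C t) r)"
        using elim(1) by (simp add: r_def algebra_simps)
      then have 1: "kp t \<bullet> q t = p t \<bullet> M t (q t) - r \<bullet> C t (\<iota> (q t))"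
        by (simp add: inner_diff_left inner_adj)
      have "kq t = N (h t) - M t (q t)" using elim(2) by (simp add: algebra_simps)
      then have 2: "kq t \<bullet> p t = adj N (p t) \<bullet> h t - p t \<bullet> M t (q t)"
        by (simp add: inner_diff_left inner_adj inner_commute[of "N (h t)"] inner_commute[of "M t (q t)"])
      show ?case unfolding 1 2 by (simp add: r_def CS_operator_def q_def)
    qed
    show "(\<lambda>t. kp t \<bullet> q t + kq t \<bullet> p t) \<in> borel_measurable (time T)"
      by (intro borel_measurable_add L2_inner_measurable kpL qL kqL pL)
    show "(\<lambda>t. adj N (p t) \<bullet> h t - (C t (y t) - yd t) \<bullet> CS h t) \<in> borel_measurable (time T)"
      by (intro borel_measurable_diff L2_inner_measurable NpL h rL CS_L2)
  qed
  also have "\<dots> = (LINT t|time T. adj N (p t) \<bullet> h t) - (LINT t|time T. (C t (y t) - yd t) \<bullet> CS h t)"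
    by (rule Bochner_Integration.integral_diff) (intro L2_inner_integrable NpL h rL CS_L2)+
  finally show ?thesis by simp
qed

section \<open>Gradient of the reduced cost and the error bounds\<close>

context
  fixes y0 :: 'h
begin

abbreviation J where "J \<equiv> reduced_cost T \<iota> A B C \<beta> yd y0"

definition residual :: "(real \<Rightarrow> 'u) \<Rightarrow> real \<Rightarrow> 'h" where
  "residual u t = C t (\<iota> (state T \<iota> A B y0 u t)) - yd t"

text \<open>The adjoint formula as a concrete function. It is the candidate that shows the choice in
  \<open>reduced_gradient\<close> to be nonvacuous.\<close>

definition gradient :: "(real \<Rightarrow> 'u) \<Rightarrow> real \<Rightarrow> 'u" where
  "gradient u t = inv riesz (dual_op B (adjoint_state T \<iota> A C yd (\<lambda>t. \<iota> (state T \<iota> A B y0 u t)) t)) + \<beta> *\<^sub>R u t"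

lemma residual_L2: "u \<in> L2 (time T) \<Longrightarrow> residual u \<in> L2 (time T)"
  unfolding residual_def[abs_def] by (intro L2_diff C_L2 L2_blinfun state_L2 yd)

lemma reduced_cost_eq:
  assumes u: "u \<in> L2 (time T)"
  shows "J u = (L2_norm (time T) (residual u))\<^sup>2 / 2 + \<beta> / 2 * (L2_norm (time T) u)\<^sup>2"
  unfolding reduced_cost_def residual_def[symmetric]
  using L2_integrable[OF residual_L2[OF u]] L2_integrable[OF u] by (simp add: L2_norm_square)

lemma
  assumes u: "u \<in> L2 (time T)"
  shows gradient_L2: "gradient u \<in> L2 (time T)"
    and gradient_inner: "\<And>h. h \<in> L2 (time T) \<Longrightarrow>
      (LINT t|time T. gradient u t \<bullet> h t) = (LINT t|time T. residual u t \<bullet> CS h t) + \<beta> * (LINT t|time T. u t \<bullet> h t)"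
proof -
  define y where "y = (\<lambda>t. \<iota> (state T \<iota> A B y0 u t))"
  define p where "p = adjoint_state T \<iota> A C yd y"
  have y: "y \<in> L2 (time T)" unfolding y_def by (intro L2_blinfun state_L2 u)
  have p: "solves_adjoint T \<iota> A C yd y p" unfolding p_def by (rule adjoint_state_solves[OF y])
  then have pL: "p \<in> L2 (time T)" unfolding solves_adjoint_iff by (blast dest: weak_pathD(1))
  have NpL: "(\<lambda>t. adj N (p t)) \<in> L2 (time T)" by (rule L2_blinfun[OF pL])
  have g: "gradient u = (\<lambda>t. adj N (p t) + \<beta> *\<^sub>R u t)"
    by (rule ext) (simp add: gradient_def p_def y_def inv_riesz_dual_op)
  show "gradient u \<in> L2 (time T)" unfolding g by (intro L2_add NpL L2_scaleR u)
  fix h :: "real \<Rightarrow> 'u" assume h: "h \<in> L2 (time T)"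
  have "(LINT t|time T. gradient u t \<bullet> h t) = (LINT t|time T. adj N (p t) \<bullet> h t) + \<beta> * (LINT t|time T. u t \<bullet> h t)"
    unfolding g inner_add_left using L2_inner_integrable[OF NpL h] L2_inner_integrable[OF u h] by simp
  then show "(LINT t|time T. gradient u t \<bullet> h t) = (LINT t|time T. residual u t \<bullet> CS h t) + \<beta> * (LINT t|time T. u t \<bullet> h t)"
    unfolding adjoint_duality[OF p y h] by (simp add: residual_def y_def)
qed

text \<open>The residual is a.e. affine in the control with linear part \<open>CS\<close>, so both
  squares expand exactly; by the adjoint formula the linear terms add up to the pairing with the
  gradient.\<close>

lemma reduced_cost_expansion:
  assumes u: "u \<in> L2 (time T)" and h: "h \<in> L2 (time T)"
  shows "J (\<lambda>t. u t + h t) = J u + (LINT t|time T. gradient u t \<bullet> h t)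
    + ((L2_norm (time T) (CS h))\<^sup>2 + \<beta> * (L2_norm (time T) h)\<^sup>2) / 2"
proof -
  note uh = L2_add[OF u h]
  have "L2_norm (time T) (residual (\<lambda>t. u t + h t)) = L2_norm (time T) (\<lambda>t. residual u t + CS h t)"
  proof (rule L2_norm_cong_AE)
    show "AE t in time T. residual (\<lambda>t. u t + h t) t = residual u t + CS h t"
      using state_add[OF u h, of y0] by eventually_elim (simp add: residual_def CS_operator_def blinfun.add_right)
  qed (intro L2_measurable residual_L2 uh L2_add u CS_L2 h)+
  then have eq: "(L2_norm (time T) (residual (\<lambda>t. u t + h t)))\<^sup>2 = (L2_norm (time T) (residual u))\<^sup>2
      + 2 * (LINT t|time T. residual u t \<bullet> CS h t) + (L2_norm (time T) (CS h))\<^sup>2"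
    by (simp only: L2_norm_add_square[OF residual_L2[OF u] CS_L2[OF h]])
  show ?thesis
    unfolding reduced_cost_eq[OF uh] reduced_cost_eq[OF u] gradient_inner[OF u h] eq L2_norm_add_square[OF u h]
    by (simp add: field_simps)
qed

lemma gradient_has_Ltwo_gradient:
  assumes u: "u \<in> L2 (time T)"
  shows "has_Ltwo_gradient T J u (gradient u)"
  unfolding has_Ltwo_gradient_def Ltwo_eq_L2 Ltwo_norm_eq_L2_norm
proof (intro conjI allI impI)
  show "gradient u \<in> L2 (time T)" by (rule gradient_L2[OF u])
  fix e :: real assume e: "e > 0"
  obtain K where K: "K > 0" "\<And>u. u \<in> L2 (time T) \<Longrightarrow> L2_norm (time T) (CS u) \<le> K * L2_norm (time T) u"
    by (rule CS_bounded) blast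
  \<comment> \<open>A bound for the quadratic remainder relative to the squared norm of
    \<open>h\<close>; \<open>e / c\<close> is therefore a sufficient radius.\<close>
  define c where "c = K\<^sup>2 + \<beta>"
  have c: "c > 0" using \<beta> by (simp add: c_def add_nonneg_pos)
  show "\<exists>d>0. \<forall>h\<in>L2 (time T). L2_norm (time T) h < d \<longrightarrow>
      \<bar>J (\<lambda>t. u t + h t) - J u - (LINT t|time T. gradient u t \<bullet> h t)\<bar> \<le> e * L2_norm (time T) h"
  proof (intro exI[of _ "e / c"] conjI ballI impI)
    fix h :: "real \<Rightarrow> 'u" assume h: "h \<in> L2 (time T)" and small: "L2_norm (time T) h < e / c"
    have "(L2_norm (time T) (CS h))\<^sup>2 \<le> (K * L2_norm (time T) h)\<^sup>2" by (rule power_mono[OF K(2)[OF h]]) simp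
    then have "((L2_norm (time T) (CS h))\<^sup>2 + \<beta> * (L2_norm (time T) h)\<^sup>2) / 2 \<le> c * (L2_norm (time T) h)\<^sup>2 / 2"
      by (simp add: c_def power_mult_distrib algebra_simps)
    also have "\<dots> \<le> c * (L2_norm (time T) h)\<^sup>2" using c by simp
    also have "\<dots> = (c * L2_norm (time T) h) * L2_norm (time T) h" by (simp add: power2_eq_square)
    also have "\<dots> \<le> e * L2_norm (time T) h"
      using small c by (intro mult_right_mono) (auto simp: field_simps)
    finally have le: "((L2_norm (time T) (CS h))\<^sup>2 + \<beta> * (L2_norm (time T) h)\<^sup>2) / 2 \<le> e * L2_norm (time T) h" .
    have "J (\<lambda>t. u t + h t) - J u - (LINT t|time T. gradient u t \<bullet> h t) = ((L2_norm (time T) (CS h))\<^sup>2 + \<beta> * (L2_norm (time T) h)\<^sup>2) / 2"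
      using reduced_cost_expansion[OF u h] by simp
    moreover have "0 \<le> ((L2_norm (time T) (CS h))\<^sup>2 + \<beta> * (L2_norm (time T) h)\<^sup>2) / 2" using \<beta> by simp
    ultimately show "\<bar>J (\<lambda>t. u t + h t) - J u - (LINT t|time T. gradient u t \<bullet> h t)\<bar> \<le> e * L2_norm (time T) h"
      using le by simp
  qed (use e c in simp)
qed

text \<open>The choice is determined up to a null set by the adjoint formula, and the norm does not
  see null sets.\<close>

lemma reduced_gradient_norm:
  assumes u: "u \<in> L2 (time T)"
  shows "L2_norm (time T) (reduced_gradient T \<iota> A B C \<beta> yd y0 u) = L2_norm (time T) (gradient u)"
proof -
  define P where "P = (\<lambda>g. has_Ltwo_gradient T J u g \<and> (AE t in time T. g t = gradient u t))"
  have eq: "reduced_gradient T \<iota> A B C \<beta> yd y0 u = (SOME g. P g)"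
    by (simp add: reduced_gradient_def Let_def P_def gradient_def)
  have "P (gradient u)" using gradient_has_Ltwo_gradient[OF u] by (simp add: P_def)
  then have P: "P (reduced_gradient T \<iota> A B C \<beta> yd y0 u)" unfolding eq by (rule someI[of P])
  show ?thesis
  proof (rule L2_norm_cong_AE)
    show "AE t in time T. reduced_gradient T \<iota> A B C \<beta> yd y0 u t = gradient u t"
      using P by (simp add: P_def)
    show "reduced_gradient T \<iota> A B C \<beta> yd y0 u \<in> borel_measurable (time T)"
      using P by (simp add: P_def has_Ltwo_gradient_def Ltwo_eq_L2 L2_measurable)
  qed (rule L2_measurable[OF gradient_L2[OF u]])
qed

text \<open>Variation of the cost along multiples of \<open>h\<close>. The quadratic term is only
  estimated through \<open>K\<close>, which suffices for \<open>linear_coeff_zero\<close>.\<close>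

lemma minimizer_gradient_zero:
  assumes u: "u \<in> L2 (time T)" and min: "\<And>v. v \<in> L2 (time T) \<Longrightarrow> J u \<le> J v" and h: "h \<in> L2 (time T)"
  shows "(LINT t|time T. gradient u t \<bullet> h t) = 0"
proof -
  obtain K where K: "K > 0" "\<And>u. u \<in> L2 (time T) \<Longrightarrow> L2_norm (time T) (CS u) \<le> K * L2_norm (time T) u"
    by (rule CS_bounded) blast
  have "0 \<le> s * (LINT t|time T. gradient u t \<bullet> h t) + s\<^sup>2 * ((K\<^sup>2 + \<beta>) * (L2_norm (time T) h)\<^sup>2 / 2)" for s
  proof -
    have sh: "(\<lambda>t. s *\<^sub>R h t) \<in> L2 (time T)" by (rule L2_scaleR[OF h])
    have "(L2_norm (time T) (CS (\<lambda>t. s *\<^sub>R h t)))\<^sup>2 \<le> (K * L2_norm (time T) (\<lambda>t. s *\<^sub>R h t))\<^sup>2"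
      by (rule power_mono[OF K(2)[OF sh]]) simp
    then have 1: "(L2_norm (time T) (CS (\<lambda>t. s *\<^sub>R h t)))\<^sup>2 \<le> K\<^sup>2 * (s\<^sup>2 * (L2_norm (time T) h)\<^sup>2)"
      by (simp add: L2_norm_scaleR power_mult_distrib)
    have "J u \<le> J (\<lambda>t. u t + s *\<^sub>R h t)" by (rule min[OF L2_add[OF u sh]])
    then have 2: "0 \<le> s * (LINT t|time T. gradient u t \<bullet> h t)
        + ((L2_norm (time T) (CS (\<lambda>t. s *\<^sub>R h t)))\<^sup>2 + \<beta> * (s\<^sup>2 * (L2_norm (time T) h)\<^sup>2)) / 2"
      using reduced_cost_expansion[OF u sh] by (simp add: L2_norm_scaleR power_mult_distrib)
    have "s\<^sup>2 * ((K\<^sup>2 + \<beta>) * (L2_norm (time T) h)\<^sup>2 / 2)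
        = (K\<^sup>2 * (s\<^sup>2 * (L2_norm (time T) h)\<^sup>2) + \<beta> * (s\<^sup>2 * (L2_norm (time T) h)\<^sup>2)) / 2"
      by (simp add: algebra_simps)
    with 1 2 show "0 \<le> s * (LINT t|time T. gradient u t \<bullet> h t) + s\<^sup>2 * ((K\<^sup>2 + \<beta>) * (L2_norm (time T) h)\<^sup>2 / 2)"
      by argo
  qed
  then show ?thesis by (rule linear_coeff_zero)
qed

text \<open>The cost at \<open>v + h\<close> is expanded around \<open>u\<close> in direction
  \<open>e + h\<close> and around \<open>v\<close> in direction \<open>h\<close>. At
  \<open>u\<close> the gradient terms vanish, so comparing the two leaves exactly the mixed terms of
  the squares.\<close>

lemma gradient_error_identity:
  assumes u: "u \<in> L2 (time T)" and min: "\<And>v. v \<in> L2 (time T) \<Longrightarrow> J u \<le> J v"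
    and v: "v \<in> L2 (time T)" and h: "h \<in> L2 (time T)"
  shows "(LINT t|time T. gradient v t \<bullet> h t) =
    (LINT t|time T. CS (\<lambda>t. v t - u t) t \<bullet> CS h t) + \<beta> * (LINT t|time T. (v t - u t) \<bullet> h t)"
proof -
  define e where "e = (\<lambda>t. v t - u t)"
  have e: "e \<in> L2 (time T)" unfolding e_def by (rule L2_diff[OF v u])
  have eh: "(\<lambda>t. e t + h t) \<in> L2 (time T)" by (rule L2_add[OF e h])
  have "(\<lambda>t. u t + e t) = v" "(\<lambda>t. u t + (e t + h t)) = (\<lambda>t. v t + h t)" by (auto simp: e_def)
  moreover have "(L2_norm (time T) (CS (\<lambda>t. e t + h t)))\<^sup>2 = (L2_norm (time T) (\<lambda>t. CS e t + CS h t))\<^sup>2"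
    by (intro arg_cong[where f = "\<lambda>x. x\<^sup>2"] L2_norm_cong_AE CS_add e h L2_measurable CS_L2 eh L2_add)
  ultimately have "(LINT t|time T. gradient v t \<bullet> h t) = (LINT t|time T. CS e t \<bullet> CS h t) + \<beta> * (LINT t|time T. e t \<bullet> h t)"
    using reduced_cost_expansion[OF u e] reduced_cost_expansion[OF u eh] reduced_cost_expansion[OF v h]
      minimizer_gradient_zero[OF u min e] minimizer_gradient_zero[OF u min eh]
      L2_norm_add_square[OF e h] L2_norm_add_square[OF CS_L2[OF e] CS_L2[OF h]]
    by (simp add: field_simps)
  then show ?thesis unfolding e_def .
qed

lemma error_bounds:
  assumes u: "u \<in> L2 (time T)" and min: "\<And>v. v \<in> L2 (time T) \<Longrightarrow> J u \<le> J v" and v: "v \<in> L2 (time T)"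
  shows "lower_estimator T \<iota> A B C \<beta> yd y0 v \<le> L2_norm (time T) (\<lambda>t. u t - v t)"
    and "L2_norm (time T) (\<lambda>t. u t - v t) \<le> upper_estimator T \<iota> A B C \<beta> yd y0 v"
proof -
  define e where "e = (\<lambda>t. v t - u t)"
  define g where "g = gradient v"
  define c where "c = Ltwo_opnorm T CS"
  have e: "e \<in> L2 (time T)" unfolding e_def by (rule L2_diff[OF v u])
  have g: "g \<in> L2 (time T)" unfolding g_def by (rule gradient_L2[OF v])
  have id: "(LINT t|time T. g t \<bullet> h t) = (LINT t|time T. CS e t \<bullet> CS h t) + \<beta> * (LINT t|time T. e t \<bullet> h t)"
    if "h \<in> L2 (time T)" for h
    unfolding g_def e_def by (rule gradient_error_identity[OF u min v that])
  have norm_e: "L2_norm (time T) (\<lambda>t. u t - v t) = L2_norm (time T) e"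
    unfolding e_def by (rule L2_norm_minus_commute)
  let ?e = "L2_norm (time T) e" and ?g = "L2_norm (time T) g"
  have den: "\<beta> + c\<^sup>2 > 0" using \<beta> by (simp add: add_pos_nonneg)
  have "?g\<^sup>2 = (LINT t|time T. CS e t \<bullet> CS g t) + \<beta> * (LINT t|time T. e t \<bullet> g t)"
    using id[OF g] by (simp add: L2_norm_square power2_norm_eq_inner)
  \<comment> \<open>Cauchy-Schwarz for both pairings. The operator bound is then used once for
    \<open>e\<close> and once for \<open>g\<close>, which is the origin of the square in the lower
    estimator.\<close>
  also have "\<dots> \<le> L2_norm (time T) (CS e) * L2_norm (time T) (CS g) + \<beta> * (?e * ?g)"
    using L2_inner_le[OF CS_L2[OF e] CS_L2[OF g]] L2_inner_le[OF e g] \<beta>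
    by (intro add_mono mult_left_mono) (auto simp: abs_le_iff)
  also have "\<dots> \<le> (c * ?e) * (c * ?g) + \<beta> * (?e * ?g)"
    unfolding c_def using CS_opnorm[OF e] CS_opnorm[OF g] L2_norm_nonneg[of "time T" "CS e"]
    by (intro add_right_mono mult_mono) (auto intro: order_trans[OF L2_norm_nonneg])
  also have "\<dots> = ((\<beta> + c\<^sup>2) * ?e) * ?g" by (simp add: algebra_simps power2_eq_square)
  finally have le: "?g\<^sup>2 \<le> ((\<beta> + c\<^sup>2) * ?e) * ?g" .
  have "?g \<le> (\<beta> + c\<^sup>2) * ?e"
  proof (cases "?g = 0")
    case False
    then have "?g > 0" using L2_norm_nonneg[of "time T" g] by linarith
    with le show ?thesis
      unfolding power2_eq_square[of ?g] by (rule mult_right_le_imp_le)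
  qed (use den in simp)
  then show "lower_estimator T \<iota> A B C \<beta> yd y0 v \<le> L2_norm (time T) (\<lambda>t. u t - v t)"
    unfolding lower_estimator_def Ltwo_norm_eq_L2_norm reduced_gradient_norm[OF v] norm_e
    using den by (simp add: g_def c_def divide_le_eq mult.commute)
  \<comment> \<open>Adding the nonnegative contribution of \<open>CS e\<close> leaves
    \<open>\<beta>\<close> as the modulus of strong convexity, the constant in the upper
    estimator.\<close>
  have "\<beta> * ?e\<^sup>2 \<le> (L2_norm (time T) (CS e))\<^sup>2 + \<beta> * ?e\<^sup>2" by simp
  also have "\<dots> = (LINT t|time T. g t \<bullet> e t)"
    using id[OF e] by (simp add: L2_norm_square power2_norm_eq_inner)
  also have "\<dots> \<le> ?g * ?e" using L2_inner_le[OF g e] by simp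
  finally have le: "\<beta> * ?e\<^sup>2 \<le> ?g * ?e" .
  have "\<beta> * ?e \<le> ?g"
  proof (cases "?e = 0")
    case False
    then have "?e > 0" using L2_norm_nonneg[of "time T" e] by linarith
    with le show ?thesis
      unfolding power2_eq_square mult.assoc[symmetric] by (rule mult_right_le_imp_le)
  qed simp
  then show "L2_norm (time T) (\<lambda>t. u t - v t) \<le> upper_estimator T \<iota> A B C \<beta> yd y0 v"
    unfolding upper_estimator_def Ltwo_norm_eq_L2_norm reduced_gradient_norm[OF v] norm_e
    using \<beta> by (simp add: g_def field_simps)
qed

end

end

theorem corollary6:
  fixes T \<beta> :: real
    and \<iota> :: "'v::{real_inner, banach, second_countable_topology} \<Rightarrow>\<^sub>L
              'h::{real_inner, banach, second_countable_topology}"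
    and A :: "real \<Rightarrow> 'v \<Rightarrow>\<^sub>L 'v \<Rightarrow>\<^sub>L real"
    and B :: "'u::{real_inner, banach, second_countable_topology} \<Rightarrow>\<^sub>L 'v \<Rightarrow>\<^sub>L real"
    and C :: "real \<Rightarrow> 'h \<Rightarrow>\<^sub>L 'h"
    and yd :: "real \<Rightarrow> 'h" and y0 :: 'h
    and ubar utilde :: "real \<Rightarrow> 'u"
  assumes "T > 0"
    and "compact_dense_embedding \<iota>"
    and "Linfty_form T A" and "uniformly_coercive T A"
    and "Linfty_op T C"
    and "\<beta> > 0"
    and "yd \<in> Ltwo T"
    and "is_arg_min (reduced_cost T \<iota> A B C \<beta> yd y0) (\<lambda>u. u \<in> Ltwo T) ubar"
    and "utilde \<in> Ltwo T"
  shows "lower_estimator T \<iota> A B C \<beta> yd y0 utilde \<le> Ltwo_norm T (\<lambda>t. ubar t - utilde t) \<and>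
         Ltwo_norm T (\<lambda>t. ubar t - utilde t) \<le> upper_estimator T \<iota> A B C \<beta> yd y0 utilde"
proof -
  obtain \<eta> where \<eta>: "\<eta> > 0" "\<And>t v. t \<in> {0<..<T} \<Longrightarrow> \<eta> * (norm v)\<^sup>2 \<le> A t v v"
    using assms(4) unfolding uniformly_coercive_def by blast
  interpret parabolic_control T \<beta> \<iota> A B C yd \<eta>
    by unfold_locales
       (use assms \<eta> in \<open>simp_all add: compact_dense_embedding_def Ltwo_eq_L2\<close>)
  \<comment> \<open>\<open>is_arg_min\<close> says that no admissible control has strictly smaller
    cost; for real values this is the inequality needed.\<close>
  have "ubar \<in> L2 (time T)" "\<And>v. v \<in> L2 (time T) \<Longrightarrow> reduced_cost T \<iota> A B C \<beta> yd y0 ubar \<le> reduced_cost T \<iota> A B C \<beta> yd y0 v"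
    using assms(8) by (auto simp: is_arg_min_def Ltwo_eq_L2 not_less)
  from error_bounds[OF this] assms(9) show ?thesis
    by (simp add: Ltwo_eq_L2 Ltwo_norm_eq_L2_norm)
qed

end
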